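(* Let $X$ be a separable Banach space with norm $\|\cdot\|$. Fix a collection $\Lambda$ of distance-like functions $\rho:X\times X\to[0,1]$. Consider a family of Markov kernels $P_t^\theta$ on $X$ indexed by $t\in\mathbb R^+$ and a parameter $\theta$ varying in some set $\Theta$. Assume the following conditions: (H1) There exists a constant $\gamma\ge1$ such that for every $\rho\in\Lambda$ and $\alpha>0$ the distance-like function $\rho_\alpha$ satisfies $$\rho_\alpha(u,v)\le C\,[\rho_{\gamma\alpha}(u,w)+\rho_{\gamma\alpha}(w,v)]$$ for all $u,v,w\in X$ and for some constant $C>0$ (which may depend on $\rho$, $\alpha$ and $\gamma$). (H2) For each $\theta\in\Theta$, there exists a probability measure $\mu_\theta$ on $X$ which is invariant under $P_t^\theta$, $t\in\mathbb R^+$. (H3) There exist $\theta_0\in\Theta$ and $\alpha'>0$ such that for each $\alpha\in(0,\alpha']$ and for each $\rho\in\Lambda$ there exist functions $g:\Theta\to\mathbb R^+$, $R:\mathbb R^+\to\mathbb R^+$, and a measurable function $f:X\to\mathbb R^+\cup\{\infty\}$ such that $$\mathcal W_{\rho_\alpha}(P_t^\theta(u,\cdot),P_t^{\theta_0}(u,\cdot))\le R(t)f(u)g(\theta)$$ for all $\theta\in\Theta$, $t\in\mathbb R^+$ and $u\in X$. (H4) For every $m\ge1$, there exists $\alpha_m>0$ such that for each $\alpha\in(0,\alpha_m]$ there exist $\rho\in\Lambda$, $T>0$ and constants $C_1,C_2>0$ for which $$\sup_{\theta\in\Theta\setminus\{\theta_0\}}\mathcal W_{\rho_\alpha}(\mu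 P_t^\theta,\tilde\mu P_t^\theta)\le C_1e^{-tC_2}\,\mathcal W_{\rho_{\alpha/m}}(\mu,\tilde\mu)$$ for every $\mu,\tilde\mu\in\Pr(X)$ and $t\ge T$, with $\theta_0\in\Theta$ as in (H3). Additionally, regarding (H3), suppose that for each $\alpha\in(0,\alpha']$ and $\rho\in\Lambda$ the corresponding functions $R$, $g$ and $f$ satisfy: (H5) $R$ is continuous and strictly increasing; (H6) $g$ is bounded, and $\lim_{\theta\to\theta_0}g(\theta)=0$; (H7) $\int_Xf(u)\,\mu_{\theta_0}(du)<\infty$, with $\mu_{\theta_0}$ as in (H2). Then there exists $\hat\alpha>0$ such that for each fixed $\alpha\in(0,\hat\alpha]$ there exists $\rho\in\Lambda$ for which the following inequality holds for every $\theta\in\Theta$ and $\mu\in\Pr(X)$ with $\int_Xf(u)\,\mu(du)<\infty$: $$\sup_{t\in\mathbb R^+}\mathcal W_{\rho_\alpha}(\mu P_t^\theta,\mu P_t^{\theta_0})\le\tilde g(\theta)\Big[\mathcal W_{\rho_{\gamma\alpha}}(\mu,\mu_{\theta_0})+\int_Xf(u)\,\mu(du)+\int_Xf(u)\,\mu_{\theta_0}(du)\Big],$$ where, if $R$ is bounded, $$\tilde g(\theta)=C\,g(\theta),$$ and if $R$ is unbounded, $$\tilde g(\theta)=C\max\Big\{\exp\big(-C_2R^{-1}(C\,g(\theta)^{-q})\big),\ g(\theta),\ g(\theta)^{1-q}\Big\}$$ for $g(\theta)\ne0$, and $\tilde g(\theta)=0$ otherwise. Here, $q$ is any fixed number in $(0,1)$,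 $C>0$ is a constant which is independent of $\theta$, and $C_2$ is the constant from the inequality in (H4). Consequently, if additionally $\mathcal W_{\rho_{\gamma\alpha}}(\mu,\mu_{\theta_0})<\infty$, then $$\lim_{\theta\to\theta_0}\ \sup_{t\in\mathbb R^+}\mathcal W_{\rho_\alpha}(\mu P_t^\theta,\mu P_t^{\theta_0})=0.$$
   Context: $\Pr(X)$ is the set of Borel probability measures on $X$. A Markov kernel $P$ on $X$ is a map $(u,\mathcal O)\mapsto P(u,\mathcal O)\in[0,1]$, measurable in $u\in X$ and a Borel probability measure in $\mathcal O$; $\mu P(\mathcal O)=\int_X P(u,\mathcal O)\,\mu(du)$, and $\mu$ is invariant under $\{P_t\}_{t\ge0}$ if $\mu P_t=\mu$ for all $t\ge0$. A distance-like function on $X$ is a map $\rho:X\times X\to\mathbb R^+$ that is symmetric, lower semicontinuous, and satisfies $\rho(u,v)=0$ if and only if $u=v$. Its Wasserstein-like extension to $\Pr(X)$ is $\mathcal W_\rho(\mu,\tilde\mu)=\inf_\Gamma\int_{X\times X}\rho(u,v)\,\Gamma(du,dv)\in[0,\infty]$, the infimum being over all couplings $\Gamma$ of $\mu$ and $\tilde\mu$ (probability measures on $X\times X$ with marginals $\mu$ and $\tilde\mu$). For $\rho\in\Lambda$ and $a>0$, $\rho_a(u,v)=\rho(u,v)^{1/2}\exp(a\|u\|^2+a\|v\|^2)$, $u,v\in X$. In the conclusion, $R,g,f$ are the functions from (H3), and $R^{-1}$ is the inverse function of $R$. *)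

theory Defs
  imports "HOL-Probability.Probability"
begin

text \<open>Borel probability measures on \<open>X\<close>. A Markov kernel on \<open>X\<close> is a measurable map
  from \<open>X\<close> into the Giry space \<open>prob_algebra borel\<close>, whose sigma-algebra is the one generated
  by the evaluations \<open>\<mu> \<mapsto> \<mu>(A)\<close> with \<open>A\<close> Borel; the action \<open>\<mu>P\<close> is the monadic bind.\<close>

abbreviation Pr :: "'a::topological_space measure set" where
  "Pr \<equiv> space (prob_algebra borel)"

definition markov_kernel :: "('a::topological_space \<Rightarrow> 'a measure) \<Rightarrow> bool" where
  "markov_kernel P \<longleftrightarrow> P \<in> borel \<rightarrow>\<^sub>M prob_algebra borel"

definition invariant_under ::
    "(real \<Rightarrow> 'a::topological_space \<Rightarrow> 'a measure) \<Rightarrow> 'a measure \<Rightarrow> bool" where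
  "invariant_under P \<mu> \<longleftrightarrow> (\<forall>t\<ge>0. \<mu> \<bind> P t = \<mu>)"

text \<open>Lower semicontinuity on all of the space, by closedness of the sublevel sets.\<close>

definition lower_semicontinuous :: "('a::topological_space \<Rightarrow> real) \<Rightarrow> bool" where
  "lower_semicontinuous h \<longleftrightarrow> (\<forall>c. closed {x. h x \<le> c})"

definition distance_like :: "('a::topological_space \<Rightarrow> 'a \<Rightarrow> real) \<Rightarrow> bool" where
  "distance_like \<rho> \<longleftrightarrow>
     (\<forall>u v. 0 \<le> \<rho> u v) \<and>
     (\<forall>u v. \<rho> u v = \<rho> v u) \<and>
     lower_semicontinuous (\<lambda>(u, v). \<rho> u v) \<and>
     (\<forall>u v. \<rho> u v = 0 \<longleftrightarrow> u = v)"

text \<open>The weighted distance \<open>\<rho>\<^sub>a\<close>. Its generalized triangle inequality enlarges the exponent \<open>a\<close>;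
  hence, in the conclusion of the theorem for \<open>\<rho>\<^sub>\<alpha>\<close>, the functions \<open>R\<close>, \<open>g\<close>, \<open>f\<close> and the contraction
  rate are those belonging to some exponent \<open>\<beta> \<ge> \<alpha>\<close>.\<close>

definition weighted ::
    "('a::real_normed_vector \<Rightarrow> 'a \<Rightarrow> real) \<Rightarrow> real \<Rightarrow> 'a \<Rightarrow> 'a \<Rightarrow> real" where
  "weighted \<rho> a u v = sqrt (\<rho> u v) * exp (a * (norm u)\<^sup>2 + a * (norm v)\<^sup>2)"

definition couplings ::
    "'a::topological_space measure \<Rightarrow> 'a measure \<Rightarrow> ('a \<times> 'a) measure set" where
  "couplings \<mu> \<nu> = {\<Gamma> \<in> Pr. distr \<Gamma> borel fst = \<mu> \<and> distr \<Gamma> borel snd = \<nu>}"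

definition wasserstein ::
    "('a::topological_space \<Rightarrow> 'a \<Rightarrow> real) \<Rightarrow> 'a measure \<Rightarrow> 'a measure \<Rightarrow> ennreal" where
  "wasserstein \<rho> \<mu> \<nu> = (INF \<Gamma>\<in>couplings \<mu> \<nu>. \<integral>\<^sup>+ (u, v). ennreal (\<rho> u v) \<partial>\<Gamma>)"

text \<open>The prefactor \<open>\<tilde>g(\<theta>)\<close>, as a function of the value \<open>x = g(\<theta>)\<close>. \<open>R\<close> only matters on
  \<open>[0,\<infinity>)\<close>, and the same constant \<open>C\<close> appears outside and inside \<open>R\<^sup>-\<^sup>1\<close>. Since \<open>inv_into\<close>
  is arbitrary off the range of \<open>R\<close>, the theorem also states that \<open>C x\<^sup>-\<^sup>q\<close> lies in that range.\<close>

definition rate :: "(real \<Rightarrow> real) \<Rightarrow> real \<Rightarrow> real \<Rightarrow> real \<Rightarrow> real \<Rightarrow> real" where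
  "rate R C C2 q x =
     (if bounded (R ` {0..}) then C * x
      else if x = 0 then 0
      else C * Max {exp (- C2 * inv_into {0..} R (C * x powr (- q))), x, x powr (1 - q)})"

end

theory Submission
  imports Defs
begin

text \<open>Compare \<open>\<mu> P\<^sub>t\<^sup>\<theta>\<close> with \<open>\<mu> P\<^sub>t\<^sup>\<theta>\<^sup>0\<close> differently for small and for large times. For small \<open>t\<close> the kernels are
  compared pointwise, which costs \<open>R(t) g(\<theta>)\<close>. For large \<open>t\<close> both laws are compared with the invariant
  measure of \<open>\<theta>0\<close>: contraction forgets the initial law at rate \<open>exp (- C2 t)\<close>, and what remains is the
  stationary error \<open>\<W>(\<mu>\<^sub>0 P\<^sub>t\<^sup>\<theta>, \<mu>\<^sub>0)\<close>, which is of order \<open>g(\<theta>)\<close> uniformly in \<open>t\<close>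
  (\<open>large_time_bound\<close>). Switching at the time \<open>t\<close> with \<open>R(t) = C g(\<theta>)\<^sup>-\<^sup>q\<close> balances the two regimes and
  produces the stated rate; switching at a fixed late time and then letting \<open>\<theta>\<close> tend to \<open>\<theta>0\<close> gives the limit.

  The stationary error needs care, because the kernels \<open>P\<^sub>t\<close> need not form a semigroup and the invariant
  measures need not have exponential moments, so that no distance to them is known to be finite in
  advance. Fix one time \<open>\<tau>\<close> at which \<open>Q = P\<^sub>\<tau>\<^sup>\<theta>\<close> contracts strongly and iterate \<open>Q\<close>. The laws
  \<open>\<mu>\<^sub>0 Q\<^sup>n\<close> stay within \<open>O(g(\<theta>))\<close> of \<open>\<mu>\<^sub>0\<close>: each step starts from the perturbation error and contracts
  the rest by a fixed factor. They also converge to the invariant measure of \<open>Q\<close> for every truncated cost.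
  Hence the invariant measures of \<open>\<theta>\<close> and \<open>\<theta>0\<close> are \<open>O(g(\<theta>))\<close> apart for every truncated cost,
  and then for the cost itself (\<open>wasserstein_invariant_le\<close>). Contraction for \<open>\<theta>0\<close> itself, which
  is not a hypothesis, is the limit of contraction for neighbouring parameters (\<open>limit_contraction\<close>).
  Every use of the triangle inequality multiplies the exponent by \<open>\<gamma>\<close>, and contraction divides it by \<open>m\<close>. The
  longest chain uses five triangle inequalities, hence \<open>\<beta> = \<gamma>\<^sup>5 \<alpha>\<close> and \<open>m = \<gamma>\<^sup>4\<close>.

  Three properties of \<open>\<W>\<^sub>c\<close> carry this argument, for unbounded lower semicontinuous costs on a Polish space:
  convexity under mixing of kernels (\<open>wasserstein_bind_le\<close>), removal of truncations
  (\<open>wasserstein_le_truncated\<close>), and a triangle inequality (\<open>wasserstein_triangle\<close>). The usual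
  proofs select couplings measurably, or disintegrate and glue them. Here all three are read off from Kantorovich duality
  (\<open>dual_bound_coupling\<close>), where they become statements about pairs of functions with
  \<open>\<phi>(u) \<le> \<psi>(v) + c(u, v)\<close>. Duality in turn follows from compactness of the set of finitely additive
  probabilities on all subsets of \<open>X \<times> X\<close>. A separation argument produces such a probability with the
  right marginals and cost. The marginals make it tight, so it is countably additive on a generating algebra and
  extends to a Borel coupling, and lower semicontinuity keeps the cost from increasing.\<close>

section \<open>Systems of affine inequalities on a compact set\<close>

text \<open>A minimax principle: an infinite system \<open>j x \<le> 0\<close> of affine inequalities is solvable as soon as no
  finite nonnegative combination of it is bounded below by a positive constant. By compactness finitely many
  inequalities suffice. For those, minimize the sum of squares of the violations: if the minimum were positive, then
  the violations at the minimizer would themselves be the coefficients of a forbidden combination. The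
  operation \<open>mix\<close> stands for convex combination, which for set functions is taken pointwise.\<close>

lemma compact_affine_feasible:
  fixes S :: "'b::topological_space set" and J :: "('b \<Rightarrow> real) set"
    and mix :: "real \<Rightarrow> 'b \<Rightarrow> 'b \<Rightarrow> 'b"
  assumes S: "compact S"
    and cont: "\<And>j. j \<in> J \<Longrightarrow> continuous_on UNIV j"
    and mixS: "\<And>t x y. 0 \<le> t \<Longrightarrow> t \<le> 1 \<Longrightarrow> x \<in> S \<Longrightarrow> y \<in> S \<Longrightarrow> mix t x y \<in> S"
    and affine: "\<And>j t x y. j \<in> J \<Longrightarrow> 0 \<le> t \<Longrightarrow> t \<le> 1 \<Longrightarrow> x \<in> S \<Longrightarrow> y \<in> S \<Longrightarrow>
                   j (mix t x y) = (1 - t) * j x + t * j y"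
    and small: "\<And>J' r \<epsilon>. finite J' \<Longrightarrow> J' \<subseteq> J \<Longrightarrow> (\<And>j. j \<in> J' \<Longrightarrow> 0 \<le> r j) \<Longrightarrow> 0 < \<epsilon> \<Longrightarrow>
                   \<exists>x\<in>S. (\<Sum>j\<in>J'. r j * j x) \<le> (\<epsilon>::real)"
  shows "\<exists>x\<in>S. \<forall>j\<in>J. j x \<le> 0"
proof -
  have fin: "S \<inter> (\<Inter>j\<in>J'. {x. j x \<le> 0}) \<noteq> {}" if J': "finite J'" "J' \<subseteq> J" for J'
  proof -
    define F where "F x = (\<Sum>j\<in>J'. (max 0 (j x))\<^sup>2)" for x
    have "S \<noteq> {}" using small[of "{}" "\<lambda>_. 0" 1] by auto
    moreover have "continuous_on S F"
      unfolding F_def using J' cont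
      by (intro continuous_intros) (auto intro: continuous_on_subset)
    ultimately obtain x0 where x0: "x0 \<in> S" "\<And>x. x \<in> S \<Longrightarrow> F x0 \<le> F x"
      using continuous_attains_inf[OF S] by blast
    define r where "r j = max 0 (j x0)" for j :: "'b \<Rightarrow> real"
    have F0: "F x0 = (\<Sum>j\<in>J'. (r j)\<^sup>2)" by (simp add: F_def r_def)
    \<comment> \<open>First-order optimality of the minimizer in the direction of \<open>x\<close>.\<close>
    have opt: "F x0 \<le> (\<Sum>j\<in>J'. r j * j x)" if x: "x \<in> S" for x
    proof -
      define A where "A = (\<Sum>j\<in>J'. r j * (j x - j x0))"
      define B where "B = (\<Sum>j\<in>J'. (j x - j x0)\<^sup>2)"
      have quad: "0 \<le> 2 * A + t * B" if t: "0 < t" "t \<le> 1" for t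
      proof -
        have "F x0 \<le> F (mix t x0 x)" using t x x0 by (intro x0(2) mixS) auto
        also have "\<dots> \<le> (\<Sum>j\<in>J'. (r j + t * (j x - j x0))\<^sup>2)"
          unfolding F_def
        proof (rule sum_mono)
          fix j assume "j \<in> J'"
          then have e: "j (mix t x0 x) = j x0 + t * (j x - j x0)"
            using affine[of j t x0 x] J' t x x0 by (auto simp: algebra_simps)
          have "\<bar>max 0 (j (mix t x0 x))\<bar> \<le> \<bar>r j + t * (j x - j x0)\<bar>"
            unfolding e r_def by auto
          then show "(max 0 (j (mix t x0 x)))\<^sup>2 \<le> (r j + t * (j x - j x0))\<^sup>2"
            by (simp only: abs_le_square_iff)
        qed
        also have "\<dots> = F x0 + 2 * t * A + t\<^sup>2 * B"
          by (simp add: F0 A_def B_def power2_sum sum.distrib sum_distrib_left power_mult_distrib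
              mult.assoc mult.left_commute)
        finally have "0 \<le> t * (2 * A + t * B)" by (simp add: algebra_simps power2_eq_square)
        then show ?thesis using t by (simp add: zero_le_mult_iff)
      qed
      have "0 \<le> A"
      proof (rule ccontr)
        assume "\<not> 0 \<le> A"
        then have A: "A < 0" by simp
        have B: "0 \<le> B" by (simp add: B_def sum_nonneg)
        define t where "t = min 1 (- A / (B + 1))"
        have "0 < - A / (B + 1)" using A B by (intro divide_pos_pos) auto
        then have "0 < t" "t \<le> 1" by (auto simp: t_def)
        moreover have "t * B \<le> - A"
        proof -
          have "t * B \<le> (- A / (B + 1)) * B" using B by (intro mult_right_mono) (auto simp: t_def)
          also have "\<dots> \<le> - A" using A B by (simp add: field_simps)
          finally show ?thesis .
        qed
        ultimately show False using quad[of t] A by simp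
      qed
      moreover have "(\<Sum>j\<in>J'. r j * j x0) = F x0"
        unfolding F0 by (rule sum.cong) (auto simp: r_def power2_eq_square max_def)
      ultimately show ?thesis by (simp add: A_def algebra_simps sum_subtractf)
    qed
    have "F x0 \<le> \<epsilon>" if "0 < \<epsilon>" for \<epsilon>
      using small[OF J', of r \<epsilon>] opt that by (force simp: r_def)
    then have "F x0 \<le> 0" by (meson dense not_le)
    then have "\<forall>j\<in>J'. r j = 0"
      unfolding F0 using J'(1)
      by (metis (no_types, lifting) antisym sum_nonneg sum_nonneg_eq_0_iff zero_eq_power2 zero_le_power2)
    then have "\<forall>j\<in>J'. j x0 \<le> 0" by (metis max.cobounded2 r_def)
    then show ?thesis using x0(1) by auto
  qed
  have closed: "closed {x. j x \<le> 0}" if "j \<in> J" for j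
    using cont[OF that] by (intro closed_Collect_le continuous_intros)
  have "S \<inter> (\<Inter>j\<in>J. {x. j x \<le> 0}) \<noteq> {}"
    by (rule compact_imp_fip_image[OF S closed fin])
  then show ?thesis by auto
qed

section \<open>Finitely additive probabilities\<close>

definition charges :: "('b set \<Rightarrow> real) set" where
  "charges = {m. (\<forall>E. 0 \<le> m E) \<and> m UNIV = 1 \<and> (\<forall>E F. E \<inter> F = {} \<longrightarrow> m (E \<union> F) = m E + m F)}"

lemma
  assumes "m \<in> charges"
  shows charges_nonneg: "0 \<le> m E"
    and charges_UNIV: "m UNIV = 1"
    and charges_add: "E \<inter> F = {} \<Longrightarrow> m (E \<union> F) = m E + m F"
  using assms by (auto simp: charges_def)

lemma charges_empty: "m \<in> charges \<Longrightarrow> m {} = 0"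
  using charges_add[of m "{}" "{}"] by simp

lemma charges_mono: "m \<in> charges \<Longrightarrow> E \<subseteq> F \<Longrightarrow> m E \<le> m F"
  using charges_add[of m E "F - E"] charges_nonneg[of m "F - E"] by (simp add: Un_absorb1)

lemma charges_subadd: "m \<in> charges \<Longrightarrow> m (E \<union> F) \<le> m E + m F"
  using charges_add[of m E "F - E"] charges_mono[of m "F - E" F] by simp

lemma charges_sub_finite:
  assumes "m \<in> charges" shows "finite I \<Longrightarrow> m (\<Union>i\<in>I. E i) \<le> (\<Sum>i\<in>I. m (E i))"
proof (induction I rule: finite_induct)
  case empty then show ?case using charges_empty[OF assms] by simp
next
  case (insert i I)
  have "m (E i \<union> (\<Union>i\<in>I. E i)) \<le> m (E i) + m (\<Union>i\<in>I. E i)" by (rule charges_subadd[OF assms])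
  then show ?case using insert by simp
qed

lemma charges_le_1: "m \<in> charges \<Longrightarrow> m E \<le> 1"
  using charges_mono[of m E UNIV] charges_UNIV[of m] by simp

text \<open>Charges form a closed subset of a product of unit intervals, so Tychonoff's theorem applies.\<close>

lemma compact_charges: "compact (charges :: ('b set \<Rightarrow> real) set)"
proof -
  have "compactin (product_topology (\<lambda>_. euclidean) UNIV)
          (PiE UNIV (\<lambda>_. {0..1}) :: ('b set \<Rightarrow> real) set)"
    by (subst compactin_PiE) auto
  then have "compact (PiE UNIV (\<lambda>_. {0..1}) :: ('b set \<Rightarrow> real) set)"
    by (simp add: euclidean_product_topology)
  moreover have "closed (charges :: ('b set \<Rightarrow> real) set)"
  proof -
    have "charges = (\<Inter>E. {m :: 'b set \<Rightarrow> real. 0 \<le> m E}) \<inter> {m. m UNIV = 1} \<inter>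
        (\<Inter>E. \<Inter>F\<in>{F. E \<inter> F = {}}. {m. m (E \<union> F) = m E + m F})"
      by (auto simp: charges_def)
    also have "closed \<dots>"
      by (intro closed_Int closed_INT ballI closed_Collect_le closed_Collect_eq continuous_intros
          continuous_on_product_coordinates)
    finally show ?thesis .
  qed
  moreover have "charges \<subseteq> (PiE UNIV (\<lambda>_. {0..1}) :: ('b set \<Rightarrow> real) set)"
    by (auto simp: PiE_def charges_nonneg charges_le_1)
  ultimately show ?thesis by (metis compact_Int_closed inf.absorb_iff2)
qed

lemma charges_mix:
  assumes "0 \<le> t" "t \<le> 1" "m \<in> charges" "m' \<in> charges"
  shows "(\<lambda>E. (1 - t) * m E + t * m' E) \<in> charges"
  using assms charges_add[OF assms(3)] charges_add[OF assms(4)]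
  by (auto simp: charges_def distrib_left)

section \<open>Borel measures from tight charges\<close>

text \<open>Membership requires only inner approximation by compact sets, not measurability: a charge is defined on all subsets.\<close>

definition tight_sets :: "('b::metric_space set \<Rightarrow> real) \<Rightarrow> 'b set set" where
  "tight_sets m = {A. \<forall>\<epsilon>>0. \<exists>C. compact C \<and> C \<subseteq> A \<and> m (A - C) \<le> \<epsilon>}"

lemma tight_sets_Un:
  assumes m: "m \<in> charges" and A: "A \<in> tight_sets m" and B: "B \<in> tight_sets m"
  shows "A \<union> B \<in> tight_sets m"
  unfolding tight_sets_def
proof (intro CollectI allI impI)
  fix \<epsilon> :: real assume "0 < \<epsilon>"
  then have e: "0 < \<epsilon>/2" by simp
  obtain C where C: "compact C" "C \<subseteq> A" "m (A - C) \<le> \<epsilon>/2"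
    using A e unfolding tight_sets_def by blast
  obtain D where D: "compact D" "D \<subseteq> B" "m (B - D) \<le> \<epsilon>/2"
    using B e unfolding tight_sets_def by blast
  have "m (A \<union> B - (C \<union> D)) \<le> m ((A - C) \<union> (B - D))" by (rule charges_mono[OF m]) auto
  also have "\<dots> \<le> m (A - C) + m (B - D)" by (rule charges_subadd[OF m])
  also have "\<dots> \<le> \<epsilon>" using C D by simp
  finally show "\<exists>C. compact C \<and> C \<subseteq> A \<union> B \<and> m (A \<union> B - C) \<le> \<epsilon>"
    using C D by (intro exI[of _ "C \<union> D"]) auto
qed

lemma tight_sets_Int:
  assumes m: "m \<in> charges" and A: "A \<in> tight_sets m" and B: "B \<in> tight_sets m"
  shows "A \<inter> B \<in> tight_sets m"
  unfolding tight_sets_def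
proof (intro CollectI allI impI)
  fix \<epsilon> :: real assume "0 < \<epsilon>"
  then have e: "0 < \<epsilon>/2" by simp
  obtain C where C: "compact C" "C \<subseteq> A" "m (A - C) \<le> \<epsilon>/2"
    using A e unfolding tight_sets_def by blast
  obtain D where D: "compact D" "D \<subseteq> B" "m (B - D) \<le> \<epsilon>/2"
    using B e unfolding tight_sets_def by blast
  have "m (A \<inter> B - (C \<inter> D)) \<le> m ((A - C) \<union> (B - D))" by (rule charges_mono[OF m]) auto
  also have "\<dots> \<le> m (A - C) + m (B - D)" by (rule charges_subadd[OF m])
  also have "\<dots> \<le> \<epsilon>" using C D by simp
  finally show "\<exists>C. compact C \<and> C \<subseteq> A \<inter> B \<and> m (A \<inter> B - C) \<le> \<epsilon>"
    using C D by (intro exI[of _ "C \<inter> D"]) auto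
qed

text \<open>The classical compactness argument for countable additivity. Approximate \<open>A i\<close> from inside by compact
  sets with errors that add up to at most half of \<open>\<epsilon>\<close>. The intersection of the compact sets is empty, hence so
  is a finite one, and then \<open>A k\<close> is covered by the finitely many errors.\<close>

lemma tight_sets_continuous_at_empty:
  fixes m :: "'b::metric_space set \<Rightarrow> real"
  assumes m: "m \<in> charges" and A: "range A \<subseteq> tight_sets m" and dec: "decseq A"
    and empty: "(\<Inter>i. A i) = {}"
  shows "(\<lambda>i. m (A i)) \<longlonglongrightarrow> 0"
proof (rule LIMSEQ_I)
  fix \<epsilon> :: real assume \<epsilon>: "0 < \<epsilon>"
  have "\<exists>C. compact C \<and> C \<subseteq> A i \<and> m (A i - C) \<le> (\<epsilon>/4) * (1/2)^i" for i :: nat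
  proof -
    have "0 < (\<epsilon>/4) * (1/2)^i" using \<epsilon> by simp
    moreover have "A i \<in> tight_sets m" using A by auto
    ultimately show ?thesis unfolding tight_sets_def by blast
  qed
  then obtain C where C: "\<And>i. compact (C i)" "\<And>i. C i \<subseteq> A i"
      "\<And>i::nat. m (A i - C i) \<le> (\<epsilon>/4) * (1/2)^i"
    by metis
  have "\<exists>n. (\<Inter>i\<le>n. C i) = {}"
  proof (rule ccontr)
    assume "\<nexists>n. (\<Inter>i\<le>n. C i) = {}"
    then have ne: "(\<Inter>i\<le>n. C i) \<noteq> {}" for n by blast
    have "C 0 \<inter> (\<Inter>i\<in>UNIV. C i) \<noteq> {}"
    proof (rule compact_imp_fip_image[OF C(1)])
      show "closed (C i)" for i using C(1) compact_imp_closed by blast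
      fix I' :: "nat set" assume I': "finite I'"
      then obtain n where "\<forall>i\<in>I'. i \<le> n" by (meson finite_nat_set_iff_bounded_le)
      then show "C 0 \<inter> (\<Inter>i\<in>I'. C i) \<noteq> {}" using ne[of n] by fastforce
    qed
    moreover have "(\<Inter>i. C i) \<subseteq> (\<Inter>i. A i)" using C(2) by (rule INF_mono')
    ultimately show False unfolding empty by auto
  qed
  then obtain n where n: "(\<Inter>i\<le>n. C i) = {}" by blast
  have "m (A k) < \<epsilon>" if k: "n \<le> k" for k
  proof -
    have "A k \<subseteq> (\<Union>i\<le>n. A i - C i)"
    proof
      fix x assume x: "x \<in> A k"
      obtain i where i: "i \<le> n" "x \<notin> C i" using n by (auto simp: set_eq_iff)
      moreover have "x \<in> A i" using x decseqD[OF dec, of i k] k i by auto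
      ultimately show "x \<in> (\<Union>i\<le>n. A i - C i)" by blast
    qed
    then have "m (A k) \<le> m (\<Union>i\<le>n. A i - C i)" by (rule charges_mono[OF m])
    also have "\<dots> \<le> (\<Sum>i\<le>n. m (A i - C i))" by (rule charges_sub_finite[OF m]) simp
    also have "\<dots> \<le> (\<Sum>i\<le>n. (\<epsilon>/4) * (1/2)^i)" by (rule sum_mono) (rule C(3))
    also have "\<dots> = (\<epsilon>/4) * (\<Sum>i\<le>n. (1/2)^i)" by (simp add: sum_distrib_left)
    also have "\<dots> \<le> (\<epsilon>/4) * 2"
    proof -
      have "(\<Sum>i\<le>n. (1/2::real)^i) \<le> 2"
        using sum_le_suminf[of "\<lambda>i. (1/2::real)^i" "{..n}"]
        by (simp add: suminf_geometric summable_geometric)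
      then show ?thesis using \<epsilon> by (intro mult_left_mono) auto
    qed
    also have "\<dots> < \<epsilon>" using \<epsilon> by simp
    finally show ?thesis .
  qed
  then show "\<exists>no. \<forall>k\<ge>no. norm (m (A k) - 0) < \<epsilon>"
    using charges_nonneg[OF m] by (intro exI[of _ n]) auto
qed

text \<open>The sets that are inner approximable together with their complement form an algebra, on which the charge is
  continuous at the empty set, so Caratheodory's theorem extends it. On open sets only an inequality survives: an open set is an increasing union of members of the algebra, and a charge may jump up in such a limit.
  For marginals and for lower semicontinuous costs this inequality has the right direction.\<close>

lemma tight_charge_measure:
  fixes m :: "'b::metric_space set \<Rightarrow> real"
  assumes m: "m \<in> charges" and B: "countable B" "topological_basis B"
    and tight: "\<And>b. b \<in> B \<Longrightarrow> b \<in> tight_sets m" "\<And>b. b \<in> B \<Longrightarrow> - b \<in> tight_sets m"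
      "UNIV \<in> tight_sets m"
  shows "\<exists>\<Gamma>\<in>Pr. \<forall>G. open G \<longrightarrow> measure \<Gamma> G \<le> m G"
proof -
  define \<R> where "\<R> = {A. A \<in> sets borel \<and> A \<in> tight_sets m \<and> - A \<in> tight_sets m}"
  have e0: "{} \<in> tight_sets m" using charges_empty[OF m] by (auto simp: tight_sets_def)
  interpret algebra UNIV \<R>
    unfolding algebra_iff_Int
    using tight_sets_Un[OF m] tight_sets_Int[OF m] tight(3) e0
    by (auto simp: \<R>_def Compl_eq_Diff_UNIV[symmetric])
  have B\<R>: "B \<subseteq> \<R>"
    using tight B(2) by (auto simp: \<R>_def intro: topological_basis_open borel_open)
  have "\<exists>\<mu>. (\<forall>s\<in>\<R>. \<mu> s = ennreal (m s)) \<and> measure_space UNIV (sigma_sets UNIV \<R>) \<mu>"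
  proof (rule caratheodory_empty_continuous)
    show "positive \<R> (\<lambda>s. ennreal (m s))" using charges_empty[OF m] by (simp add: positive_def)
    show "additive \<R> (\<lambda>s. ennreal (m s))"
      by (auto simp: additive_def charges_add[OF m] charges_nonneg[OF m])
    fix A :: "nat \<Rightarrow> 'b set"
    assume "range A \<subseteq> \<R>" "decseq A" "(\<Inter>i. A i) = {}"
    then have "(\<lambda>i. m (A i)) \<longlonglongrightarrow> 0"
      by (intro tight_sets_continuous_at_empty[OF m]) (auto simp: \<R>_def)
    then show "(\<lambda>i. ennreal (m (A i))) \<longlonglongrightarrow> 0"
      by (metis ennreal_0 tendsto_ennrealI)
  qed auto
  then obtain \<mu> where \<mu>: "\<And>s. s \<in> \<R> \<Longrightarrow> \<mu> s = ennreal (m s)"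
      and ms: "measure_space UNIV (sigma_sets UNIV \<R>) \<mu>" by auto
  have sig: "sigma_sets UNIV \<R> = sets borel"
  proof
    have "\<R> \<subseteq> sets borel" by (auto simp: \<R>_def)
    then show "sigma_sets UNIV \<R> \<subseteq> sets borel"
      using sets.sigma_sets_subset[of \<R> borel] by simp
    have "sets borel = sigma_sets UNIV B"
      by (subst borel_eq_countable_basis[OF B]) simp
    also have "\<dots> \<subseteq> sigma_sets UNIV \<R>" using B\<R> by (rule sigma_sets_mono')
    finally show "sets borel \<subseteq> sigma_sets UNIV \<R>" .
  qed
  define \<Gamma> where "\<Gamma> = measure_of UNIV (sets (borel::'b measure)) \<mu>"
  have sets\<Gamma>[simp]: "sets \<Gamma> = sets borel" "space \<Gamma> = UNIV"
    using sets.sigma_sets_eq[of "borel::'b measure"] by (simp_all add: \<Gamma>_def)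
  have em: "emeasure \<Gamma> A = \<mu> A" if "A \<in> sets borel" for A
    unfolding \<Gamma>_def using ms that sets.sigma_sets_eq[of "borel::'b measure"]
    by (intro emeasure_measure_of_sigma)
       (auto simp: measure_space_def sig sets.sigma_algebra_axioms[of "borel::'b measure", simplified])
  have em\<R>: "emeasure \<Gamma> A = ennreal (m A)" if "A \<in> \<R>" for A
    using em[of A] \<mu>[OF that] that by (auto simp: \<R>_def)
  have "emeasure \<Gamma> (space \<Gamma>) = 1"
    using em\<R>[OF top] charges_UNIV[OF m] by simp
  then interpret \<Gamma>: prob_space \<Gamma> by (rule prob_spaceI)
  have "measure \<Gamma> G \<le> m G" if G: "open G" for G
  proof (cases "G = {}")
    case True then show ?thesis using charges_nonneg[OF m] by simp
  next
    case False
    obtain B' where B': "B' \<subseteq> B" "G = \<Union>B'"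
      using topological_basisE B(2) G by (metis topological_basis_def)
    have cB': "countable B'" "B' \<noteq> {}" using B' B(1) countable_subset False by auto
    define U where "U n = (\<Union>i\<le>n. from_nat_into B' i)" for n :: nat
    have U\<R>: "U n \<in> \<R>" for n
      unfolding U_def using B\<R> B'(1) from_nat_into[OF cB'(2)]
      by (intro finite_UN) auto
    have "(\<Union>n. U n) = G"
    proof -
      have "(\<Union>n. U n) = \<Union> (range (from_nat_into B'))" by (auto simp: U_def)
      then show ?thesis by (simp add: B'(2) range_from_nat_into[OF cB'(2,1)])
    qed
    moreover have "incseq U" unfolding incseq_def U_def by (intro allI impI UN_mono) auto
    ultimately have "(\<lambda>n. measure \<Gamma> (U n)) \<longlonglongrightarrow> measure \<Gamma> G"
      using \<Gamma>.finite_Lim_measure_incseq[of U] U\<R> by (auto simp: \<R>_def)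
    moreover have "measure \<Gamma> (U n) \<le> m G" for n
    proof -
      have "measure \<Gamma> (U n) = m (U n)"
        using em\<R>[OF U\<R>] charges_nonneg[OF m] by (simp add: measure_def)
      also have "\<dots> \<le> m G" using \<open>(\<Union>n. U n) = G\<close> by (intro charges_mono[OF m]) auto
      finally show ?thesis .
    qed
    ultimately show ?thesis by (intro LIMSEQ_le_const2) auto
  qed
  then show ?thesis
    using \<Gamma>.prob_space_axioms by (intro bexI[of _ \<Gamma>]) (auto simp: space_prob_algebra)
qed

section \<open>Borel probability measures on Polish spaces\<close>

lemma Pr_iff: "\<mu> \<in> Pr \<longleftrightarrow> sets \<mu> = sets borel \<and> prob_space \<mu>"
  by (auto simp: space_prob_algebra)

lemma Pr_space: "\<mu> \<in> Pr \<Longrightarrow> space \<mu> = UNIV"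
  using sets_eq_imp_space_eq[of \<mu> borel] by (auto simp: Pr_iff)

lemma Pr_measurable: "\<mu> \<in> Pr \<Longrightarrow> f \<in> borel \<rightarrow>\<^sub>M N \<Longrightarrow> f \<in> \<mu> \<rightarrow>\<^sub>M N"
  using measurable_cong_sets[of \<mu> borel N N] by (auto simp: Pr_iff)

lemma Pr_integrable:
  fixes f :: "'a::topological_space \<Rightarrow> real"
  assumes "\<mu> \<in> Pr" "f \<in> borel_measurable borel" "\<And>x. \<bar>f x\<bar> \<le> K"
  shows "integrable \<mu> f"
proof -
  interpret prob_space \<mu> using assms(1) by (simp add: Pr_iff)
  show ?thesis
    using Pr_measurable[OF assms(1,2)] assms(3) by (intro integrable_const_bound[of _ K]) auto
qed

lemma Pr_compact_approx:
  fixes \<mu> :: "'a::{second_countable_topology, complete_space} measure"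
  assumes \<mu>: "\<mu> \<in> Pr" and A: "A \<in> sets borel" and e: "0 < \<epsilon>"
  shows "\<exists>C. compact C \<and> C \<subseteq> A \<and> measure \<mu> (A - C) \<le> \<epsilon>"
proof -
  interpret prob_space \<mu> using \<mu> by (simp add: Pr_iff)
  have s: "sets \<mu> = sets borel" using \<mu> by (simp add: Pr_iff)
  have eq: "emeasure \<mu> A = (SUP K \<in> {K. K \<subseteq> A \<and> compact K}. emeasure \<mu> K)"
    by (rule inner_regular[OF s _ A]) simp
  have ne: "{K. K \<subseteq> A \<and> compact K} \<noteq> {}" by auto
  have "\<exists>C\<in>{K. K \<subseteq> A \<and> compact K}. emeasure \<mu> A < emeasure \<mu> C + \<epsilon>"
    by (rule SUP_approx_ennreal[OF e ne eq]) simp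
  then obtain C where C: "C \<subseteq> A" "compact C" "emeasure \<mu> A < emeasure \<mu> C + \<epsilon>" by auto
  have C': "C \<in> sets borel" using C(2) by (simp add: borel_compact)
  have "measure \<mu> A < measure \<mu> C + \<epsilon>"
    using C(3) e by (simp add: emeasure_eq_measure ennreal_less_iff flip: ennreal_plus)
  then have "measure \<mu> (A - C) \<le> \<epsilon>"
    using finite_measure_Diff[of A C] A C' C(1) s by simp
  then show ?thesis using C by blast
qed

text \<open>Outer regularity carries the inequality to all Borel sets, and passing to complements reverses it.\<close>

lemma Pr_eqI_open_le:
  fixes \<mu> \<nu> :: "'a::{second_countable_topology, complete_space} measure"
  assumes \<mu>: "\<mu> \<in> Pr" and \<nu>: "\<nu> \<in> Pr" and le: "\<And>G. open G \<Longrightarrow> emeasure \<nu> G \<le> emeasure \<mu> G"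
  shows "\<nu> = \<mu>"
proof -
  interpret M: prob_space \<mu> using \<mu> by (simp add: Pr_iff)
  interpret N: prob_space \<nu> using \<nu> by (simp add: Pr_iff)
  have s: "sets \<mu> = sets borel" "sets \<nu> = sets borel" using \<mu> \<nu> by (auto simp: Pr_iff)
  have le': "emeasure \<nu> A \<le> emeasure \<mu> A" if A: "A \<in> sets borel" for A
  proof -
    have "emeasure \<nu> A = (INF U \<in> {U. A \<subseteq> U \<and> open U}. emeasure \<nu> U)"
      by (rule outer_regular[OF s(2) _ A]) simp
    also have "\<dots> \<le> (INF U \<in> {U. A \<subseteq> U \<and> open U}. emeasure \<mu> U)"
      using le by (intro INF_mono) auto
    also have "\<dots> = emeasure \<mu> A"
      by (rule outer_regular[OF s(1) _ A, symmetric]) simp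
    finally show ?thesis .
  qed
  show ?thesis
  proof (rule measure_eqI)
    fix A assume "A \<in> sets \<nu>"
    then have A: "A \<in> sets borel" using s by simp
    have "measure \<nu> A \<le> measure \<mu> A" "measure \<nu> (UNIV - A) \<le> measure \<mu> (UNIV - A)"
      using le'[of A] le'[of "UNIV - A"] A by (auto simp: M.emeasure_eq_measure N.emeasure_eq_measure)
    then have "measure \<nu> A = measure \<mu> A"
      using M.prob_compl[of A] N.prob_compl[of A] A s Pr_space[OF \<mu>] Pr_space[OF \<nu>] by simp
    then show "emeasure \<nu> A = emeasure \<mu> A" by (simp add: M.emeasure_eq_measure N.emeasure_eq_measure)
  qed (simp add: s)
qed

lemma lsc_borel_measurable:
  assumes "lower_semicontinuous h" shows "h \<in> borel_measurable borel"
  by (rule borel_measurableI_le) (use assms in \<open>auto simp: lower_semicontinuous_def\<close>)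

lemma lsc_cost_measurable:
  fixes c :: "'a::second_countable_topology \<Rightarrow> 'a \<Rightarrow> real"
  assumes "lower_semicontinuous (\<lambda>(u, v). c u v)"
  shows "(\<lambda>(u, v). ennreal (c u v)) \<in> borel_measurable borel"
proof -
  have "(\<lambda>x. ennreal ((\<lambda>(u, v). c u v) x)) \<in> borel_measurable borel"
    by (intro measurable_compose[OF lsc_borel_measurable[OF assms] measurable_ennreal])
  then show ?thesis by (simp add: case_prod_beta')
qed

section \<open>Kantorovich duality\<close>

text \<open>The statement that the Kantorovich dual problem has value at most \<open>s\<close>. Writing the constraint as
  \<open>\<phi> u \<le> \<psi> v + c u v\<close> keeps all integrals nonnegative. The bound on \<open>\<phi>\<close> is what
  lets truncations of the cost be removed later.\<close>

definition dual_bound ::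
    "('a::topological_space \<Rightarrow> 'a \<Rightarrow> real) \<Rightarrow> 'a measure \<Rightarrow> 'a measure \<Rightarrow> ennreal \<Rightarrow> bool" where
  "dual_bound c \<mu> \<nu> s \<longleftrightarrow>
     (\<forall>\<phi>\<in>borel_measurable borel. \<forall>\<psi>\<in>borel_measurable borel. \<forall>K::real.
        (\<forall>u. \<phi> u \<le> ennreal K) \<longrightarrow> (\<forall>u v. \<phi> u \<le> \<psi> v + ennreal (c u v)) \<longrightarrow>
        (\<integral>\<^sup>+u. \<phi> u \<partial>\<mu>) \<le> (\<integral>\<^sup>+v. \<psi> v \<partial>\<nu>) + s)"

text \<open>Signed test functions are reduced to nonnegative ones by a common shift and by scaling with \<open>1 / k\<close>.\<close>

lemma dual_bound_real:
  fixes \<Phi> \<Psi> :: "'a::topological_space \<Rightarrow> real"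
  assumes \<mu>: "\<mu> \<in> Pr" and \<nu>: "\<nu> \<in> Pr" and s: "0 \<le> s" and k: "0 < k"
    and c: "\<And>u v. 0 \<le> c u v"
    and dual: "dual_bound c \<mu> \<nu> (ennreal s)"
    and [measurable]: "\<Phi> \<in> borel_measurable borel" "\<Psi> \<in> borel_measurable borel"
    and b: "\<And>u. \<bar>\<Phi> u\<bar> \<le> B" "\<And>v. \<bar>\<Psi> v\<bar> \<le> B"
    and le: "\<And>u v. \<Phi> u \<le> \<Psi> v + k * c u v"
  shows "(\<integral>u. \<Phi> u \<partial>\<mu>) \<le> (\<integral>v. \<Psi> v \<partial>\<nu>) + k * s"
proof -
  interpret M: prob_space \<mu> using \<mu> by (simp add: Pr_iff)
  interpret N: prob_space \<nu> using \<nu> by (simp add: Pr_iff)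
  note int = Pr_integrable[OF \<mu> assms(7) b(1)] Pr_integrable[OF \<nu> assms(8) b(2)]
  have nn: "0 \<le> (\<Phi> u + B) / k" "0 \<le> (\<Psi> u + B) / k" for u
    using b(1)[of u] b(2)[of u] k by auto
  have "(\<integral>\<^sup>+u. ennreal ((\<Phi> u + B) / k) \<partial>\<mu>) \<le> (\<integral>\<^sup>+v. ennreal ((\<Psi> v + B) / k) \<partial>\<nu>) + ennreal s"
  proof (rule dual[unfolded dual_bound_def, rule_format])
    show "ennreal ((\<Phi> u + B) / k) \<le> ennreal (2 * B / k)" for u
      using b(1)[of u] k by (intro ennreal_leI divide_right_mono) auto
    show "ennreal ((\<Phi> u + B) / k) \<le> ennreal ((\<Psi> v + B) / k) + ennreal (c u v)" for u v
    proof -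
      have "(\<Phi> u + B) / k \<le> (\<Psi> v + k * c u v + B) / k"
        using le[of u v] k by (intro divide_right_mono) auto
      also have "\<dots> = (\<Psi> v + B) / k + c u v" using k by (simp add: add_divide_distrib)
      finally have "ennreal ((\<Phi> u + B) / k) \<le> ennreal ((\<Psi> v + B) / k + c u v)"
        by (rule ennreal_leI)
      then show ?thesis by (simp only: ennreal_plus[OF nn(2) c])
    qed
  qed auto
  moreover have "(\<integral>\<^sup>+u. ennreal ((\<Phi> u + B) / k) \<partial>\<mu>) = ennreal (((\<integral>u. \<Phi> u \<partial>\<mu>) + B) / k)"
    using int nn by (subst nn_integral_eq_integral) (auto simp: M.prob_space)
  moreover have "(\<integral>\<^sup>+u. ennreal ((\<Psi> u + B) / k) \<partial>\<nu>) = ennreal (((\<integral>u. \<Psi> u \<partial>\<nu>) + B) / k)"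
    using int nn by (subst nn_integral_eq_integral) (auto simp: N.prob_space)
  moreover have "0 \<le> ((\<integral>u. \<Psi> u \<partial>\<nu>) + B) / k"
  proof -
    have "0 \<le> (\<integral>u. (\<Psi> u + B) / k \<partial>\<nu>)" using nn by (intro integral_nonneg_AE) auto
    then show ?thesis using int by (simp add: N.prob_space)
  qed
  ultimately have "((\<integral>u. \<Phi> u \<partial>\<mu>) + B) / k \<le> ((\<integral>u. \<Psi> u \<partial>\<nu>) + B) / k + s"
    using s by (simp add: ennreal_plus[symmetric] del: ennreal_plus)
  then have "k * (\<integral>u. \<Phi> u \<partial>\<mu>) \<le> k * ((\<integral>v. \<Psi> v \<partial>\<nu>) + k * s)"
    using k by (simp add: field_simps)
  then show ?thesis using k by (simp only: mult_le_cancel_left_pos)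
qed

text \<open>The layer cake approximation of a number \<open>x\<close> with step \<open>\<delta>\<close> and \<open>N\<close> layers. It turns
  an integral into a finite combination of values on superlevel sets, which makes sense for a charge.\<close>

lemma layer_sum_bounds:
  fixes \<delta> x :: real and N :: nat
  assumes "0 < \<delta>" "0 \<le> x"
  defines "f \<equiv> \<lambda>N. \<Sum>i<N. \<delta> * (if real (Suc i) * \<delta> < x then 1 else 0)"
  shows "f N \<le> x" and "min x (real N * \<delta>) \<le> \<delta> + f N"
proof -
  have "f N \<le> x \<and> f N \<le> real N * \<delta> \<and> min x (real N * \<delta>) \<le> \<delta> + f N \<and>
      (real N * \<delta> < x \<longrightarrow> f N = real N * \<delta>)"
  proof (induction N)
    case 0 then show ?case using assms by (simp add: f_def)
  next
    case (Suc N)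
    have "f (Suc N) = f N + (if real (Suc N) * \<delta> < x then \<delta> else 0)" by (simp add: f_def)
    moreover have "real (Suc N) * \<delta> = real N * \<delta> + \<delta>" by (simp add: algebra_simps)
    ultimately show ?case using Suc assms(1) by (auto simp: min_def split: if_splits)
  qed
  then show "f N \<le> x" "min x (real N * \<delta>) \<le> \<delta> + f N" by auto
qed

text \<open>The linear programming core of the duality theorem. The constraints on the charge are affine and continuous in
  it, so the minimax principle applies, and it remains to find for every finite nonnegative combination
  of the constraints a point mass at which it is small. If there were none, the combination would be dominated by an expression
  \<open>\<Phi>(u) + \<Psi>(v) + k c(u, v)\<close> that stays above \<open>\<epsilon>\<close>, and this contradicts the dual bound.
  Upper bounds for the marginals are enough, since complements turn them into equalities.\<close>

lemma charge_with_bounds: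
  fixes c :: "'a::topological_space \<Rightarrow> 'a \<Rightarrow> real"
  assumes \<mu>: "\<mu> \<in> Pr" and \<nu>: "\<nu> \<in> Pr" and s: "0 \<le> s" and c: "\<And>u v. 0 \<le> c u v"
    and dual: "dual_bound c \<mu> \<nu> (ennreal s)"
  shows "\<exists>m\<in>charges. (\<forall>A\<in>sets borel. m (A \<times> UNIV) \<le> measure \<mu> A) \<and>
           (\<forall>A\<in>sets borel. m (UNIV \<times> A) \<le> measure \<nu> A) \<and>
           (\<forall>\<delta>>0. \<forall>N. (\<Sum>i<N. \<delta> * m {(u, v). real (Suc i) * \<delta> < c u v}) \<le> s)"
proof -
  interpret M: prob_space \<mu> using \<mu> by (simp add: Pr_iff)
  interpret N: prob_space \<nu> using \<nu> by (simp add: Pr_iff)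
  define J1 where "J1 = (\<lambda>A (m :: ('a \<times> 'a) set \<Rightarrow> real). m (A \<times> UNIV) - measure \<mu> A) ` sets borel"
  define J2 where "J2 = (\<lambda>A (m :: ('a \<times> 'a) set \<Rightarrow> real). m (UNIV \<times> A) - measure \<nu> A) ` sets borel"
  define J3 where "J3 = {(\<lambda>m. (\<Sum>i<N. \<delta> * m {(u, v). real (Suc i) * \<delta> < c u v}) - s) |\<delta> N. 0 < \<delta>}"
  define J where "J = J1 \<union> J2 \<union> J3"
  define dirac where "dirac u v = (\<lambda>E. indicator E (u, v) :: real)" for u v :: 'a
  have diracC: "dirac u v \<in> charges" for u v by (auto simp: dirac_def charges_def indicator_def)
  \<comment> \<open>Each constraint, evaluated at a point mass, is at most a function of the form \<open>\<Phi>(u) + \<Psi>(v) + k c(u, v)\<close> whose dual value is nonpositive.\<close>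
  define dominates where "dominates j \<Phi> \<Psi> k B \<longleftrightarrow>
      \<Phi> \<in> borel_measurable borel \<and> \<Psi> \<in> borel_measurable borel \<and>
      (\<forall>u. \<bar>\<Phi> u\<bar> \<le> B) \<and> (\<forall>u. \<bar>\<Psi> u\<bar> \<le> B) \<and> 0 \<le> k \<and>
      (\<forall>u v. j (dirac u v) \<le> \<Phi> u + \<Psi> v + k * c u v) \<and>
      (\<integral>u. \<Phi> u \<partial>\<mu>) + (\<integral>v. \<Psi> v \<partial>\<nu>) + k * s \<le> (0::real)" for j \<Phi> \<Psi> k B
  have dom: "\<exists>\<Phi> \<Psi> k B. dominates j \<Phi> \<Psi> k B"
    if jJ: "j \<in> J" for j
  proof -
    consider (1) "j \<in> J1" | (2) "j \<in> J2" | (3) "j \<in> J3" using jJ unfolding J_def by blast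
    then show ?thesis
    proof cases
      case 1
      then obtain A where 1: "A \<in> sets borel" "j = (\<lambda>m. m (A \<times> UNIV) - measure \<mu> A)"
        by (auto simp: J1_def)
      have "(\<integral>u. (indicator A u - measure \<mu> A :: real) \<partial>\<mu>) = 0"
        using 1(1) \<mu> by (subst Bochner_Integration.integral_diff)
          (auto simp: Pr_iff M.prob_space M.emeasure_eq_measure)
      then show ?thesis using 1 unfolding dominates_def
        by (intro exI[of _ "\<lambda>u. indicator A u - measure \<mu> A"] exI[of _ "\<lambda>_. 0"] exI[of _ 0] exI[of _ 1])
           (auto simp: dirac_def indicator_def)
    next
      case 2
      then obtain A where 2: "A \<in> sets borel" "j = (\<lambda>m. m (UNIV \<times> A) - measure \<nu> A)"
        by (auto simp: J2_def)
      have "(\<integral>u. (indicator A u - measure \<nu> A :: real) \<partial>\<nu>) = 0"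
        using 2(1) \<nu> by (subst Bochner_Integration.integral_diff)
          (auto simp: Pr_iff N.prob_space N.emeasure_eq_measure)
      then show ?thesis using 2 unfolding dominates_def
        by (intro exI[of _ "\<lambda>_. 0"] exI[of _ "\<lambda>u. indicator A u - measure \<nu> A"] exI[of _ 0] exI[of _ 1])
           (auto simp: dirac_def indicator_def)
    next
      case 3
      then obtain \<delta> N where 3: "0 < \<delta>"
          "j = (\<lambda>m. (\<Sum>i<N. \<delta> * m {(u, v). real (Suc i) * \<delta> < c u v}) - s)"
        unfolding J3_def by blast
      have "j (dirac u v) \<le> c u v - s" for u v
      proof -
        have "j (dirac u v) = (\<Sum>i<N. \<delta> * (if real (Suc i) * \<delta> < c u v then 1 else 0)) - s"
          unfolding 3(2) dirac_def indicator_def by (simp only: mem_Collect_eq prod.case of_bool_def)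
        then show ?thesis using layer_sum_bounds(1)[OF 3(1) c[of u v], where N = N] by linarith
      qed
      then show ?thesis using s unfolding dominates_def
        by (intro exI[of _ "\<lambda>_. - s"] exI[of _ "\<lambda>_. 0"] exI[of _ 1] exI[of _ s])
           (auto simp: M.prob_space algebra_simps)
    qed
  qed
  then obtain \<Phi> \<Psi> k B where "\<And>j. j \<in> J \<Longrightarrow> dominates j (\<Phi> j) (\<Psi> j) (k j) (B j)"
    by metis
  then have D: "\<And>j. j \<in> J \<Longrightarrow> \<Phi> j \<in> borel_measurable borel"
      "\<And>j. j \<in> J \<Longrightarrow> \<Psi> j \<in> borel_measurable borel"
      "\<And>j u. j \<in> J \<Longrightarrow> \<bar>\<Phi> j u\<bar> \<le> B j" "\<And>j u. j \<in> J \<Longrightarrow> \<bar>\<Psi> j u\<bar> \<le> B j"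
      "\<And>j. j \<in> J \<Longrightarrow> 0 \<le> k j"
      "\<And>j u v. j \<in> J \<Longrightarrow> j (dirac u v) \<le> \<Phi> j u + \<Psi> j v + k j * c u v"
      "\<And>j. j \<in> J \<Longrightarrow> (\<integral>u. \<Phi> j u \<partial>\<mu>) + (\<integral>v. \<Psi> j v \<partial>\<nu>) + k j * s \<le> (0::real)"
    unfolding dominates_def by blast+
  have "\<exists>m\<in>charges. \<forall>j\<in>J. j m \<le> 0"
  proof (rule compact_affine_feasible[where mix = "\<lambda>t m m' E. (1 - t) * m E + t * m' E"])
    show "compact (charges :: (('a \<times> 'a) set \<Rightarrow> real) set)" by (rule compact_charges)
    show "continuous_on UNIV j" if "j \<in> J" for j
      using that unfolding J_def J1_def J2_def J3_def
      by (auto intro!: continuous_intros continuous_on_product_coordinates)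
    show "(\<lambda>E. (1 - t) * m E + t * m' E) \<in> charges"
      if "0 \<le> t" "t \<le> 1" "m \<in> charges" "m' \<in> charges" for t and m m' :: "('a \<times> 'a) set \<Rightarrow> real"
      using charges_mix[OF that] .
    show "j (\<lambda>E. (1 - t) * m E + t * m' E) = (1 - t) * j m + t * j m'" if "j \<in> J" for j t m m'
      using that unfolding J_def J1_def J2_def J3_def
      by (auto simp: algebra_simps sum.distrib sum_distrib_left sum_subtractf)
    fix J' and r :: "((('a \<times> 'a) set \<Rightarrow> real) \<Rightarrow> real) \<Rightarrow> real" and \<epsilon> :: real
    assume J': "finite J'" "J' \<subseteq> J" and r: "\<And>j. j \<in> J' \<Longrightarrow> 0 \<le> r j" and \<epsilon>: "0 < \<epsilon>"
    show "\<exists>m\<in>charges. (\<Sum>j\<in>J'. r j * j m) \<le> \<epsilon>"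
    proof (rule ccontr)
      assume "\<not> ?thesis"
      then have gt: "\<epsilon> < (\<Sum>j\<in>J'. r j * j (dirac u v))" for u v using diracC by (meson not_le)
      define P where "P u = (\<Sum>j\<in>J'. r j * \<Phi> j u)" for u
      define Q where "Q v = (\<Sum>j\<in>J'. r j * \<Psi> j v)" for v
      define k' where "k' = (\<Sum>j\<in>J'. r j * k j)"
      \<comment> \<open>The cost coefficient \<open>k'\<close> may vanish; enlarging it by \<open>\<eta>\<close> makes division possible, at the price \<open>\<eta> s < \<epsilon>\<close>.\<close>
      define \<eta> where "\<eta> = \<epsilon> / (2 * (s + 1))"
      define b where "b = (\<Sum>j\<in>J'. r j * B j) + \<epsilon>"
      have \<eta>: "0 < \<eta>" using \<epsilon> s by (simp add: \<eta>_def)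
      have k': "0 \<le> k'" unfolding k'_def using r D(5) J' by (intro sum_nonneg) auto
      have meas: "P \<in> borel_measurable borel" "Q \<in> borel_measurable borel"
        unfolding P_def Q_def using D(1,2) J' by (auto intro!: borel_measurable_sum)
      have Pb: "\<bar>P u\<bar> \<le> b - \<epsilon>" for u
      proof -
        have "\<bar>P u\<bar> \<le> (\<Sum>j\<in>J'. \<bar>r j * \<Phi> j u\<bar>)" unfolding P_def by (rule sum_abs)
        also have "\<dots> \<le> (\<Sum>j\<in>J'. r j * B j)"
          using r D(3) J' by (intro sum_mono) (auto simp: abs_mult intro!: mult_left_mono)
        finally show ?thesis by (simp add: b_def)
      qed
      have Qb: "\<bar>Q u\<bar> \<le> b - \<epsilon>" for u
      proof -
        have "\<bar>Q u\<bar> \<le> (\<Sum>j\<in>J'. \<bar>r j * \<Psi> j u\<bar>)" unfolding Q_def by (rule sum_abs)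
        also have "\<dots> \<le> (\<Sum>j\<in>J'. r j * B j)"
          using r D(4) J' by (intro sum_mono) (auto simp: abs_mult intro!: mult_left_mono)
        finally show ?thesis by (simp add: b_def)
      qed
      have "\<epsilon> - P u \<le> Q v + (k' + \<eta>) * c u v" for u v
      proof -
        have "\<epsilon> < (\<Sum>j\<in>J'. r j * j (dirac u v))" by (rule gt)
        also have "\<dots> \<le> (\<Sum>j\<in>J'. r j * (\<Phi> j u + \<Psi> j v + k j * c u v))"
          using r D(6) J' by (intro sum_mono mult_left_mono) auto
        also have "\<dots> = P u + Q v + k' * c u v"
          by (simp add: P_def Q_def k'_def sum.distrib sum_distrib_right distrib_left mult.assoc)
        also have "\<dots> \<le> P u + Q v + (k' + \<eta>) * c u v" using \<eta> c[of u v] by (simp add: distrib_right)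
        finally show ?thesis by simp
      qed
      then have "(\<integral>u. \<epsilon> - P u \<partial>\<mu>) \<le> (\<integral>v. Q v \<partial>\<nu>) + (k' + \<eta>) * s"
        using meas k' \<eta> Pb Qb \<epsilon>
        by (intro dual_bound_real[OF \<mu> \<nu> s _ c dual, where B = b]) (auto simp: abs_le_iff, smt+)
      moreover have "(\<integral>u. P u \<partial>\<mu>) + (\<integral>v. Q v \<partial>\<nu>) + k' * s \<le> 0"
      proof -
        have iP: "integrable \<mu> (\<Phi> j)" "integrable \<nu> (\<Psi> j)" if "j \<in> J'" for j
          using that J' D(1-4) by (auto intro!: Pr_integrable[OF \<mu>, where K="B j"] Pr_integrable[OF \<nu>, where K="B j"])
        have "(\<integral>u. P u \<partial>\<mu>) + (\<integral>v. Q v \<partial>\<nu>) + k' * s =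
            (\<Sum>j\<in>J'. r j * ((\<integral>u. \<Phi> j u \<partial>\<mu>) + (\<integral>v. \<Psi> j v \<partial>\<nu>) + k j * s))"
          using iP by (simp add: P_def Q_def k'_def Bochner_Integration.integral_sum sum.distrib
              sum_distrib_right distrib_left mult.assoc)
        also have "\<dots> \<le> 0" using r D(7) J' by (intro sum_nonpos mult_nonneg_nonpos) auto
        finally show ?thesis .
      qed
      moreover have "(\<integral>u. \<epsilon> - P u \<partial>\<mu>) = \<epsilon> - (\<integral>u. P u \<partial>\<mu>)"
        using Pr_integrable[OF \<mu> meas(1) Pb]
        by (subst Bochner_Integration.integral_diff) (auto simp: M.prob_space)
      ultimately have "\<epsilon> \<le> \<eta> * s" by (simp add: algebra_simps)
      also have "\<dots> < \<epsilon>" using s \<epsilon> by (simp add: \<eta>_def field_simps add_nonneg_pos)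
      finally show False by simp
    qed
  qed
  then obtain m where m: "m \<in> charges" "\<And>j. j \<in> J \<Longrightarrow> j m \<le> 0" by blast
  have "m (A \<times> UNIV) \<le> measure \<mu> A" "m (UNIV \<times> A) \<le> measure \<nu> A" if "A \<in> sets borel" for A
    using that m(2)[of "\<lambda>m. m (A \<times> UNIV) - measure \<mu> A"] m(2)[of "\<lambda>m. m (UNIV \<times> A) - measure \<nu> A"]
    by (auto simp: J_def J1_def J2_def)
  moreover have "(\<Sum>i<N. \<delta> * m {(u, v). real (Suc i) * \<delta> < c u v}) \<le> s" if "0 < \<delta>" for \<delta> N
    using that m(2)[of "\<lambda>m. (\<Sum>i<N. \<delta> * m {(u, v). real (Suc i) * \<delta> < c u v}) - s"]
    by (auto simp: J_def J3_def)
  ultimately show ?thesis using m(1) by blast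
qed

text \<open>Kantorovich duality, with the optimal coupling attained. The marginal bounds make rectangles tight, so the charge dominates
  a Borel measure on open sets. Its marginals are then at most \<open>\<mu>\<close> and \<open>\<nu>\<close> on open
  sets, hence equal to them. Superlevel sets of the cost are open, so the layer cake sums do not increase either.\<close>

theorem dual_bound_coupling:
  fixes c :: "'a::{second_countable_topology, complete_space} \<Rightarrow> 'a \<Rightarrow> real"
  assumes \<mu>: "\<mu> \<in> Pr" and \<nu>: "\<nu> \<in> Pr" and s: "0 \<le> s" and c: "\<And>u v. 0 \<le> c u v"
    and lsc: "lower_semicontinuous (\<lambda>(u, v). c u v)"
    and dual: "dual_bound c \<mu> \<nu> (ennreal s)"
  shows "\<exists>\<Gamma>\<in>couplings \<mu> \<nu>. (\<integral>\<^sup>+(u, v). ennreal (c u v) \<partial>\<Gamma>) \<le> ennreal s"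
proof -
  interpret M: prob_space \<mu> using \<mu> by (simp add: Pr_iff)
  interpret N: prob_space \<nu> using \<nu> by (simp add: Pr_iff)
  have sets[simp]: "sets \<mu> = sets borel" "sets \<nu> = sets borel" using \<mu> \<nu> by (auto simp: Pr_iff)
  obtain m :: "('a \<times> 'a) set \<Rightarrow> real" where m: "m \<in> charges"
      and m1: "\<And>A. A \<in> sets borel \<Longrightarrow> m (A \<times> UNIV) \<le> measure \<mu> A"
      and m2: "\<And>A. A \<in> sets borel \<Longrightarrow> m (UNIV \<times> A) \<le> measure \<nu> A"
      and m3: "\<And>\<delta> N. 0 < \<delta> \<Longrightarrow> (\<Sum>i<N. \<delta> * m {(u, v). real (Suc i) * \<delta> < c u v}) \<le> s"
    using charge_with_bounds[OF \<mu> \<nu> s c dual] by blast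
  have rect: "A \<times> A' \<in> tight_sets m" if A: "A \<in> sets borel" "A' \<in> sets borel" for A A'
    unfolding tight_sets_def
  proof (intro CollectI allI impI)
    fix \<epsilon> :: real assume "0 < \<epsilon>"
    then have e: "0 < \<epsilon>/2" by simp
    obtain C where C: "compact C" "C \<subseteq> A" "measure \<mu> (A - C) \<le> \<epsilon>/2"
      using Pr_compact_approx[OF \<mu> A(1) e] by blast
    obtain C' where C': "compact C'" "C' \<subseteq> A'" "measure \<nu> (A' - C') \<le> \<epsilon>/2"
      using Pr_compact_approx[OF \<nu> A(2) e] by blast
    have b: "A - C \<in> sets borel" "A' - C' \<in> sets borel"
      using A C C' by (auto simp: borel_compact)
    have "m (A \<times> A' - C \<times> C') \<le> m ((A - C) \<times> UNIV \<union> UNIV \<times> (A' - C'))"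
      by (rule charges_mono[OF m]) auto
    also have "\<dots> \<le> m ((A - C) \<times> UNIV) + m (UNIV \<times> (A' - C'))" by (rule charges_subadd[OF m])
    also have "\<dots> \<le> \<epsilon>" using m1[OF b(1)] m2[OF b(2)] C C' by simp
    finally show "\<exists>K. compact K \<and> K \<subseteq> A \<times> A' \<and> m (A \<times> A' - K) \<le> \<epsilon>"
      using C C' by (intro exI[of _ "C \<times> C'"]) (auto simp: compact_Times)
  qed
  obtain B0 :: "'a set set" where B0: "countable B0" "topological_basis B0"
    using ex_countable_basis by blast
  define B where "B = (\<lambda>(a, b). a \<times> b) ` (B0 \<times> B0)"
  have B0b: "a \<in> sets borel" if "a \<in> B0" for a
    using topological_basis_open[OF B0(2) that] by simp
  have "\<exists>\<Gamma>\<in>Pr. \<forall>G. open G \<longrightarrow> measure \<Gamma> G \<le> m G"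
  proof (rule tight_charge_measure[OF m])
    show "countable B" using B0 by (auto simp: B_def)
    show "topological_basis B" unfolding B_def by (rule topological_basis_prod[OF B0(2) B0(2)])
    show "UNIV \<in> tight_sets m" using rect[of UNIV UNIV] by simp
    fix b assume "b \<in> B"
    then obtain a a' where a: "a \<in> B0" "a' \<in> B0" "b = a \<times> a'" by (auto simp: B_def)
    show "b \<in> tight_sets m" using a rect B0b by auto
    have "- b = (- a) \<times> UNIV \<union> UNIV \<times> (- a')" using a by auto
    moreover have "- a \<in> sets borel" "- a' \<in> sets borel" using a(1,2) B0b by auto
    ultimately show "- b \<in> tight_sets m" using rect by (auto intro!: tight_sets_Un[OF m])
  qed
  then obtain \<Gamma> where \<Gamma>: "\<Gamma> \<in> Pr" and \<Gamma>m: "\<And>G. open G \<Longrightarrow> measure \<Gamma> G \<le> m G" by blast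
  interpret G: prob_space \<Gamma> using \<Gamma> by (simp add: Pr_iff)
  have [simp]: "sets \<Gamma> = sets borel" "space \<Gamma> = UNIV" using \<Gamma> Pr_space[OF \<Gamma>] by (auto simp: Pr_iff)
  have fs[measurable]: "fst \<in> \<Gamma> \<rightarrow>\<^sub>M borel" "snd \<in> \<Gamma> \<rightarrow>\<^sub>M borel"
    by (auto intro!: Pr_measurable[OF \<Gamma>] borel_measurable_continuous_onI continuous_on_fst continuous_on_snd continuous_on_id)
  have "distr \<Gamma> borel fst = \<mu>"
  proof (rule Pr_eqI_open_le[OF \<mu>])
    show "distr \<Gamma> borel fst \<in> Pr" by (auto simp: Pr_iff G.prob_space_distr)
    fix G :: "'a set" assume G: "open G"
    have eq: "fst -` G = G \<times> UNIV" by auto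
    have "measure \<Gamma> (fst -` G) \<le> measure \<mu> G"
      unfolding eq using \<Gamma>m[of "G \<times> UNIV"] m1[of G] G by (simp add: open_Times)
    then show "emeasure (distr \<Gamma> borel fst) G \<le> emeasure \<mu> G"
      using G by (simp add: emeasure_distr G.emeasure_eq_measure M.emeasure_eq_measure)
  qed
  moreover have "distr \<Gamma> borel snd = \<nu>"
  proof (rule Pr_eqI_open_le[OF \<nu>])
    show "distr \<Gamma> borel snd \<in> Pr" by (auto simp: Pr_iff G.prob_space_distr)
    fix G :: "'a set" assume G: "open G"
    have eq: "snd -` G = UNIV \<times> G" by auto
    have "measure \<Gamma> (snd -` G) \<le> measure \<nu> G"
      unfolding eq using \<Gamma>m[of "UNIV \<times> G"] m2[of G] G by (simp add: open_Times)
    then show "emeasure (distr \<Gamma> borel snd) G \<le> emeasure \<nu> G"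
      using G by (simp add: emeasure_distr G.emeasure_eq_measure N.emeasure_eq_measure)
  qed
  ultimately have "\<Gamma> \<in> couplings \<mu> \<nu>" using \<Gamma> by (auto simp: couplings_def)
  moreover have "(\<integral>\<^sup>+(u, v). ennreal (c u v) \<partial>\<Gamma>) \<le> ennreal s"
  proof (rule ennreal_le_epsilon)
    fix \<delta> :: real assume \<delta>: "0 < \<delta>"
    let ?c = "\<lambda>x. case x of (u, v) \<Rightarrow> c u v"
    define E where "E i = {(u, v). real (Suc i) * \<delta> < c u v}" for i
    have oE: "open (E i)" for i
    proof -
      have "E i = - {x. ?c x \<le> real (Suc i) * \<delta>}" by (auto simp: E_def)
      then show ?thesis using lsc by (auto simp: lower_semicontinuous_def)
    qed
    have cm: "?c \<in> borel_measurable \<Gamma>" by (rule Pr_measurable[OF \<Gamma> lsc_borel_measurable[OF lsc]])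
    have int1: "integrable \<Gamma> (\<lambda>x. \<delta> * indicator (E i) x)" for i
      using oE by (auto simp: G.emeasure_eq_measure)
    have int: "integrable \<Gamma> (\<lambda>x. \<delta> + (\<Sum>i<N. \<delta> * indicator (E i) x))" for N
      by (intro Bochner_Integration.integrable_add Bochner_Integration.integrable_sum int1) simp
    have bound: "(\<integral>\<^sup>+x. ennreal (min (?c x) (real N * \<delta>)) \<partial>\<Gamma>) \<le> ennreal s + ennreal \<delta>" for N
    proof -
      have "(\<integral>\<^sup>+x. ennreal (min (?c x) (real N * \<delta>)) \<partial>\<Gamma>)
          \<le> (\<integral>\<^sup>+x. ennreal (\<delta> + (\<Sum>i<N. \<delta> * indicator (E i) x)) \<partial>\<Gamma>)"
      proof (intro nn_integral_mono ennreal_leI)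
        fix x :: "'a \<times> 'a"
        obtain u v where x: "x = (u, v)" by (cases x)
        have "indicator (E i) x = (if real (Suc i) * \<delta> < c u v then 1 else 0 :: real)" for i
          by (simp add: E_def x indicator_def)
        then show "min (?c x) (real N * \<delta>) \<le> \<delta> + (\<Sum>i<N. \<delta> * indicator (E i) x)"
          using layer_sum_bounds(2)[OF \<delta> c[of u v], where N = N] by (simp only: x prod.case)
      qed
      also have "\<dots> = ennreal (\<integral>x. \<delta> + (\<Sum>i<N. \<delta> * indicator (E i) x) \<partial>\<Gamma>)"
        using int \<delta> by (intro nn_integral_eq_integral AE_I2 add_nonneg_nonneg sum_nonneg) auto
      also have "(\<integral>x. \<delta> + (\<Sum>i<N. \<delta> * indicator (E i) x) \<partial>\<Gamma>) = \<delta> + (\<Sum>i<N. \<delta> * measure \<Gamma> (E i))"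
      proof -
        have "(\<integral>x. (\<Sum>i<N. \<delta> * indicator (E i) x) \<partial>\<Gamma>) = (\<Sum>i<N. \<integral>x. \<delta> * indicator (E i) x \<partial>\<Gamma>)"
          by (rule Bochner_Integration.integral_sum) (rule int1)
        moreover have "(\<integral>x. \<delta> * indicator (E i) x \<partial>\<Gamma>) = \<delta> * measure \<Gamma> (E i)" for i
          using oE by simp
        moreover have "(\<integral>x. \<delta> \<partial>\<Gamma>) = \<delta>" using G.prob_space by simp
        ultimately show ?thesis
          by (subst Bochner_Integration.integral_add)
            (auto simp only: integrable_const finite_measure.integrable_const G.integrable_const
              intro!: Bochner_Integration.integrable_sum int1)
      qed
      also have "\<dots> \<le> \<delta> + (\<Sum>i<N. \<delta> * m (E i))"
        using \<Gamma>m oE \<delta> by (intro add_left_mono sum_mono mult_left_mono) auto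
      also have "\<dots> \<le> \<delta> + s" using m3[OF \<delta>, of N] by (simp add: E_def)
      finally show ?thesis using s \<delta> by (simp add: add.commute ennreal_leI flip: ennreal_plus)
    qed
    have "(\<integral>\<^sup>+x. ennreal (?c x) \<partial>\<Gamma>) = (\<integral>\<^sup>+x. (SUP N. ennreal (min (?c x) (real N * \<delta>))) \<partial>\<Gamma>)"
    proof (rule nn_integral_cong)
      fix x
      obtain N where "?c x / \<delta> \<le> real N" using real_arch_simple by blast
      then have "?c x \<le> real N * \<delta>" using \<delta> by (simp add: field_simps)
      then have "ennreal (?c x) = ennreal (min (?c x) (real N * \<delta>))" by simp
      also have "\<dots> \<le> (SUP N. ennreal (min (?c x) (real N * \<delta>)))" by (rule SUP_upper) simp
      finally show "ennreal (?c x) = (SUP N. ennreal (min (?c x) (real N * \<delta>)))"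
        by (intro antisym SUP_least) (auto intro!: ennreal_leI)
    qed
    also have "\<dots> = (SUP N. \<integral>\<^sup>+x. ennreal (min (?c x) (real N * \<delta>)) \<partial>\<Gamma>)"
      using cm \<delta> by (intro nn_integral_monotone_convergence_SUP)
        (auto simp: incseq_def le_fun_def intro!: ennreal_leI min.mono mult_right_mono)
    also have "\<dots> \<le> ennreal s + ennreal \<delta>" using bound by (intro SUP_least)
    finally show "(\<integral>\<^sup>+(u, v). ennreal (c u v) \<partial>\<Gamma>) \<le> ennreal s + ennreal \<delta>"
      by (simp add: case_prod_beta')
  qed
  ultimately show ?thesis by blast
qed

section \<open>Calculus of optimal transport costs\<close>

definition lsc_cost :: "('a::topological_space \<Rightarrow> 'a \<Rightarrow> real) \<Rightarrow> bool" where
  "lsc_cost c \<longleftrightarrow> (\<forall>u v. 0 \<le> c u v) \<and> lower_semicontinuous (\<lambda>(u, v). c u v)"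

lemma couplings_integrals:
  fixes \<mu> \<nu> :: "'a::topological_space measure"
  assumes \<Gamma>: "\<Gamma> \<in> couplings \<mu> \<nu>" and f: "f \<in> borel_measurable borel"
  shows "(\<integral>\<^sup>+x. f (fst x) \<partial>\<Gamma>) = (\<integral>\<^sup>+u. f u \<partial>\<mu>)" "(\<integral>\<^sup>+x. f (snd x) \<partial>\<Gamma>) = (\<integral>\<^sup>+u. f u \<partial>\<nu>)"
proof -
  have \<Gamma>': "\<Gamma> \<in> Pr" "\<mu> = distr \<Gamma> borel fst" "\<nu> = distr \<Gamma> borel snd" using \<Gamma> by (auto simp: couplings_def)
  have m: "fst \<in> \<Gamma> \<rightarrow>\<^sub>M borel" "snd \<in> \<Gamma> \<rightarrow>\<^sub>M borel"
    by (auto intro!: Pr_measurable[OF \<Gamma>'(1)] borel_measurable_continuous_onI continuous_on_fst continuous_on_snd continuous_on_id)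
  show "(\<integral>\<^sup>+x. f (fst x) \<partial>\<Gamma>) = (\<integral>\<^sup>+u. f u \<partial>\<mu>)" "(\<integral>\<^sup>+x. f (snd x) \<partial>\<Gamma>) = (\<integral>\<^sup>+u. f u \<partial>\<nu>)"
    unfolding \<Gamma>'(2,3) using f m by (auto simp: nn_integral_distr)
qed

lemma wasserstein_approx:
  assumes "wasserstein c \<mu> \<nu> \<noteq> \<infinity>" "0 < (\<epsilon>::real)"
  obtains \<Gamma> where "\<Gamma> \<in> couplings \<mu> \<nu>"
    "(\<integral>\<^sup>+x. ennreal (c (fst x) (snd x)) \<partial>\<Gamma>) \<le> wasserstein c \<mu> \<nu> + ennreal \<epsilon>"
proof -
  have "\<exists>\<Gamma>\<in>couplings \<mu> \<nu>. (\<integral>\<^sup>+(u, v). ennreal (c u v) \<partial>\<Gamma>) < wasserstein c \<mu> \<nu> + ennreal \<epsilon>"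
    by (rule INF_approx_ennreal[OF assms(2) _ assms(1)]) (simp add: wasserstein_def)
  then show thesis using that by (force simp: case_prod_beta')
qed

text \<open>The easy half of duality: integrate the constraint against a nearly optimal coupling. The factor \<open>D\<close>
  is the constant of the generalized triangle inequality.\<close>

lemma wasserstein_dual_le:
  fixes c :: "'a::{second_countable_topology, complete_space} \<Rightarrow> 'a \<Rightarrow> real"
  assumes c: "lsc_cost c" and D: "0 < D"
    and \<phi>: "\<phi> \<in> borel_measurable borel" and \<psi>: "\<psi> \<in> borel_measurable borel"
    and le: "\<And>u v. \<phi> u \<le> \<psi> v + ennreal D * ennreal (c u v)"
  shows "(\<integral>\<^sup>+u. \<phi> u \<partial>\<mu>) \<le> (\<integral>\<^sup>+v. \<psi> v \<partial>\<nu>) + ennreal D * wasserstein c \<mu> \<nu>"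
proof (cases "wasserstein c \<mu> \<nu> = \<infinity>")
  case True then show ?thesis using D by (simp add: ennreal_mult_top)
next
  case False
  show ?thesis
  proof (rule ennreal_le_epsilon)
    fix e :: real assume e: "0 < e"
    then have "0 < e / D" using D by simp
    then obtain \<Gamma> where \<Gamma>: "\<Gamma> \<in> couplings \<mu> \<nu>"
        "(\<integral>\<^sup>+x. ennreal (c (fst x) (snd x)) \<partial>\<Gamma>) \<le> wasserstein c \<mu> \<nu> + ennreal (e / D)"
      using wasserstein_approx[OF False] by blast
    have \<Gamma>': "\<Gamma> \<in> Pr" using \<Gamma>(1) by (auto simp: couplings_def)
    have m: "(\<lambda>x. \<psi> (snd x)) \<in> borel_measurable \<Gamma>" "(\<lambda>x. ennreal (c (fst x) (snd x))) \<in> borel_measurable \<Gamma>"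
      using lsc_cost_measurable[of c] c \<psi>
      by (auto intro!: Pr_measurable[OF \<Gamma>'] measurable_compose[OF _ \<psi>] borel_measurable_continuous_onI
          continuous_on_snd continuous_on_id simp: lsc_cost_def case_prod_beta')
    have "(\<integral>\<^sup>+u. \<phi> u \<partial>\<mu>) = (\<integral>\<^sup>+x. \<phi> (fst x) \<partial>\<Gamma>)" using couplings_integrals(1)[OF \<Gamma>(1) \<phi>] by simp
    also have "\<dots> \<le> (\<integral>\<^sup>+x. \<psi> (snd x) + ennreal D * ennreal (c (fst x) (snd x)) \<partial>\<Gamma>)"
      by (intro nn_integral_mono le)
    also have "\<dots> = (\<integral>\<^sup>+v. \<psi> v \<partial>\<nu>) + ennreal D * (\<integral>\<^sup>+x. ennreal (c (fst x) (snd x)) \<partial>\<Gamma>)"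
      using m by (simp add: nn_integral_add nn_integral_cmult couplings_integrals(2)[OF \<Gamma>(1) \<psi>])
    also have "\<dots> \<le> (\<integral>\<^sup>+v. \<psi> v \<partial>\<nu>) + ennreal D * (wasserstein c \<mu> \<nu> + ennreal (e / D))"
      by (intro add_left_mono mult_left_mono \<Gamma>(2)) simp
    also have "\<dots> = (\<integral>\<^sup>+v. \<psi> v \<partial>\<nu>) + ennreal D * wasserstein c \<mu> \<nu> + ennreal e"
      using D e by (simp add: distrib_left add.assoc flip: ennreal_mult)
    finally show "(\<integral>\<^sup>+u. \<phi> u \<partial>\<mu>) \<le> (\<integral>\<^sup>+v. \<psi> v \<partial>\<nu>) + ennreal D * wasserstein c \<mu> \<nu> + ennreal e" .
  qed
qed

lemma wasserstein_dual_le1: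
  fixes c :: "'a::{second_countable_topology, complete_space} \<Rightarrow> 'a \<Rightarrow> real"
  assumes "lsc_cost c" "\<phi> \<in> borel_measurable borel" "\<psi> \<in> borel_measurable borel"
    and "\<And>u v. \<phi> u \<le> \<psi> v + ennreal (c u v)"
  shows "(\<integral>\<^sup>+u. \<phi> u \<partial>\<mu>) \<le> (\<integral>\<^sup>+v. \<psi> v \<partial>\<nu>) + wasserstein c \<mu> \<nu>"
  using wasserstein_dual_le[OF assms(1) _ assms(2,3), of 1] assms(4) by simp

text \<open>The hard half of duality, in the form in which upper bounds for transport costs are proved below.\<close>

lemma wasserstein_leI:
  fixes c :: "'a::{second_countable_topology, complete_space} \<Rightarrow> 'a \<Rightarrow> real"
  assumes \<mu>: "\<mu> \<in> Pr" and \<nu>: "\<nu> \<in> Pr" and c: "lsc_cost c"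
    and dual: "\<And>\<phi> \<psi> K. \<phi> \<in> borel_measurable borel \<Longrightarrow> \<psi> \<in> borel_measurable borel \<Longrightarrow>
      (\<And>u. \<phi> u \<le> ennreal K) \<Longrightarrow> (\<And>u v. \<phi> u \<le> \<psi> v + ennreal (c u v)) \<Longrightarrow>
      (\<integral>\<^sup>+u. \<phi> u \<partial>\<mu>) \<le> (\<integral>\<^sup>+v. \<psi> v \<partial>\<nu>) + s"
  shows "wasserstein c \<mu> \<nu> \<le> s"
proof (cases s)
  case (real r)
  have "dual_bound c \<mu> \<nu> (ennreal r)" unfolding dual_bound_def real(2)[symmetric] using dual by blast
  then obtain \<Gamma> where "\<Gamma> \<in> couplings \<mu> \<nu>" "(\<integral>\<^sup>+(u, v). ennreal (c u v) \<partial>\<Gamma>) \<le> ennreal r"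
    using dual_bound_coupling[OF \<mu> \<nu> real(1), of c] c unfolding lsc_cost_def by blast
  then show ?thesis unfolding wasserstein_def real(2) by (rule INF_lower2)
qed simp

lemma wasserstein_mono:
  assumes "\<And>u v. c u v \<le> c' u v" shows "wasserstein c \<mu> \<nu> \<le> wasserstein c' \<mu> \<nu>"
  unfolding wasserstein_def using assms
  by (intro INF_mono') (auto intro!: nn_integral_mono ennreal_leI)

lemma wasserstein_sym_le:
  fixes c :: "'a::{second_countable_topology} \<Rightarrow> 'a \<Rightarrow> real"
  assumes c: "lsc_cost c" "\<And>u v. c u v = c v u"
  shows "wasserstein c \<nu> \<mu> \<le> wasserstein c \<mu> \<nu>"
  unfolding wasserstein_def
proof (rule INF_greatest)
  fix \<Gamma> assume \<Gamma>: "\<Gamma> \<in> couplings \<mu> \<nu>"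
  then have \<Gamma>': "\<Gamma> \<in> Pr" by (auto simp: couplings_def)
  then interpret prob_space \<Gamma> by (simp add: Pr_iff)
  let ?swap = "\<lambda>x::'a \<times> 'a. (snd x, fst x)"
  have m[measurable]: "?swap \<in> \<Gamma> \<rightarrow>\<^sub>M borel" "fst \<in> borel \<rightarrow>\<^sub>M (borel :: 'a measure)" "snd \<in> borel \<rightarrow>\<^sub>M (borel :: 'a measure)"
    by (auto intro!: Pr_measurable[OF \<Gamma>'] borel_measurable_continuous_onI continuous_intros)
  have "distr \<Gamma> borel ?swap \<in> couplings \<nu> \<mu>"
    using \<Gamma> by (auto simp: couplings_def Pr_iff prob_space_distr distr_distr comp_def)
  moreover have "(\<integral>\<^sup>+(u, v). ennreal (c u v) \<partial>(distr \<Gamma> borel ?swap)) = (\<integral>\<^sup>+(u, v). ennreal (c u v) \<partial>\<Gamma>)"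
    using lsc_cost_measurable[of c] c(1)
    by (subst nn_integral_distr) (auto simp: lsc_cost_def case_prod_beta' c(2) intro!: nn_integral_cong)
  ultimately show "(INF \<Gamma>\<in>couplings \<nu> \<mu>. \<integral>\<^sup>+(u, v). ennreal (c u v) \<partial>\<Gamma>) \<le> (\<integral>\<^sup>+(u, v). ennreal (c u v) \<partial>\<Gamma>)"
    by (metis (no_types, lifting) INF_lower)
qed

lemma wasserstein_sym:
  fixes c :: "'a::{second_countable_topology} \<Rightarrow> 'a \<Rightarrow> real"
  assumes "lsc_cost c" "\<And>u v. c u v = c v u"
  shows "wasserstein c \<nu> \<mu> = wasserstein c \<mu> \<nu>"
  using wasserstein_sym_le[OF assms] by (intro antisym)

lemma wasserstein_le_const:
  fixes c :: "'a::{second_countable_topology, complete_space} \<Rightarrow> 'a \<Rightarrow> real"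
  assumes \<mu>: "\<mu> \<in> Pr" and \<nu>: "\<nu> \<in> Pr" and c: "lsc_cost c" and K: "\<And>u v. c u v \<le> K"
  shows "wasserstein c \<mu> \<nu> \<le> ennreal K"
proof (rule wasserstein_leI[OF \<mu> \<nu> c])
  fix \<phi> \<psi> :: "'a \<Rightarrow> ennreal"
  assume m: "\<phi> \<in> borel_measurable borel" "\<psi> \<in> borel_measurable borel"
    and le: "\<And>u v. \<phi> u \<le> \<psi> v + ennreal (c u v)"
  interpret M: prob_space \<mu> using \<mu> by (simp add: Pr_iff)
  interpret N: prob_space \<nu> using \<nu> by (simp add: Pr_iff)
  have b: "(\<integral>\<^sup>+u. \<phi> u \<partial>\<mu>) \<le> \<psi> v + ennreal K" for v
  proof (rule M.nn_integral_le_const)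
    show "AE u in \<mu>. \<phi> u \<le> \<psi> v + ennreal K"
      by (intro AE_I2 order_trans[OF le add_left_mono[OF ennreal_leI[OF K]]])
  qed simp
  have "(\<integral>\<^sup>+u. \<phi> u \<partial>\<mu>) = (\<integral>\<^sup>+v. (\<integral>\<^sup>+u. \<phi> u \<partial>\<mu>) \<partial>\<nu>)" by (simp add: N.emeasure_space_1)
  also have "\<dots> \<le> (\<integral>\<^sup>+v. \<psi> v + ennreal K \<partial>\<nu>)" by (intro nn_integral_mono b)
  also have "\<dots> = (\<integral>\<^sup>+v. \<psi> v \<partial>\<nu>) + ennreal K"
    using Pr_measurable[OF \<nu> m(2)] by (simp add: nn_integral_add N.emeasure_space_1)
  finally show "(\<integral>\<^sup>+u. \<phi> u \<partial>\<mu>) \<le> (\<integral>\<^sup>+v. \<psi> v \<partial>\<nu>) + ennreal K" .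
qed

lemma wasserstein_refl:
  fixes c :: "'a::{second_countable_topology, complete_space} \<Rightarrow> 'a \<Rightarrow> real"
  assumes \<mu>: "\<mu> \<in> Pr" and c: "lsc_cost c" and z: "\<And>u. c u u = 0"
  shows "wasserstein c \<mu> \<mu> = 0"
proof -
  have "wasserstein c \<mu> \<mu> \<le> 0"
  proof (rule wasserstein_leI[OF \<mu> \<mu> c])
    fix \<phi> \<psi> :: "'a \<Rightarrow> ennreal" assume le: "\<And>u v. \<phi> u \<le> \<psi> v + ennreal (c u v)"
    show "(\<integral>\<^sup>+u. \<phi> u \<partial>\<mu>) \<le> (\<integral>\<^sup>+v. \<psi> v \<partial>\<mu>) + 0"
      using le[of u u for u] z by (auto intro!: nn_integral_mono)
  qed
  then show ?thesis by simp
qed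

lemma wasserstein_return:
  fixes c :: "'a::{second_countable_topology, complete_space} \<Rightarrow> 'a \<Rightarrow> real"
  assumes c: "lsc_cost c"
  shows "wasserstein c (return borel u) (return borel v) \<le> ennreal (c u v)"
  by (rule wasserstein_leI[OF _ _ c])
     (auto simp: Pr_iff prob_space_return nn_integral_return)

text \<open>Convexity of the transport cost under mixtures. Dual pairs are integrated first against the kernels and then against
  \<open>N\<close>, so no measurable choice of couplings between \<open>P1 x\<close> and \<open>P2 x\<close> is
  made. The index space is arbitrary because it is also used for a product of two initial laws.\<close>

lemma wasserstein_bind_le:
  fixes c :: "'a::{second_countable_topology, complete_space} \<Rightarrow> 'a \<Rightarrow> real"
  assumes c: "lsc_cost c" and N: "N \<in> space (prob_algebra M)"
    and P: "P1 \<in> M \<rightarrow>\<^sub>M prob_algebra borel" "P2 \<in> M \<rightarrow>\<^sub>M prob_algebra borel"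
    and h: "h \<in> borel_measurable M" and le: "\<And>x. x \<in> space M \<Longrightarrow> wasserstein c (P1 x) (P2 x) \<le> h x"
  shows "wasserstein c (N \<bind> P1) (N \<bind> P2) \<le> (\<integral>\<^sup>+x. h x \<partial>N)"
proof (rule wasserstein_leI[OF _ _ c])
  have sN: "sets N = sets M" using N by (simp add: space_prob_algebra)
  have P': "P1 \<in> N \<rightarrow>\<^sub>M subprob_algebra borel" "P2 \<in> N \<rightarrow>\<^sub>M subprob_algebra borel"
    using measurable_prob_algebraD[OF P(1)] measurable_prob_algebraD[OF P(2)] measurable_cong_sets[OF sN refl] by auto
  have sp: "space N = space M" using sN by (rule sets_eq_imp_space_eq)
  show "N \<bind> P1 \<in> Pr" "N \<bind> P2 \<in> Pr"
    using prob_space_bind'[OF N P(1)] sets_bind'[OF N P(1)] prob_space_bind'[OF N P(2)] sets_bind'[OF N P(2)]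
    by (simp_all add: Pr_iff)
  fix \<phi> \<psi> :: "'a \<Rightarrow> ennreal"
  assume m: "\<phi> \<in> borel_measurable borel" "\<psi> \<in> borel_measurable borel"
    and le': "\<And>u v. \<phi> u \<le> \<psi> v + ennreal (c u v)"
  have "(\<integral>\<^sup>+u. \<phi> u \<partial>(N \<bind> P1)) = (\<integral>\<^sup>+x. \<integral>\<^sup>+u. \<phi> u \<partial>P1 x \<partial>N)" by (rule nn_integral_bind[OF m(1) P'(1)])
  also have "\<dots> \<le> (\<integral>\<^sup>+x. (\<integral>\<^sup>+v. \<psi> v \<partial>P2 x) + h x \<partial>N)"
  proof (rule nn_integral_mono)
    fix x assume "x \<in> space N"
    then have x: "x \<in> space M" by (simp add: sp)
    have "(\<integral>\<^sup>+u. \<phi> u \<partial>P1 x) \<le> (\<integral>\<^sup>+v. \<psi> v \<partial>P2 x) + wasserstein c (P1 x) (P2 x)"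
      by (rule wasserstein_dual_le1[OF c m le'])
    also have "\<dots> \<le> (\<integral>\<^sup>+v. \<psi> v \<partial>P2 x) + h x" by (intro add_left_mono le x)
    finally show "(\<integral>\<^sup>+u. \<phi> u \<partial>P1 x) \<le> (\<integral>\<^sup>+v. \<psi> v \<partial>P2 x) + h x" .
  qed
  also have "\<dots> = (\<integral>\<^sup>+x. \<integral>\<^sup>+v. \<psi> v \<partial>P2 x \<partial>N) + (\<integral>\<^sup>+x. h x \<partial>N)"
    using h measurable_cong_sets[OF sN refl] measurable_compose[OF P'(2) nn_integral_measurable_subprob_algebra[OF m(2)]]
    by (intro nn_integral_add) auto
  also have "(\<integral>\<^sup>+x. \<integral>\<^sup>+v. \<psi> v \<partial>P2 x \<partial>N) = (\<integral>\<^sup>+v. \<psi> v \<partial>(N \<bind> P2))"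
    by (rule nn_integral_bind[OF m(2) P'(2), symmetric])
  finally show "(\<integral>\<^sup>+u. \<phi> u \<partial>(N \<bind> P1)) \<le> (\<integral>\<^sup>+v. \<psi> v \<partial>(N \<bind> P2)) + (\<integral>\<^sup>+x. h x \<partial>N)" .
qed

lemma lsc_cost_min:
  assumes "lsc_cost c" "0 \<le> K" shows "lsc_cost (\<lambda>u v. min (c u v) K)"
proof -
  have "closed {x. (case x of (u, v) \<Rightarrow> min (c u v) K) \<le> r}" for r
  proof (cases "K \<le> r")
    case True then have "{x. (case x of (u, v) \<Rightarrow> min (c u v) K) \<le> r} = UNIV" by auto
    then show ?thesis by simp
  next
    case False
    then have "{x. (case x of (u, v) \<Rightarrow> min (c u v) K) \<le> r} = {x. (case x of (u, v) \<Rightarrow> c u v) \<le> r}" by auto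
    then show ?thesis using assms by (simp add: lsc_cost_def lower_semicontinuous_def)
  qed
  then show ?thesis using assms by (auto simp: lsc_cost_def lower_semicontinuous_def)
qed

text \<open>Lower semicontinuity of the transport cost along truncations: a test function bounded by \<open>K\<close> cannot
  distinguish \<open>c\<close> from \<open>min c K\<close>.\<close>

lemma wasserstein_le_truncated:
  fixes c :: "'a::{second_countable_topology, complete_space} \<Rightarrow> 'a \<Rightarrow> real"
  assumes \<mu>: "\<mu> \<in> Pr" and \<nu>: "\<nu> \<in> Pr" and c: "lsc_cost c"
    and le: "\<And>K. 0 \<le> K \<Longrightarrow> wasserstein (\<lambda>u v. min (c u v) K) \<mu> \<nu> \<le> s"
  shows "wasserstein c \<mu> \<nu> \<le> s"
proof (rule wasserstein_leI[OF \<mu> \<nu> c])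
  fix \<phi> \<psi> :: "'a \<Rightarrow> ennreal" and K :: real
  assume m: "\<phi> \<in> borel_measurable borel" "\<psi> \<in> borel_measurable borel"
    and K: "\<And>u. \<phi> u \<le> ennreal K" and le': "\<And>u v. \<phi> u \<le> \<psi> v + ennreal (c u v)"
  have "\<phi> u \<le> \<psi> v + ennreal (min (c u v) (max K 0))" for u v
  proof (cases "c u v \<le> max K 0")
    case True then show ?thesis using le' by simp
  next
    case False
    have "\<phi> u \<le> ennreal (max K 0)" using K[of u] by (simp add: ennreal_leI order_trans)
    also have "\<dots> \<le> \<psi> v + ennreal (max K 0)" by simp
    finally show ?thesis using False by (simp add: min_def)
  qed
  then have "(\<integral>\<^sup>+u. \<phi> u \<partial>\<mu>) \<le> (\<integral>\<^sup>+v. \<psi> v \<partial>\<nu>) + wasserstein (\<lambda>u v. min (c u v) (max K 0)) \<mu> \<nu>"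
    by (intro wasserstein_dual_le1 lsc_cost_min c m) auto
  also have "\<dots> \<le> (\<integral>\<^sup>+v. \<psi> v \<partial>\<nu>) + s" by (intro add_left_mono le) simp
  finally show "(\<integral>\<^sup>+u. \<phi> u \<partial>\<mu>) \<le> (\<integral>\<^sup>+v. \<psi> v \<partial>\<nu>) + s" .
qed

text \<open>The function \<open>w \<mapsto> inf\<^sub>v G (w, v)\<close> need not be Borel, since its sublevel sets are projections.
  Up to an error \<open>\<epsilon>\<close> and a null set of \<open>\<Gamma>\<close> it can be replaced by a Borel function: the level bands of
  \<open>G\<close> are exhausted by compact sets, and projections of compact sets are compact.\<close>

lemma borel_partial_infimum:
  fixes G :: "'a::{second_countable_topology, complete_space} \<times> 'a \<Rightarrow> ennreal"
  assumes \<Gamma>: "\<Gamma> \<in> Pr" and G: "G \<in> borel_measurable borel" and \<epsilon>: "0 < \<epsilon>"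
  obtains \<zeta> where "\<zeta> \<in> borel_measurable borel"
    "\<And>w. \<zeta> w = \<infinity> \<or> (\<exists>v. G (w, v) \<le> \<zeta> w)"
    "AE x in \<Gamma>. \<zeta> (fst x) \<le> G x + ennreal \<epsilon>"
proof -
  interpret prob_space \<Gamma> using \<Gamma> by (simp add: Pr_iff)
  have s[simp]: "sets \<Gamma> = sets borel" "space \<Gamma> = UNIV" using \<Gamma> Pr_space[OF \<Gamma>] by (auto simp: Pr_iff)
  define E where "E k = {x. ennreal (real k * \<epsilon>) \<le> G x \<and> G x < ennreal (real (Suc k) * \<epsilon>)}" for k
  have E: "E k \<in> sets borel" for k
    unfolding E_def using G by measurable
  have "\<exists>C. compact C \<and> C \<subseteq> E k \<and> measure \<Gamma> (E k - C) \<le> 1 / real (Suc n)" for k n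
    by (rule Pr_compact_approx[OF \<Gamma> E]) simp
  then obtain C where C: "\<And>k n. compact (C k n)" "\<And>k n. C k n \<subseteq> E k"
      "\<And>k n. measure \<Gamma> (E k - C k n) \<le> 1 / real (Suc n)"
    by metis
  define A where "A k = (\<Union>n. fst ` C k n)" for k
  define \<zeta> where "\<zeta> w = (if \<exists>k. w \<in> A k then ennreal (real (Suc (LEAST k. w \<in> A k)) * \<epsilon>) else \<infinity>)" for w
  have Ab[measurable]: "A k \<in> sets borel" for k
    unfolding A_def using C(1)
    by (intro sets.countable_UN) (auto intro!: borel_compact compact_continuous_image continuous_on_fst continuous_on_id)
  have "\<zeta> \<in> borel_measurable borel"
    unfolding \<zeta>_def by measurable
  moreover have "\<zeta> w = \<infinity> \<or> (\<exists>v. G (w, v) \<le> \<zeta> w)" for w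
  proof (cases "\<exists>k. w \<in> A k")
    case True
    then have "w \<in> A (LEAST k. w \<in> A k)" by (rule LeastI_ex)
    then obtain n v where "(w, v) \<in> C (LEAST k. w \<in> A k) n" by (auto simp: A_def)
    then have "(w, v) \<in> E (LEAST k. w \<in> A k)" using C(2) by blast
    then have "G (w, v) \<le> \<zeta> w" using True by (auto simp: E_def \<zeta>_def intro: less_imp_le)
    then show ?thesis by blast
  qed (simp add: \<zeta>_def)
  moreover have "AE x in \<Gamma>. \<zeta> (fst x) \<le> G x + ennreal \<epsilon>"
  proof -
    have "AE x in \<Gamma>. x \<notin> E k - (\<Union>n. C k n)" for k
    proof (rule AE_not_in)
      have b: "E k - (\<Union>n. C k n) \<in> sets borel" by (intro sets.Diff E sets.countable_UN) (auto intro!: borel_compact C(1))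
      have "measure \<Gamma> (E k - (\<Union>n. C k n)) \<le> 1 / real (Suc n)" for n
      proof -
        have "measure \<Gamma> (E k - (\<Union>n. C k n)) \<le> measure \<Gamma> (E k - C k n)"
          using E[of k] borel_compact[OF C(1), of k n] by (intro finite_measure_mono) auto
        then show ?thesis using C(3)[of k n] by simp
      qed
      then have "measure \<Gamma> (E k - (\<Union>n. C k n)) \<le> 0"
        using LIMSEQ_inverse_real_of_nat by (intro LIMSEQ_le_const) (auto simp: inverse_eq_divide)
      then show "E k - (\<Union>n. C k n) \<in> null_sets \<Gamma>"
        using b by (auto simp: emeasure_eq_measure null_sets_def measure_le_0_iff)
    qed
    then have "AE x in \<Gamma>. \<forall>k. x \<notin> E k - (\<Union>n. C k n)" by (simp add: AE_all_countable)
    then show ?thesis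
    proof (rule AE_mp, intro AE_I2 impI)
      fix x assume x: "\<forall>k. x \<notin> E k - (\<Union>n. C k n)"
      show "\<zeta> (fst x) \<le> G x + ennreal \<epsilon>"
      proof (cases "G x")
        case (real r)
        define k where "k = nat \<lfloor>r / \<epsilon>\<rfloor>"
        have "0 \<le> r / \<epsilon>" using real(1) \<epsilon> by simp
        then have "real k = of_int \<lfloor>r / \<epsilon>\<rfloor>" by (simp add: k_def)
        then have k1: "real k \<le> r / \<epsilon>" "r / \<epsilon> < real (Suc k)"
          using of_int_floor_le[of "r / \<epsilon>"] real_of_int_floor_add_one_gt[of "r / \<epsilon>"]
          unfolding of_nat_Suc by linarith+
        have k: "real k * \<epsilon> \<le> r" "r < real (Suc k) * \<epsilon>"
          using k1 \<epsilon> by (simp_all only: pos_le_divide_eq pos_divide_less_eq)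
        then have "x \<in> E k" using real \<epsilon> by (auto simp: E_def intro!: ennreal_leI ennreal_lessI)
        then obtain n where "x \<in> C k n" using x by blast
        then have w: "fst x \<in> A k" by (auto simp: A_def)
        then have "(LEAST k. fst x \<in> A k) \<le> k" by (rule Least_le)
        then have "\<zeta> (fst x) \<le> ennreal (real (Suc k) * \<epsilon>)"
          using w \<epsilon> by (auto simp: \<zeta>_def intro!: ennreal_leI mult_right_mono)
        also have "\<dots> \<le> ennreal (r + \<epsilon>)" using k \<epsilon> by (intro ennreal_leI) (simp add: algebra_simps)
        finally show ?thesis using real \<epsilon> by simp
      qed simp
    qed
  qed
  ultimately show thesis using that by blast
qed

text \<open>Instead of gluing two couplings along \<open>\<kappa>\<close>, a dual pair \<open>(\<phi>, \<psi>)\<close> for \<open>c\<close> is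
  split at the intermediate function \<open>\<zeta>(w) = inf\<^sub>v (\<psi>(v) + D c2(w, v))\<close>. Then \<open>(\<phi>, \<zeta>)\<close> is admissible
  for \<open>D c1\<close>, and \<open>(\<zeta>, \<psi>)\<close> is admissible for \<open>D c2\<close>.
  For the Borel version of \<open>\<zeta>\<close> the second claim holds up to \<open>\<epsilon>\<close> and almost everywhere under a nearly optimal
  coupling, which is enough to integrate it.\<close>

theorem wasserstein_triangle:
  fixes c :: "'a::{second_countable_topology, complete_space} \<Rightarrow> 'a \<Rightarrow> real"
  assumes \<mu>: "\<mu> \<in> Pr" and \<nu>: "\<nu> \<in> Pr"
    and c: "lsc_cost c" "lsc_cost c1" "lsc_cost c2" and D: "0 < D"
    and tri: "\<And>u v w. c u v \<le> D * (c1 u w + c2 w v)"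
  shows "wasserstein c \<mu> \<nu> \<le> ennreal D * (wasserstein c1 \<mu> \<kappa> + wasserstein c2 \<kappa> \<nu>)"
proof (cases "wasserstein c2 \<kappa> \<nu> = \<infinity>")
  case True then show ?thesis using D by (simp add: ennreal_mult_top)
next
  case False
  show ?thesis
  proof (rule wasserstein_leI[OF \<mu> \<nu> c(1)])
    fix \<phi> \<psi> :: "'a \<Rightarrow> ennreal"
    assume m: "\<phi> \<in> borel_measurable borel" "\<psi> \<in> borel_measurable borel"
      and le: "\<And>u v. \<phi> u \<le> \<psi> v + ennreal (c u v)"
    have nn: "0 \<le> c1 u v" "0 \<le> c2 u v" for u v using c by (auto simp: lsc_cost_def)
    show "(\<integral>\<^sup>+u. \<phi> u \<partial>\<mu>) \<le> (\<integral>\<^sup>+v. \<psi> v \<partial>\<nu>) + ennreal D * (wasserstein c1 \<mu> \<kappa> + wasserstein c2 \<kappa> \<nu>)"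
    proof (rule ennreal_le_epsilon)
      fix e :: real assume e: "0 < e"
      define \<epsilon> where "\<epsilon> = e / (D + 1)"
      have \<epsilon>: "0 < \<epsilon>" using e D by (simp add: \<epsilon>_def)
      obtain \<Gamma> where \<Gamma>: "\<Gamma> \<in> couplings \<kappa> \<nu>"
          "(\<integral>\<^sup>+x. ennreal (c2 (fst x) (snd x)) \<partial>\<Gamma>) \<le> wasserstein c2 \<kappa> \<nu> + ennreal \<epsilon>"
        using wasserstein_approx[OF False \<epsilon>] by blast
      have \<Gamma>': "\<Gamma> \<in> Pr" using \<Gamma>(1) by (auto simp: couplings_def)
      interpret prob_space \<Gamma> using \<Gamma>' by (simp add: Pr_iff)
      define G where "G x = \<psi> (snd x) + ennreal D * ennreal (c2 (fst x) (snd x))" for x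
      have m2: "(\<lambda>x. ennreal (c2 (fst x) (snd x))) \<in> borel_measurable borel"
        using lsc_cost_measurable[of c2] c(3) by (simp add: lsc_cost_def case_prod_beta')
      have m3: "(\<lambda>x::'a \<times> 'a. \<psi> (snd x)) \<in> borel_measurable borel"
        by (intro measurable_compose[OF _ m(2)] borel_measurable_continuous_onI continuous_on_snd continuous_on_id)
      have G: "G \<in> borel_measurable borel" unfolding G_def using m2 m3 by measurable
      obtain \<zeta> where \<zeta>: "\<zeta> \<in> borel_measurable borel"
          "\<And>w. \<zeta> w = \<infinity> \<or> (\<exists>v. G (w, v) \<le> \<zeta> w)"
          "AE x in \<Gamma>. \<zeta> (fst x) \<le> G x + ennreal \<epsilon>"
        using borel_partial_infimum[OF \<Gamma>' G \<epsilon>] by blast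
      have "\<phi> u \<le> \<zeta> w + ennreal D * ennreal (c1 u w)" for u w
        using \<zeta>(2)[of w]
      proof
        assume "\<exists>v. G (w, v) \<le> \<zeta> w"
        then obtain v where v: "G (w, v) \<le> \<zeta> w" by blast
        have "\<phi> u \<le> \<psi> v + ennreal (D * (c1 u w + c2 w v))"
          using le[of u v] tri[of u v w] by (meson add_left_mono ennreal_leI order_trans)
        also have "ennreal (D * (c1 u w + c2 w v)) = ennreal D * ennreal (c1 u w) + ennreal D * ennreal (c2 w v)"
          using D nn by (simp add: ennreal_mult distrib_left)
        also have "\<psi> v + \<dots> = G (w, v) + ennreal D * ennreal (c1 u w)" by (simp add: G_def ac_simps)
        also have "\<dots> \<le> \<zeta> w + ennreal D * ennreal (c1 u w)" by (intro add_right_mono v)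
        finally show ?thesis .
      qed simp
      then have "(\<integral>\<^sup>+u. \<phi> u \<partial>\<mu>) \<le> (\<integral>\<^sup>+w. \<zeta> w \<partial>\<kappa>) + ennreal D * wasserstein c1 \<mu> \<kappa>"
        by (rule wasserstein_dual_le[OF c(2) D m(1) \<zeta>(1)])
      also have "(\<integral>\<^sup>+w. \<zeta> w \<partial>\<kappa>) = (\<integral>\<^sup>+x. \<zeta> (fst x) \<partial>\<Gamma>)" using couplings_integrals(1)[OF \<Gamma>(1) \<zeta>(1)] by simp
      also have "\<dots> \<le> (\<integral>\<^sup>+x. G x + ennreal \<epsilon> \<partial>\<Gamma>)" by (rule nn_integral_mono_AE[OF \<zeta>(3)])
      also have "\<dots> = (\<integral>\<^sup>+x. G x \<partial>\<Gamma>) + ennreal \<epsilon>"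
        using Pr_measurable[OF \<Gamma>' G] by (simp add: nn_integral_add emeasure_space_1)
      also have "(\<integral>\<^sup>+x. G x \<partial>\<Gamma>) = (\<integral>\<^sup>+v. \<psi> v \<partial>\<nu>) + ennreal D * (\<integral>\<^sup>+x. ennreal (c2 (fst x) (snd x)) \<partial>\<Gamma>)"
        unfolding G_def using Pr_measurable[OF \<Gamma>' m2] Pr_measurable[OF \<Gamma>' m3]
        by (simp add: nn_integral_add nn_integral_cmult couplings_integrals(2)[OF \<Gamma>(1) m(2)])
      also have "\<dots> \<le> (\<integral>\<^sup>+v. \<psi> v \<partial>\<nu>) + ennreal D * (wasserstein c2 \<kappa> \<nu> + ennreal \<epsilon>)"
        by (intro add_left_mono mult_left_mono \<Gamma>(2)) simp
      finally have "(\<integral>\<^sup>+u. \<phi> u \<partial>\<mu>) \<le> (\<integral>\<^sup>+v. \<psi> v \<partial>\<nu>) + ennreal D * (wasserstein c2 \<kappa> \<nu> + ennreal \<epsilon>) + ennreal \<epsilon>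
          + ennreal D * wasserstein c1 \<mu> \<kappa>" by (simp add: add_right_mono)
      also have "\<dots> = (\<integral>\<^sup>+v. \<psi> v \<partial>\<nu>) + ennreal D * (wasserstein c1 \<mu> \<kappa> + wasserstein c2 \<kappa> \<nu>)
          + (ennreal D * ennreal \<epsilon> + ennreal \<epsilon>)" by (simp add: distrib_left ac_simps)
      also have "ennreal D * ennreal \<epsilon> + ennreal \<epsilon> = ennreal e"
      proof -
        have "(D + 1) * \<epsilon> = e" using D by (simp add: \<epsilon>_def)
        then have "D * \<epsilon> + \<epsilon> = e" by (simp add: distrib_right)
        then show ?thesis using D \<epsilon> by (simp flip: ennreal_mult ennreal_plus)
      qed
      finally show "(\<integral>\<^sup>+u. \<phi> u \<partial>\<mu>) \<le> (\<integral>\<^sup>+v. \<psi> v \<partial>\<nu>) +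
          ennreal D * (wasserstein c1 \<mu> \<kappa> + wasserstein c2 \<kappa> \<nu>) + ennreal e" .
    qed
  qed
qed

section \<open>The weighted distances\<close>

text \<open>Multiplying a lower semicontinuous function by a positive continuous weight keeps sublevel sets closed; this is
  the form in which it is needed for the weighted distances.\<close>

lemma closed_lsc_le_continuous:
  fixes h k :: "'b::topological_space \<Rightarrow> real"
  assumes h: "lower_semicontinuous h" and k: "continuous_on UNIV k"
  shows "closed {x. h x \<le> k x}"
proof -
  have eq: "- {x. h x \<le> k x} = (\<Union>q. - {x. h x \<le> q} \<inter> {x. k x < q})"
    by (auto simp: not_le) (metis dense not_le)
  have op: "open (- {x. h x \<le> q} \<inter> {x. k x < q})" for q
    using h k by (intro open_Int open_Collect_less) (auto simp: lower_semicontinuous_def)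
  show ?thesis unfolding closed_def eq by (intro open_UN ballI op)
qed

lemma lsc_cost_weighted:
  fixes \<rho> :: "'a::real_normed_vector \<Rightarrow> 'a \<Rightarrow> real"
  assumes \<rho>: "distance_like \<rho>" shows "lsc_cost (weighted \<rho> a)"
proof -
  have nn: "0 \<le> \<rho> u v" for u v using \<rho> by (simp add: distance_like_def)
  have "closed {x. (case x of (u, v) \<Rightarrow> weighted \<rho> a u v) \<le> r}" for r
  proof (cases "r < 0")
    case True
    have "0 \<le> weighted \<rho> a u v" for u v by (simp add: weighted_def nn)
    then have eq: "{x. (case x of (u, v) \<Rightarrow> weighted \<rho> a u v) \<le> r} = {}"
      using True by (auto simp: not_le intro: less_le_trans)
    show ?thesis unfolding eq by (rule closed_empty)
  next
    case False
    have shift: "s * exp y \<le> r \<longleftrightarrow> s \<le> r * exp (- y)" for s y :: real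
      by (simp add: exp_minus field_simps)
    let ?k = "\<lambda>x::'a \<times> 'a. (r * exp (- (a * (norm (fst x))\<^sup>2 + a * (norm (snd x))\<^sup>2)))\<^sup>2"
    have "weighted \<rho> a u v \<le> r \<longleftrightarrow> \<rho> u v \<le> ?k (u, v)" for u v
    proof -
      have "weighted \<rho> a u v \<le> r \<longleftrightarrow> sqrt (\<rho> u v) \<le> r * exp (- (a * (norm u)\<^sup>2 + a * (norm v)\<^sup>2))"
        unfolding weighted_def by (rule shift)
      also have "\<dots> \<longleftrightarrow> sqrt (\<rho> u v) \<le> sqrt (?k (u, v))" using False by simp
      finally show ?thesis by (simp only: real_sqrt_le_iff)
    qed
    then have eq: "{x. (case x of (u, v) \<Rightarrow> weighted \<rho> a u v) \<le> r} = {x. (\<lambda>(u, v). \<rho> u v) x \<le> ?k x}"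
      by auto
    show ?thesis unfolding eq
      using \<rho> by (intro closed_lsc_le_continuous continuous_intros) (simp add: distance_like_def)
  qed
  then show ?thesis
    by (auto simp: lsc_cost_def lower_semicontinuous_def weighted_def nn)
qed

lemma weighted_mono:
  assumes "distance_like \<rho>" "a \<le> b" shows "weighted \<rho> a u v \<le> weighted \<rho> b u v"
  using assms unfolding weighted_def distance_like_def
  by (intro mult_left_mono) (auto intro!: add_mono mult_right_mono)

lemma weighted_sym: "distance_like \<rho> \<Longrightarrow> weighted \<rho> a u v = weighted \<rho> a v u"
  by (simp add: weighted_def distance_like_def add.commute)

lemma weighted_refl: "distance_like \<rho> \<Longrightarrow> weighted \<rho> a u u = 0"
  by (simp add: weighted_def distance_like_def)

section \<open>Iterated kernels and invariant measures\<close>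

lemma Pr_bind:
  assumes "\<nu> \<in> Pr" "markov_kernel Q" shows "\<nu> \<bind> Q \<in> Pr"
  using prob_space_bind'[OF assms(1), of Q borel] sets_bind'[OF assms(1), of Q borel] assms(2)
  by (auto simp: Pr_iff markov_kernel_def)

primrec kernel_iter :: "('a::topological_space \<Rightarrow> 'a measure) \<Rightarrow> nat \<Rightarrow> 'a \<Rightarrow> 'a measure" where
  "kernel_iter Q 0 = return borel"
| "kernel_iter Q (Suc n) = (\<lambda>u. kernel_iter Q n u \<bind> Q)"

lemma kernel_iter_kernel: "markov_kernel Q \<Longrightarrow> markov_kernel (kernel_iter Q n)"
proof (induction n)
  case 0 then show ?case by (simp add: markov_kernel_def)
next
  case (Suc n)
  then show ?case using measurable_bind_prob_space[of "kernel_iter Q n" borel borel Q borel]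
    by (simp add: markov_kernel_def)
qed

lemma kernel_iter_Pr: "markov_kernel Q \<Longrightarrow> kernel_iter Q n u \<in> Pr"
  using measurable_space[of "kernel_iter Q n" borel "prob_algebra borel" u] kernel_iter_kernel[of Q n]
  by (simp add: markov_kernel_def)

lemma bind_kernel_iter_0: "\<nu> \<in> Pr \<Longrightarrow> \<nu> \<bind> kernel_iter Q 0 = \<nu>"
  by (simp add: bind_return'' Pr_iff)

lemma bind_kernel_iter_Suc:
  assumes "\<nu> \<in> Pr" "markov_kernel Q"
  shows "\<nu> \<bind> kernel_iter Q (Suc n) = (\<nu> \<bind> kernel_iter Q n) \<bind> Q"
proof -
  have "kernel_iter Q n \<in> \<nu> \<rightarrow>\<^sub>M subprob_algebra borel"
    using kernel_iter_kernel[OF assms(2), of n]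
    by (intro Pr_measurable[OF assms(1)] measurable_prob_algebraD) (simp add: markov_kernel_def)
  moreover have "Q \<in> borel \<rightarrow>\<^sub>M subprob_algebra borel"
    using assms(2) by (intro measurable_prob_algebraD) (simp add: markov_kernel_def)
  ultimately show ?thesis by (simp add: bind_assoc)
qed

text \<open>From point masses the iterates contract geometrically, so the truncated cost between \<open>Q\<^sup>n(u)\<close> and
  \<open>Q\<^sup>n(v)\<close> is at most \<open>min (\<kappa>\<^sup>n d(u, v)) K\<close>. Averaging over the product of the initial laws and dominated convergence give
  the claim, even when the initial laws are at infinite distance from each other.\<close>

lemma truncated_wasserstein_iterates_tendsto_0:
  fixes b d e :: "'a::{second_countable_topology, complete_space} \<Rightarrow> 'a \<Rightarrow> real"
  assumes Q: "markov_kernel Q" and lsc: "lsc_cost d"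
    and le: "\<And>u v. b u v \<le> d u v" "\<And>u v. d u v \<le> e u v"
    and \<kappa>: "0 \<le> \<kappa>" "\<kappa> < 1"
    and contr: "\<And>\<nu> \<nu>'. \<nu> \<in> Pr \<Longrightarrow> \<nu>' \<in> Pr \<Longrightarrow>
      wasserstein e (\<nu> \<bind> Q) (\<nu>' \<bind> Q) \<le> ennreal \<kappa> * wasserstein b \<nu> \<nu>'"
    and \<nu>: "\<nu>1 \<in> Pr" "\<nu>2 \<in> Pr" and K: "0 \<le> K"
  shows "(\<lambda>n. wasserstein (\<lambda>u v. min (d u v) K) (\<nu>1 \<bind> kernel_iter Q n) (\<nu>2 \<bind> kernel_iter Q n)) \<longlonglongrightarrow> 0"
proof -
  let ?dK = "\<lambda>u v. min (d u v) K"
  define h where "h n x = ennreal (min (\<kappa> ^ n * d (fst x) (snd x)) K)" for n x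
  have lscK: "lsc_cost ?dK" by (rule lsc_cost_min[OF lsc K])
  have nn: "0 \<le> d u v" for u v using lsc by (simp add: lsc_cost_def)
  \<comment> \<open>Contraction controls the cost \<open>e \<ge> d\<close> by \<open>b \<le> d\<close>, so it can be iterated in \<open>d\<close>.\<close>
  have ptd: "wasserstein d (kernel_iter Q n u) (kernel_iter Q n v) \<le> ennreal (\<kappa> ^ n * d u v)" for n u v
  proof (induction n)
    case 0 then show ?case using wasserstein_return[OF lsc] by simp
  next
    case (Suc n)
    have "wasserstein d (kernel_iter Q (Suc n) u) (kernel_iter Q (Suc n) v)
        \<le> wasserstein e (kernel_iter Q n u \<bind> Q) (kernel_iter Q n v \<bind> Q)"
      by (simp add: wasserstein_mono le)
    also have "\<dots> \<le> ennreal \<kappa> * wasserstein b (kernel_iter Q n u) (kernel_iter Q n v)"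
      by (intro contr kernel_iter_Pr Q)
    also have "\<dots> \<le> ennreal \<kappa> * wasserstein d (kernel_iter Q n u) (kernel_iter Q n v)"
      by (intro mult_left_mono wasserstein_mono le) simp
    also have "\<dots> \<le> ennreal \<kappa> * ennreal (\<kappa> ^ n * d u v)" by (intro mult_left_mono Suc) simp
    also have "\<dots> = ennreal (\<kappa> ^ Suc n * d u v)"
      using \<kappa> nn by (simp add: ennreal_mult[symmetric] mult.assoc)
    finally show ?case .
  qed
  have pt: "wasserstein ?dK (kernel_iter Q n (fst x)) (kernel_iter Q n (snd x)) \<le> h n x" for n x
  proof -
    have "wasserstein ?dK (kernel_iter Q n (fst x)) (kernel_iter Q n (snd x)) \<le> ennreal (\<kappa> ^ n * d (fst x) (snd x))"
      by (rule order_trans[OF wasserstein_mono ptd]) simp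
    moreover have "wasserstein ?dK (kernel_iter Q n (fst x)) (kernel_iter Q n (snd x)) \<le> ennreal K"
      by (intro wasserstein_le_const kernel_iter_Pr Q lscK) simp
    ultimately show ?thesis by (simp add: h_def min_def)
  qed
  have dm: "(\<lambda>x. d (fst x) (snd x)) \<in> borel_measurable (borel \<Otimes>\<^sub>M borel)"
    using lsc_borel_measurable[of "\<lambda>(u, v). d u v"] lsc by (simp add: lsc_cost_def borel_prod case_prod_beta')
  have hm: "h n \<in> borel_measurable (borel \<Otimes>\<^sub>M borel)" for n
    unfolding h_def using dm by measurable
  let ?N = "\<nu>1 \<Otimes>\<^sub>M \<nu>2"
  interpret N1: prob_space \<nu>1 using \<nu>(1) by (simp add: Pr_iff)
  interpret N2: prob_space \<nu>2 using \<nu>(2) by (simp add: Pr_iff)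
  interpret pair_prob_space \<nu>1 \<nu>2 ..
  have sN: "sets ?N = sets (borel \<Otimes>\<^sub>M borel)"
    using \<nu> by (intro sets_pair_measure_cong) (auto simp: Pr_iff)
  have N: "?N \<in> space (prob_algebra (borel \<Otimes>\<^sub>M borel))"
    using sN P.prob_space_axioms by (simp add: space_prob_algebra)
  have hN: "h n \<in> borel_measurable ?N" for n using hm measurable_cong_sets[OF sN refl] by blast
  have k: "kernel_iter Q n \<in> borel \<rightarrow>\<^sub>M prob_algebra borel" for n
    using kernel_iter_kernel[OF Q] by (simp add: markov_kernel_def)
  have k1: "(\<lambda>x. kernel_iter Q n (fst x)) \<in> borel \<Otimes>\<^sub>M borel \<rightarrow>\<^sub>M prob_algebra borel"
       "(\<lambda>x. kernel_iter Q n (snd x)) \<in> borel \<Otimes>\<^sub>M borel \<rightarrow>\<^sub>M prob_algebra borel" for n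
    by (auto intro!: measurable_compose[OF measurable_fst k] measurable_compose[OF measurable_snd k])
  have b1: "?N \<bind> (\<lambda>x. kernel_iter Q n (fst x)) = \<nu>1 \<bind> kernel_iter Q n" for n
  proof -
    have "distr ?N \<nu>1 fst = \<nu>1" by (rule N2.distr_pair_fst)
    moreover have "distr ?N \<nu>1 fst \<bind> kernel_iter Q n = ?N \<bind> (\<lambda>x. kernel_iter Q n (fst x))"
      by (rule bind_distr[OF measurable_fst]) (auto intro!: Pr_measurable[OF \<nu>(1)] measurable_prob_algebraD k N1.not_empty N2.not_empty simp: space_pair_measure)
    ultimately show ?thesis by simp
  qed
  have b2: "?N \<bind> (\<lambda>x. kernel_iter Q n (snd x)) = \<nu>2 \<bind> kernel_iter Q n" for n
  proof -
    have "distr ?N \<nu>2 snd = \<nu>2"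
    proof (rule measure_eqI)
      fix A assume "A \<in> sets (distr ?N \<nu>2 snd)"
      then have A: "A \<in> sets \<nu>2" by simp
      have "snd -` A \<inter> space ?N = space \<nu>1 \<times> A" using sets.sets_into_space[OF A] by (auto simp: space_pair_measure)
      then show "emeasure (distr ?N \<nu>2 snd) A = emeasure \<nu>2 A"
        using A by (simp add: emeasure_distr N2.emeasure_pair_measure_Times N1.emeasure_space_1)
    qed simp
    moreover have "distr ?N \<nu>2 snd \<bind> kernel_iter Q n = ?N \<bind> (\<lambda>x. kernel_iter Q n (snd x))"
      by (rule bind_distr[OF measurable_snd]) (auto intro!: Pr_measurable[OF \<nu>(2)] measurable_prob_algebraD k N1.not_empty N2.not_empty simp: space_pair_measure)
    ultimately show ?thesis by simp
  qed
  have bound: "wasserstein ?dK (\<nu>1 \<bind> kernel_iter Q n) (\<nu>2 \<bind> kernel_iter Q n) \<le> (\<integral>\<^sup>+x. h n x \<partial>?N)" for n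
    using wasserstein_bind_le[OF lscK N k1(1)[of n] k1(2)[of n] hm pt] by (simp add: b1 b2)
  have "(\<lambda>n. \<integral>\<^sup>+x. h n x \<partial>?N) \<longlonglongrightarrow> (\<integral>\<^sup>+x. 0 \<partial>?N)"
  proof (rule nn_integral_dominated_convergence[where w = "\<lambda>_. ennreal K"])
    show "AE x in ?N. (\<lambda>n. h n x) \<longlonglongrightarrow> 0"
    proof (rule AE_I2)
      fix x
      have "(\<lambda>n. \<kappa> ^ n * d (fst x) (snd x)) \<longlonglongrightarrow> 0 * d (fst x) (snd x)"
        using \<kappa> by (intro tendsto_mult_right LIMSEQ_realpow_zero) auto
      then have "(\<lambda>n. min (\<kappa> ^ n * d (fst x) (snd x)) K) \<longlonglongrightarrow> min (0 * d (fst x) (snd x)) K"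
        by (intro tendsto_min tendsto_const)
      then have "(\<lambda>n. ennreal (min (\<kappa> ^ n * d (fst x) (snd x)) K)) \<longlonglongrightarrow> ennreal (min (0 * d (fst x) (snd x)) K)"
        by (rule tendsto_ennrealI)
      then show "(\<lambda>n. h n x) \<longlonglongrightarrow> 0" using K by (simp add: h_def)
    qed
    show "(\<integral>\<^sup>+x. ennreal K \<partial>?N) < \<infinity>" by (simp add: P.emeasure_space_1)
    show "AE x in ?N. h n x \<le> ennreal K" for n by (intro AE_I2) (simp add: h_def ennreal_leI)
  qed (use hN in auto)
  then have "(\<lambda>n. \<integral>\<^sup>+x. h n x \<partial>?N) \<longlonglongrightarrow> 0" by simp
  then show ?thesis
    by (rule tendsto_sandwich[OF _ _ tendsto_const, rotated 2]) (auto intro!: always_eventually bound)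
qed

text \<open>A perturbation bound for invariant measures, with \<open>r\<close> the error of one step. The three costs \<open>c\<close>,
  \<open>d\<close>, \<open>e\<close> are one weighted distance with growing exponents, and the contraction
  recovers \<open>e\<close> from the smaller exponent of \<open>b\<close>. The iterates \<open>\<nu> Q\<^sup>n\<close> stay within \<open>2 D r\<close> of
  \<open>\<nu>\<close>, because this bound is reproduced by the step \<open>x \<mapsto> D (\<kappa> x + r)\<close> when \<open>D \<kappa> \<le> 1/2\<close>.
  They approach \<open>\<pi>\<close> for every truncated cost. One triangle inequality combines the two, and the
  truncation is removed last because \<open>\<pi>\<close> and \<open>\<nu>\<close> might a priori be at infinite distance.\<close>

lemma wasserstein_invariant_le:
  fixes b c d e :: "'a::{second_countable_topology, complete_space} \<Rightarrow> 'a \<Rightarrow> real"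
  assumes Q: "markov_kernel Q" and lsc: "lsc_cost c" "lsc_cost d" "lsc_cost e"
    and le: "\<And>u v. b u v \<le> d u v" "\<And>u v. d u v \<le> e u v"
    and D: "1 \<le> D"
    and tri: "\<And>u v w. c u v \<le> D * (d u w + d w v)" "\<And>u v w. d u v \<le> D * (e u w + e w v)"
    and zero: "\<And>u. d u u = 0"
    and \<kappa>: "0 \<le> \<kappa>" "D * \<kappa> \<le> 1/2"
    and contr: "\<And>\<nu> \<nu>'. \<nu> \<in> Pr \<Longrightarrow> \<nu>' \<in> Pr \<Longrightarrow>
      wasserstein e (\<nu> \<bind> Q) (\<nu>' \<bind> Q) \<le> ennreal \<kappa> * wasserstein b \<nu> \<nu>'"
    and \<pi>: "\<pi> \<in> Pr" "\<pi> \<bind> Q = \<pi>" and \<nu>: "\<nu> \<in> Pr"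
    and r: "wasserstein e (\<nu> \<bind> Q) \<nu> \<le> r"
  shows "wasserstein c \<pi> \<nu> \<le> ennreal (2 * D\<^sup>2) * r"
proof -
  let ?\<nu> = "\<lambda>n. \<nu> \<bind> kernel_iter Q n"
  have D0: "0 < D" using D by simp
  have Pr\<nu>: "?\<nu> n \<in> Pr" for n by (intro Pr_bind \<nu> kernel_iter_kernel Q)
  have \<pi>n: "\<pi> \<bind> kernel_iter Q n = \<pi>" for n
  proof (induction n)
    case 0 then show ?case by (rule bind_kernel_iter_0[OF \<pi>(1)])
  next
    case (Suc n) then show ?case using bind_kernel_iter_Suc[OF \<pi>(1) Q, of n] \<pi>(2) by simp
  qed
  have step: "wasserstein d (?\<nu> n) \<nu> \<le> ennreal (2 * D) * r" for n
  proof (induction n)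
    case 0
    then show ?case using wasserstein_refl[OF \<nu> lsc(2) zero] by (simp add: bind_kernel_iter_0[OF \<nu>] del: kernel_iter.simps)
  next
    case (Suc n)
    have "wasserstein d (?\<nu> (Suc n)) \<nu>
        \<le> ennreal D * (wasserstein e (?\<nu> n \<bind> Q) (\<nu> \<bind> Q) + wasserstein e (\<nu> \<bind> Q) \<nu>)"
      unfolding bind_kernel_iter_Suc[OF \<nu> Q]
      by (intro wasserstein_triangle Pr_bind Pr\<nu> Q \<nu> lsc D0 tri)
    also have "\<dots> \<le> ennreal D * (ennreal \<kappa> * (ennreal (2 * D) * r) + r)"
    proof (intro mult_left_mono add_mono r)
      have "wasserstein e (?\<nu> n \<bind> Q) (\<nu> \<bind> Q) \<le> ennreal \<kappa> * wasserstein b (?\<nu> n) \<nu>"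
        by (intro contr Pr\<nu> \<nu>)
      also have "\<dots> \<le> ennreal \<kappa> * wasserstein d (?\<nu> n) \<nu>"
        by (intro mult_left_mono wasserstein_mono le) simp
      also have "\<dots> \<le> ennreal \<kappa> * (ennreal (2 * D) * r)" by (intro mult_left_mono Suc) simp
      finally show "wasserstein e (?\<nu> n \<bind> Q) (\<nu> \<bind> Q) \<le> ennreal \<kappa> * (ennreal (2 * D) * r)" .
    qed simp
    also have "\<dots> = (ennreal D * ennreal \<kappa> * ennreal (2 * D) + ennreal D) * r"
      by (simp add: distrib_left distrib_right mult.assoc)
    also have "ennreal D * ennreal \<kappa> * ennreal (2 * D) + ennreal D = ennreal (D * \<kappa> * (2 * D) + D)"
      using D0 \<kappa> by (simp add: ennreal_mult)
    also have "\<dots> * r \<le> ennreal (2 * D) * r"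
    proof (intro mult_right_mono ennreal_leI)
      have "D * \<kappa> * (2 * D) \<le> (1/2) * (2 * D)" using D0 \<kappa>(2) by (intro mult_right_mono) auto
      then show "D * \<kappa> * (2 * D) + D \<le> 2 * D" by simp
    qed simp
    finally show ?case .
  qed
  have \<kappa>1: "\<kappa> < 1"
  proof -
    have "1 * \<kappa> \<le> D * \<kappa>" using D \<kappa>(1) by (intro mult_right_mono)
    then show ?thesis using \<kappa>(2) by simp
  qed
  show ?thesis
  proof (rule wasserstein_le_truncated[OF \<pi>(1) \<nu> lsc(1)])
    fix K :: real assume K: "0 \<le> K"
    let ?t = "\<lambda>h u v. min (h u v) K :: real"
    have nn: "0 \<le> d u v" for u v using lsc(2) by (simp add: lsc_cost_def)
    \<comment> \<open>Truncation preserves the generalized triangle inequality because \<open>D \<ge> 1\<close>.\<close>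
    have triK: "?t c u v \<le> D * (?t d u w + ?t d w v)" for u v w
    proof (cases "d u w \<le> K \<and> d w v \<le> K")
      case True then show ?thesis using tri(1)[of u v w] by simp
    next
      case False
      then have "K \<le> ?t d u w + ?t d w v" using K nn[of u w] nn[of w v] by auto
      then have "1 * K \<le> D * (?t d u w + ?t d w v)" using D K by (intro mult_mono) auto
      then show ?thesis by simp
    qed
    have bound: "wasserstein (?t c) \<pi> \<nu> \<le>
        ennreal D * (wasserstein (?t d) (\<pi> \<bind> kernel_iter Q n) (?\<nu> n) + ennreal (2 * D) * r)" for n
    proof -
      have "wasserstein (?t c) \<pi> \<nu> \<le> ennreal D * (wasserstein (?t d) \<pi> (?\<nu> n) + wasserstein d (?\<nu> n) \<nu>)"
      proof (rule wasserstein_triangle[OF \<pi>(1) \<nu>])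
        show "?t c u v \<le> D * (?t d u w + d w v)" for u v w
          using D0 by (intro order_trans[OF triK[of u v w]] mult_left_mono) auto
      qed (auto intro: lsc_cost_min lsc K D0)
      also have "\<dots> \<le> ennreal D * (wasserstein (?t d) \<pi> (?\<nu> n) + ennreal (2 * D) * r)"
        by (intro mult_left_mono add_left_mono step) simp
      finally show ?thesis by (simp add: \<pi>n)
    qed
    have "(\<lambda>n. ennreal D * (wasserstein (?t d) (\<pi> \<bind> kernel_iter Q n) (?\<nu> n) + ennreal (2 * D) * r))
        \<longlonglongrightarrow> ennreal D * (0 + ennreal (2 * D) * r)"
      by (intro ennreal_tendsto_cmult tendsto_add tendsto_const
          truncated_wasserstein_iterates_tendsto_0[OF Q lsc(2) le \<kappa>(1) \<kappa>1 contr \<pi>(1) \<nu> K]) auto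
    then have "wasserstein (?t c) \<pi> \<nu> \<le> ennreal D * (0 + ennreal (2 * D) * r)"
      by (rule LIMSEQ_le_const) (auto intro: bound)
    also have "\<dots> = ennreal (D * (2 * D)) * r" using D0 by (simp add: ennreal_mult mult.assoc)
    also have "D * (2 * D) = 2 * D\<^sup>2" by (simp add: power2_eq_square)
    finally show "wasserstein (?t c) \<pi> \<nu> \<le> ennreal (2 * D\<^sup>2) * r" .
  qed
qed

section \<open>Perturbations of a contracting family\<close>

text \<open>The hypotheses of the theorem once \<open>\<rho>\<close>, the exponent and \<open>m\<close> are fixed. The costs \<open>w i\<close> stand
  for \<open>\<rho>\<close> weighted with exponent \<open>\<gamma>\<^sup>i \<alpha>\<close>. A triangle inequality leads from \<open>w i\<close> to \<open>w (Suc i)\<close>,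
  perturbation and contraction bounds are available for \<open>w 5\<close>, and contraction is measured by \<open>w 1\<close>.\<close>

locale perturbed_kernels =
  fixes P :: "real \<Rightarrow> 'p::topological_space \<Rightarrow> 'a::{second_countable_topology, complete_space} \<Rightarrow> 'a measure"
    and \<Theta> :: "'p set" and \<theta>0 :: 'p and \<pi> :: "'p \<Rightarrow> 'a measure"
    and w :: "nat \<Rightarrow> 'a \<Rightarrow> 'a \<Rightarrow> real" and D T C1 C2 :: real
    and R :: "real \<Rightarrow> real" and f :: "'a \<Rightarrow> ennreal" and g :: "'p \<Rightarrow> real"
  assumes \<theta>0: "\<theta>0 \<in> \<Theta>" "\<theta>0 islimpt \<Theta>"
    and kernel: "0 \<le> t \<Longrightarrow> \<theta> \<in> \<Theta> \<Longrightarrow> markov_kernel (P t \<theta>)"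
    and \<pi>: "\<theta> \<in> \<Theta> \<Longrightarrow> \<pi> \<theta> \<in> Pr"
    and invariant: "\<theta> \<in> \<Theta> \<Longrightarrow> 0 \<le> t \<Longrightarrow> \<pi> \<theta> \<bind> P t \<theta> = \<pi> \<theta>"
    and lsc: "lsc_cost (w i)"
    and sym: "w i u v = w i v u"
    and zero: "w i u u = 0"
    and mono: "i \<le> j \<Longrightarrow> w i u v \<le> w j u v"
    and D: "1 \<le> D"
    and tri: "i < 5 \<Longrightarrow> w i u v \<le> D * (w (Suc i) u x + w (Suc i) x v)"
    and positive: "0 < T" "0 < C1" "0 < C2"
    and close: "\<theta> \<in> \<Theta> \<Longrightarrow> 0 \<le> t \<Longrightarrow>
      wasserstein (w 5) (P t \<theta> u) (P t \<theta>0 u) \<le> ennreal (R t) * f u * ennreal (g \<theta>)"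
    and contr: "\<theta> \<in> \<Theta> \<Longrightarrow> \<theta> \<noteq> \<theta>0 \<Longrightarrow> T \<le> t \<Longrightarrow> \<mu> \<in> Pr \<Longrightarrow> \<nu> \<in> Pr \<Longrightarrow>
      wasserstein (w 5) (\<mu> \<bind> P t \<theta>) (\<nu> \<bind> P t \<theta>)
        \<le> ennreal (C1 * exp (- t * C2)) * wasserstein (w 1) \<mu> \<nu>"
    and f: "f \<in> borel_measurable borel" and f_inv: "(\<integral>\<^sup>+u. f u \<partial>\<pi> \<theta>0) < \<infinity>"
    and g: "\<theta> \<in> \<Theta> \<Longrightarrow> 0 \<le> g \<theta>" "(g \<longlongrightarrow> 0) (at \<theta>0 within \<Theta>)"
    and R: "0 \<le> t \<Longrightarrow> 0 \<le> R t" "continuous_on {0..} R" "strict_mono_on {0..} R"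
begin

abbreviation F :: "'a measure \<Rightarrow> ennreal" where "F \<nu> \<equiv> \<integral>\<^sup>+u. f u \<partial>\<nu>"

lemma D_pos: "0 < D" "0 \<le> D" using D by auto

lemma bind_P_Pr: "\<nu> \<in> Pr \<Longrightarrow> 0 \<le> t \<Longrightarrow> \<theta> \<in> \<Theta> \<Longrightarrow> \<nu> \<bind> P t \<theta> \<in> Pr"
  by (intro Pr_bind kernel)

lemma wasserstein_w_sym: "wasserstein (w i) \<mu> \<nu> = wasserstein (w i) \<nu> \<mu>"
  by (rule wasserstein_sym[OF lsc sym])

lemma wasserstein_w_triangle:
  assumes "i < 5" "\<mu> \<in> Pr" "\<nu> \<in> Pr"
  shows "wasserstein (w i) \<mu> \<nu> \<le>
    ennreal D * (wasserstein (w (Suc i)) \<mu> \<kappa> + wasserstein (w (Suc i)) \<kappa> \<nu>)"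
  by (intro wasserstein_triangle assms lsc D_pos tri)

lemma perturbation_bound:
  assumes "\<nu> \<in> Pr" "\<theta> \<in> \<Theta>" "0 \<le> t" "i \<le> 5"
  shows "wasserstein (w i) (\<nu> \<bind> P t \<theta>) (\<nu> \<bind> P t \<theta>0) \<le> ennreal (R t) * F \<nu> * ennreal (g \<theta>)"
proof -
  have "wasserstein (w i) (\<nu> \<bind> P t \<theta>) (\<nu> \<bind> P t \<theta>0) \<le> wasserstein (w 5) (\<nu> \<bind> P t \<theta>) (\<nu> \<bind> P t \<theta>0)"
    by (intro wasserstein_mono mono assms)
  also have "\<dots> \<le> (\<integral>\<^sup>+u. ennreal (R t) * f u * ennreal (g \<theta>) \<partial>\<nu>)"
    using kernel assms \<theta>0 f
    by (intro wasserstein_bind_le[OF lsc assms(1)] close) (auto simp: markov_kernel_def)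
  also have "\<dots> = ennreal (R t) * F \<nu> * ennreal (g \<theta>)"
    using Pr_measurable[OF assms(1) f] by (simp add: nn_integral_cmult nn_integral_multc)
  finally show ?thesis .
qed

lemma contraction:
  assumes "\<theta> \<in> \<Theta>" "\<theta> \<noteq> \<theta>0" "T \<le> t" "\<mu> \<in> Pr" "\<nu> \<in> Pr" "i \<le> 5"
  shows "wasserstein (w i) (\<mu> \<bind> P t \<theta>) (\<nu> \<bind> P t \<theta>)
        \<le> ennreal (C1 * exp (- t * C2)) * wasserstein (w 1) \<mu> \<nu>"
  using assms by (intro order_trans[OF wasserstein_mono contr] mono)

text \<open>The perturbation bound for invariant measures, applied to a single kernel of the family for \<open>\<theta>\<close>: started from
  \<open>\<pi> \<theta>0\<close>, one step of it is off by the perturbation error at that time.\<close>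

lemma invariant_measures_close:
  "\<exists>B\<ge>0. \<forall>\<theta>\<in>\<Theta> - {\<theta>0}. wasserstein (w 3) (\<pi> \<theta>) (\<pi> \<theta>0) \<le> ennreal B * (F (\<pi> \<theta>0) * ennreal (g \<theta>))"
proof -
  \<comment> \<open>The time \<open>\<tau>\<close> depends only on the constants, hence neither on \<open>\<theta>\<close> nor on the initial law.\<close>
  define \<tau> where "\<tau> = max T (ln (2 * D * C1) / C2)"
  have \<tau>: "T \<le> \<tau>" "0 \<le> \<tau>" using positive by (auto simp: \<tau>_def)
  define \<kappa> where "\<kappa> = C1 * exp (- \<tau> * C2)"
  have \<kappa>: "0 \<le> \<kappa>" "D * \<kappa> \<le> 1/2"
  proof -
    show "0 \<le> \<kappa>" using positive by (simp add: \<kappa>_def)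
    have "ln (2 * D * C1) / C2 \<le> \<tau>" by (simp add: \<tau>_def)
    then have "ln (2 * D * C1) \<le> \<tau> * C2" using positive by (simp add: field_simps)
    then have "2 * D * C1 \<le> exp (\<tau> * C2)"
      using D_pos positive by (metis exp_le_cancel_iff exp_ln mult_pos_pos zero_less_numeral)
    then have "2 * (D * \<kappa>) \<le> exp (\<tau> * C2) * exp (- \<tau> * C2)"
      using mult_right_mono[of "2 * D * C1" "exp (\<tau> * C2)" "exp (- \<tau> * C2)"] by (simp add: \<kappa>_def mult.assoc)
    also have "\<dots> = 1" by (simp flip: exp_add)
    finally show "D * \<kappa> \<le> 1/2" by simp
  qed
  have "wasserstein (w 3) (\<pi> \<theta>) (\<pi> \<theta>0) \<le> ennreal (2 * D\<^sup>2 * R \<tau>) * (F (\<pi> \<theta>0) * ennreal (g \<theta>))"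
    if \<theta>: "\<theta> \<in> \<Theta>" "\<theta> \<noteq> \<theta>0" for \<theta>
  proof -
    have "wasserstein (w 3) (\<pi> \<theta>) (\<pi> \<theta>0) \<le>
        ennreal (2 * D\<^sup>2) * (ennreal (R \<tau>) * F (\<pi> \<theta>0) * ennreal (g \<theta>))"
    proof (rule wasserstein_invariant_le[where b = "w 1" and c = "w 3" and d = "w 4" and e = "w 5"
          and Q = "P \<tau> \<theta>" and \<kappa> = \<kappa> and \<pi> = "\<pi> \<theta>" and \<nu> = "\<pi> \<theta>0"])
      show "w 3 u v \<le> D * (w 4 u x + w 4 x v)" for u v x
        using tri[of 3 u v x] by (simp add: eval_nat_numeral)
      show "w 4 u v \<le> D * (w 5 u x + w 5 x v)" for u v x
        using tri[of 4 u v x] by (simp add: eval_nat_numeral)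
      show "wasserstein (w 5) (\<pi> \<theta>0 \<bind> P \<tau> \<theta>) (\<pi> \<theta>0) \<le> ennreal (R \<tau>) * F (\<pi> \<theta>0) * ennreal (g \<theta>)"
        using perturbation_bound[OF \<pi>[OF \<theta>0(1)] \<theta>(1) \<tau>(2), of 5] invariant[OF \<theta>0(1) \<tau>(2)] by simp
      show "wasserstein (w 5) (\<mu> \<bind> P \<tau> \<theta>) (\<nu> \<bind> P \<tau> \<theta>) \<le> ennreal \<kappa> * wasserstein (w 1) \<mu> \<nu>"
        if "\<mu> \<in> Pr" "\<nu> \<in> Pr" for \<mu> \<nu>
        unfolding \<kappa>_def by (rule contr[OF \<theta> \<tau>(1) that])
      show "w 1 u v \<le> w 4 u v" "w 4 u v \<le> w 5 u v" for u v by (auto intro: mono)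
    qed (use \<theta> \<theta>0 \<tau> \<kappa> in \<open>simp_all add: kernel lsc D zero \<pi> invariant\<close>)
    also have "\<dots> = ennreal (2 * D\<^sup>2 * R \<tau>) * (F (\<pi> \<theta>0) * ennreal (g \<theta>))"
      using D_pos R(1)[OF \<tau>(2)] by (simp add: ennreal_mult mult.assoc)
    finally show ?thesis .
  qed
  moreover have "0 \<le> 2 * D\<^sup>2 * R \<tau>" using R(1)[OF \<tau>(2)] by simp
  ultimately show ?thesis by blast
qed

text \<open>Contraction for \<open>\<theta>0\<close>: replace it by a nearby \<open>\<theta>\<close>, at the price of perturbation errors at the fixed time \<open>t\<close>,
  which vanish as \<open>\<theta>\<close> tends to \<open>\<theta>0\<close>.\<close>

lemma limit_contraction:
  assumes \<nu>: "\<nu> \<in> Pr" "F \<nu> < \<infinity>" and t: "T \<le> t"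
  shows "wasserstein (w 1) (\<nu> \<bind> P t \<theta>0) (\<pi> \<theta>0) \<le>
    ennreal (D * D * (C1 * exp (- t * C2))) * wasserstein (w 1) \<nu> (\<pi> \<theta>0)"
proof (rule ennreal_le_epsilon)
  fix e :: real assume e: "0 < e"
  have t0: "0 \<le> t" using t positive by simp
  let ?X = "wasserstein (w 1) \<nu> (\<pi> \<theta>0)"
  let ?E = "ennreal (C1 * exp (- t * C2))"
  let ?Z = "ennreal D * (ennreal (R t) * F \<nu>) + ennreal D * (ennreal D * (ennreal (R t) * F (\<pi> \<theta>0)))"
  note \<pi>0 = \<pi>[OF \<theta>0(1)]
  have bound: "wasserstein (w 1) (\<nu> \<bind> P t \<theta>0) (\<pi> \<theta>0) \<le> ennreal D * (ennreal D * (?E * ?X)) + ?Z * ennreal (g \<theta>)"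
    if \<theta>: "\<theta> \<in> \<Theta>" "\<theta> \<noteq> \<theta>0" for \<theta>
  proof -
    have "wasserstein (w (Suc 1)) (\<nu> \<bind> P t \<theta>) (\<pi> \<theta>0) \<le>
        ennreal D * (wasserstein (w (Suc (Suc 1))) (\<nu> \<bind> P t \<theta>) (\<pi> \<theta>0 \<bind> P t \<theta>)
          + wasserstein (w (Suc (Suc 1))) (\<pi> \<theta>0 \<bind> P t \<theta>) (\<pi> \<theta>0))"
      by (intro wasserstein_w_triangle bind_P_Pr \<nu> t0 \<theta> \<pi>0) simp
    also have "\<dots> \<le> ennreal D * (?E * ?X + ennreal (R t) * F (\<pi> \<theta>0) * ennreal (g \<theta>))"
    proof (intro mult_left_mono add_mono)
      show "wasserstein (w (Suc (Suc 1))) (\<nu> \<bind> P t \<theta>) (\<pi> \<theta>0 \<bind> P t \<theta>) \<le> ?E * ?X"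
        by (intro contraction \<theta> t \<nu> \<pi>0) simp
      show "wasserstein (w (Suc (Suc 1))) (\<pi> \<theta>0 \<bind> P t \<theta>) (\<pi> \<theta>0) \<le> ennreal (R t) * F (\<pi> \<theta>0) * ennreal (g \<theta>)"
        using perturbation_bound[OF \<pi>0 \<theta>(1) t0, of "Suc (Suc 1)"] invariant[OF \<theta>0(1) t0] by simp
    qed simp
    finally have 1: "wasserstein (w (Suc 1)) (\<nu> \<bind> P t \<theta>) (\<pi> \<theta>0) \<le>
        ennreal D * (?E * ?X + ennreal (R t) * F (\<pi> \<theta>0) * ennreal (g \<theta>))" .
    have "wasserstein (w 1) (\<nu> \<bind> P t \<theta>0) (\<pi> \<theta>0) \<le>
        ennreal D * (wasserstein (w (Suc 1)) (\<nu> \<bind> P t \<theta>0) (\<nu> \<bind> P t \<theta>) + wasserstein (w (Suc 1)) (\<nu> \<bind> P t \<theta>) (\<pi> \<theta>0))"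
      by (intro wasserstein_w_triangle bind_P_Pr \<nu> t0 \<theta>0 \<pi>0) simp
    also have "\<dots> \<le> ennreal D * (ennreal (R t) * F \<nu> * ennreal (g \<theta>)
        + ennreal D * (?E * ?X + ennreal (R t) * F (\<pi> \<theta>0) * ennreal (g \<theta>)))"
      using perturbation_bound[OF \<nu>(1) \<theta>(1) t0, of "Suc 1"] 1
      by (intro mult_left_mono add_mono) (auto simp: wasserstein_w_sym[of _ "\<nu> \<bind> P t \<theta>0"])
    also have "\<dots> = ennreal D * (ennreal D * (?E * ?X)) + ?Z * ennreal (g \<theta>)" by (simp add: algebra_simps)
    finally show ?thesis .
  qed
  have "?Z < \<infinity>" using \<nu>(2) f_inv by (simp add: ennreal_mult_less_top)
  then obtain z where z: "0 \<le> z" "?Z = ennreal z" by (cases ?Z) auto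
  have "\<forall>\<^sub>F \<theta> in at \<theta>0 within \<Theta>. g \<theta> < e / (z + 1)"
    using e z by (intro order_tendstoD(2)[OF g(2)]) auto
  moreover have "\<forall>\<^sub>F \<theta> in at \<theta>0 within \<Theta>. \<theta> \<in> \<Theta> \<and> \<theta> \<noteq> \<theta>0" by (simp add: eventually_at_filter)
  ultimately have "\<forall>\<^sub>F \<theta> in at \<theta>0 within \<Theta>. g \<theta> < e / (z + 1) \<and> \<theta> \<in> \<Theta> \<and> \<theta> \<noteq> \<theta>0"
    by (rule eventually_conj)
  moreover have "at \<theta>0 within \<Theta> \<noteq> bot" using \<theta>0(2) by (simp add: trivial_limit_within)
  ultimately obtain \<theta> where \<theta>: "g \<theta> < e / (z + 1)" "\<theta> \<in> \<Theta>" "\<theta> \<noteq> \<theta>0"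
    using eventually_happens' by blast
  have "?Z * ennreal (g \<theta>) \<le> ennreal e"
  proof -
    have "z * g \<theta> \<le> (z + 1) * (e / (z + 1))" using z \<theta> g(1) by (intro mult_mono) auto
    then show ?thesis using z g(1)[OF \<theta>(2)] by (simp add: ennreal_mult[symmetric] ennreal_leI)
  qed
  then have "wasserstein (w 1) (\<nu> \<bind> P t \<theta>0) (\<pi> \<theta>0) \<le> ennreal D * (ennreal D * (?E * ?X)) + ennreal e"
    using bound[OF \<theta>(2,3)] by (meson add_left_mono order_trans)
  also have "ennreal D * (ennreal D * (?E * ?X)) = ennreal (D * D * (C1 * exp (- t * C2))) * ?X"
    using D_pos positive by (simp add: ennreal_mult mult.assoc)
  finally show "wasserstein (w 1) (\<nu> \<bind> P t \<theta>0) (\<pi> \<theta>0) \<le> ennreal (D * D * (C1 * exp (- t * C2))) * ?X + ennreal e" .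
qed

text \<open>Both laws are compared with \<open>\<pi> \<theta>0\<close>. On the side of \<open>\<theta>\<close> the path leads through \<open>\<pi> \<theta>0\<close> transported by \<open>P t \<theta>\<close>
  and through \<open>\<pi> \<theta>\<close>, where the stationary error is the distance of the two invariant measures; on the side of \<open>\<theta>0\<close>
  it is the limiting contraction.\<close>

lemma large_time_bound:
  "\<exists>B>0. \<forall>\<theta>\<in>\<Theta> - {\<theta>0}. \<forall>\<nu>\<in>Pr. F \<nu> < \<infinity> \<longrightarrow> (\<forall>t\<ge>T.
     wasserstein (w 0) (\<nu> \<bind> P t \<theta>) (\<nu> \<bind> P t \<theta>0) \<le>
       ennreal B * (ennreal (exp (- t * C2)) * wasserstein (w 1) \<nu> (\<pi> \<theta>0) + F (\<pi> \<theta>0) * ennreal (g \<theta>)))"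
proof -
  obtain B0 where B0: "0 \<le> B0"
      "\<And>\<theta>. \<theta> \<in> \<Theta> \<Longrightarrow> \<theta> \<noteq> \<theta>0 \<Longrightarrow> wasserstein (w 3) (\<pi> \<theta>) (\<pi> \<theta>0) \<le> ennreal B0 * (F (\<pi> \<theta>0) * ennreal (g \<theta>))"
    using invariant_measures_close by blast
  define B1 where "B1 = (D * D + D * (D * D)) * C1"
  define B2 where "B2 = D * (D * (D * (C1 * B0 + B0)))"
  have B12: "0 < B1" "0 \<le> B2" using D_pos positive B0 by (simp_all add: B1_def B2_def add_pos_pos)
  note \<pi>0 = \<pi>[OF \<theta>0(1)]
  have "wasserstein (w 0) (\<nu> \<bind> P t \<theta>) (\<nu> \<bind> P t \<theta>0) \<le>
       ennreal (B1 + B2) * (ennreal (exp (- t * C2)) * wasserstein (w 1) \<nu> (\<pi> \<theta>0) + F (\<pi> \<theta>0) * ennreal (g \<theta>))"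
    if \<theta>: "\<theta> \<in> \<Theta>" "\<theta> \<noteq> \<theta>0" and \<nu>: "\<nu> \<in> Pr" "F \<nu> < \<infinity>" and t: "T \<le> t" for \<theta> \<nu> t
  proof -
    have t0: "0 \<le> t" using t positive by simp
    define X where "X = wasserstein (w 1) \<nu> (\<pi> \<theta>0)"
    define Y where "Y = F (\<pi> \<theta>0) * ennreal (g \<theta>)"
    define c1 where "c1 = ennreal C1"
    define ex where "ex = ennreal (exp (- t * C2))"
    define b0 where "b0 = ennreal B0"
    define d where "d = ennreal D"
    have E: "ennreal (C1 * exp (- t * C2)) = c1 * ex" using positive by (simp add: c1_def ex_def ennreal_mult)
    have ex1: "ex \<le> 1" using t0 positive by (simp add: ex_def ennreal_le_1)
    have inv: "wasserstein (w 3) (\<pi> \<theta>) (\<pi> \<theta>0) \<le> b0 * Y"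
      using B0(2)[OF \<theta>] by (simp add: b0_def Y_def)
    have "wasserstein (w 3) (\<pi> \<theta>0 \<bind> P t \<theta>) (\<pi> \<theta>) \<le> c1 * ex * wasserstein (w 1) (\<pi> \<theta>0) (\<pi> \<theta>)"
      using contraction[OF \<theta> t \<pi>0 \<pi>[OF \<theta>(1)], of 3, unfolded E invariant[OF \<theta>(1) t0]] by simp
    also have "\<dots> \<le> c1 * 1 * wasserstein (w 3) (\<pi> \<theta>) (\<pi> \<theta>0)"
      unfolding wasserstein_w_sym[of 1 "\<pi> \<theta>0"] by (intro mult_mono wasserstein_mono mono ex1) auto
    also have "\<dots> \<le> c1 * (b0 * Y)" using inv by (simp add: mult_left_mono)
    finally have s3: "wasserstein (w 3) (\<pi> \<theta>0 \<bind> P t \<theta>) (\<pi> \<theta>) \<le> c1 * (b0 * Y)" .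
    have "wasserstein (w 2) (\<pi> \<theta>0 \<bind> P t \<theta>) (\<pi> \<theta>0) \<le>
        d * (wasserstein (w (Suc 2)) (\<pi> \<theta>0 \<bind> P t \<theta>) (\<pi> \<theta>) + wasserstein (w (Suc 2)) (\<pi> \<theta>) (\<pi> \<theta>0))"
      unfolding d_def by (intro wasserstein_w_triangle bind_P_Pr \<pi>0 t0 \<theta>) simp
    also have "\<dots> \<le> d * (c1 * (b0 * Y) + b0 * Y)"
      using s3 inv by (intro mult_left_mono add_mono) (simp_all add: eval_nat_numeral)
    finally have s2: "wasserstein (w 2) (\<pi> \<theta>0 \<bind> P t \<theta>) (\<pi> \<theta>0) \<le> d * (c1 * (b0 * Y) + b0 * Y)" .
    have "wasserstein (w 1) (\<nu> \<bind> P t \<theta>) (\<pi> \<theta>0) \<le>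
        d * (wasserstein (w (Suc 1)) (\<nu> \<bind> P t \<theta>) (\<pi> \<theta>0 \<bind> P t \<theta>) + wasserstein (w (Suc 1)) (\<pi> \<theta>0 \<bind> P t \<theta>) (\<pi> \<theta>0))"
      unfolding d_def by (intro wasserstein_w_triangle bind_P_Pr \<nu> \<pi>0 t0 \<theta>) simp
    also have "\<dots> \<le> d * (c1 * ex * X + d * (c1 * (b0 * Y) + b0 * Y))"
      using contraction[OF \<theta> t \<nu>(1) \<pi>0, of "Suc 1", unfolded E] s2
      by (intro mult_left_mono add_mono) (simp_all add: X_def eval_nat_numeral)
    finally have s1: "wasserstein (w 1) (\<nu> \<bind> P t \<theta>) (\<pi> \<theta>0) \<le> d * (c1 * ex * X + d * (c1 * (b0 * Y) + b0 * Y))" .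
    have s1': "wasserstein (w 1) (\<pi> \<theta>0) (\<nu> \<bind> P t \<theta>0) \<le> d * d * (c1 * ex) * X"
    proof -
      have "ennreal (D * D * (C1 * exp (- t * C2))) = d * d * (c1 * ex)"
        using D_pos positive by (simp add: d_def ennreal_mult flip: E)
      then show ?thesis using limit_contraction[OF \<nu> t] unfolding wasserstein_w_sym[of 1 "\<pi> \<theta>0"] X_def by simp
    qed
    have "wasserstein (w 0) (\<nu> \<bind> P t \<theta>) (\<nu> \<bind> P t \<theta>0) \<le>
        d * (wasserstein (w (Suc 0)) (\<nu> \<bind> P t \<theta>) (\<pi> \<theta>0) + wasserstein (w (Suc 0)) (\<pi> \<theta>0) (\<nu> \<bind> P t \<theta>0))"
      unfolding d_def by (intro wasserstein_w_triangle bind_P_Pr \<nu> \<pi>0 t0 \<theta> \<theta>0) simp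
    also have "\<dots> \<le> d * (d * (c1 * ex * X + d * (c1 * (b0 * Y) + b0 * Y)) + d * d * (c1 * ex) * X)"
      using s1 s1' by (intro mult_left_mono add_mono) simp_all
    also have "\<dots> = (d * d + d * (d * d)) * c1 * (ex * X) + d * (d * (d * (c1 * b0 + b0))) * Y"
      by (simp add: algebra_simps)
    also have "(d * d + d * (d * d)) * c1 = ennreal B1"
      using D_pos positive by (simp add: B1_def d_def c1_def ennreal_mult)
    also have "d * (d * (d * (c1 * b0 + b0))) = ennreal B2"
      using D_pos positive B0 by (simp add: B2_def d_def c1_def b0_def ennreal_mult)
    also have "ennreal B1 * (ex * X) + ennreal B2 * Y \<le> ennreal (B1 + B2) * (ex * X) + ennreal (B1 + B2) * Y"
      using B12 by (intro add_mono mult_right_mono ennreal_leI) auto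
    also have "\<dots> = ennreal (B1 + B2) * (ex * X + Y)" by (simp add: distrib_left)
    finally show ?thesis by (simp only: X_def Y_def ex_def)
  qed
  then show ?thesis using B12 by (intro exI[of _ "B1 + B2"]) auto
qed

lemma R_mono: "0 \<le> s \<Longrightarrow> s \<le> t \<Longrightarrow> R s \<le> R t"
  using strict_mono_on_leD[OF R(3), of s t] by simp

text \<open>An unbounded \<open>R\<close> takes every value above \<open>R 0\<close>, so the inverse function in the rate is meaningful.\<close>

lemma range_R:
  assumes "\<not> bounded (R ` {0..})" "R 0 \<le> y"
  shows "y \<in> R ` {0..}"
proof -
  have "\<exists>t\<ge>0. y < R t"
  proof (rule ccontr)
    assume "\<not> ?thesis"
    then have "\<forall>x\<in>R ` {0..}. norm x \<le> y" using R(1) by (auto simp: not_less)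
    then show False using assms(1) by (auto simp: bounded_iff)
  qed
  then obtain t where t: "0 \<le> t" "y < R t" by blast
  have "continuous_on {0..t} R" by (rule continuous_on_subset[OF R(2)]) auto
  then obtain s where "0 \<le> s" "R s = y" using IVT'[of R 0 y t] assms(2) t by auto
  then show ?thesis by auto
qed

lemma wasserstein_w_diagonal: "\<nu> \<in> Pr \<Longrightarrow> 0 \<le> t \<Longrightarrow> wasserstein (w i) (\<nu> \<bind> P t \<theta>0) (\<nu> \<bind> P t \<theta>0) = 0"
  by (intro wasserstein_refl bind_P_Pr \<theta>0 lsc zero)

section \<open>Estimates uniform in time\<close>

abbreviation sup_dist :: "'a measure \<Rightarrow> 'p \<Rightarrow> ennreal" where
  "sup_dist \<nu> \<theta> \<equiv> SUP t\<in>{0..}. wasserstein (w 0) (\<nu> \<bind> P t \<theta>) (\<nu> \<bind> P t \<theta>0)"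

text \<open>When \<open>R\<close> is bounded, the pointwise comparison of the kernels is uniform in time by itself.\<close>

lemma uniform_in_time_bounded:
  assumes bdd: "bounded (R ` {0..})"
  shows "\<exists>C>0. \<forall>\<theta>\<in>\<Theta>. \<forall>\<nu>\<in>Pr. F \<nu> < \<infinity> \<longrightarrow> sup_dist \<nu> \<theta> \<le>
    ennreal (rate R C C2 q (g \<theta>)) * (wasserstein (w 1) \<nu> (\<pi> \<theta>0) + F \<nu> + F (\<pi> \<theta>0))"
proof -
  obtain M where M: "\<And>t. 0 \<le> t \<Longrightarrow> \<bar>R t\<bar> \<le> M" using bdd by (auto simp: bounded_iff)
  define C where "C = max M 1"
  have "sup_dist \<nu> \<theta> \<le> ennreal (rate R C C2 q (g \<theta>)) * (wasserstein (w 1) \<nu> (\<pi> \<theta>0) + F \<nu> + F (\<pi> \<theta>0))"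
    if \<theta>: "\<theta> \<in> \<Theta>" and \<nu>: "\<nu> \<in> Pr" for \<theta> \<nu>
  proof (rule SUP_least)
    fix t :: real assume "t \<in> {0..}"
    then have t: "0 \<le> t" by simp
    have "wasserstein (w 0) (\<nu> \<bind> P t \<theta>) (\<nu> \<bind> P t \<theta>0) \<le> ennreal (R t) * F \<nu> * ennreal (g \<theta>)"
      by (intro perturbation_bound \<nu> \<theta> t) simp
    also have "\<dots> \<le> ennreal C * F \<nu> * ennreal (g \<theta>)"
      using M[OF t] by (intro mult_right_mono ennreal_leI) (auto simp: C_def)
    also have "\<dots> = ennreal (rate R C C2 q (g \<theta>)) * F \<nu>"
      using bdd g(1)[OF \<theta>] by (simp add: rate_def C_def ennreal_mult ac_simps)
    also have "\<dots> \<le> ennreal (rate R C C2 q (g \<theta>)) * (wasserstein (w 1) \<nu> (\<pi> \<theta>0) + F \<nu> + F (\<pi> \<theta>0))"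
      by (intro mult_left_mono) (auto intro: add_increasing add_increasing2)
    finally show "wasserstein (w 0) (\<nu> \<bind> P t \<theta>) (\<nu> \<bind> P t \<theta>0) \<le>
      ennreal (rate R C C2 q (g \<theta>)) * (wasserstein (w 1) \<nu> (\<pi> \<theta>0) + F \<nu> + F (\<pi> \<theta>0))" .
  qed
  moreover have "0 < C" by (simp add: C_def)
  ultimately show ?thesis by blast
qed

text \<open>Up to the switching time the error is \<open>C x\<^sup>1\<^sup>-\<^sup>q\<close>, where \<open>x = g \<theta>\<close>, because \<open>R\<close> increases; after it the large-time bound
  applies, and its exponential is largest at the switching time.\<close>

lemma uniform_in_time_unbounded:
  assumes unb: "\<not> bounded (R ` {0..})" and G: "0 < G" "\<And>\<theta>. \<theta> \<in> \<Theta> \<Longrightarrow> g \<theta> \<le> G" and q: "0 < q"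
  shows "\<exists>C>0. (\<forall>\<theta>\<in>\<Theta>. g \<theta> \<noteq> 0 \<longrightarrow> C * g \<theta> powr (- q) \<in> R ` {0..}) \<and>
    (\<forall>\<theta>\<in>\<Theta>. \<forall>\<nu>\<in>Pr. F \<nu> < \<infinity> \<longrightarrow> sup_dist \<nu> \<theta> \<le>
    ennreal (rate R C C2 q (g \<theta>)) * (wasserstein (w 1) \<nu> (\<pi> \<theta>0) + F \<nu> + F (\<pi> \<theta>0)))"
proof -
  obtain B where B: "0 < B"
    "\<And>\<theta> \<nu> t. \<theta> \<in> \<Theta> \<Longrightarrow> \<theta> \<noteq> \<theta>0 \<Longrightarrow> \<nu> \<in> Pr \<Longrightarrow> F \<nu> < \<infinity> \<Longrightarrow> T \<le> t \<Longrightarrow>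
     wasserstein (w 0) (\<nu> \<bind> P t \<theta>) (\<nu> \<bind> P t \<theta>0) \<le>
       ennreal B * (ennreal (exp (- t * C2)) * wasserstein (w 1) \<nu> (\<pi> \<theta>0) + F (\<pi> \<theta>0) * ennreal (g \<theta>))"
    using large_time_bound by (metis DiffI singletonD)
  have T0: "0 \<le> T" using positive by simp
  \<comment> \<open>The second term makes \<open>C g(\<theta>)\<^sup>-\<^sup>q\<close> at least \<open>R T\<close>, so that the switching time lies in the large-time regime.\<close>
  define C where "C = max B (R T * G powr q)"
  have C: "0 < C" "B \<le> C" "R T * G powr q \<le> C" using B(1) by (auto simp: C_def)
  have large: "R T \<le> C * g \<theta> powr (- q)" if "\<theta> \<in> \<Theta>" "g \<theta> \<noteq> 0" for \<theta>
  proof -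
    have x: "0 < g \<theta>" using g(1)[OF that(1)] that(2) by simp
    have "R T = R T * G powr q * G powr (- q)" using G(1) by (simp add: powr_minus)
    also have "\<dots> \<le> C * g \<theta> powr (- q)"
      using C x q G(2)[OF that(1)] R(1)[OF T0] by (intro mult_mono powr_mono2') auto
    finally show ?thesis .
  qed
  have range: "C * g \<theta> powr (- q) \<in> R ` {0..}" if "\<theta> \<in> \<Theta>" "g \<theta> \<noteq> 0" for \<theta>
    using large[OF that] R_mono[of 0 T] T0 by (intro range_R[OF unb]) auto
  have "sup_dist \<nu> \<theta> \<le> ennreal (rate R C C2 q (g \<theta>)) * (wasserstein (w 1) \<nu> (\<pi> \<theta>0) + F \<nu> + F (\<pi> \<theta>0))"
    if \<theta>: "\<theta> \<in> \<Theta>" and \<nu>: "\<nu> \<in> Pr" "F \<nu> < \<infinity>" for \<theta> \<nu>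
  proof (rule SUP_least)
    fix t :: real assume "t \<in> {0..}"
    then have t: "0 \<le> t" by simp
    let ?W = "wasserstein (w 0) (\<nu> \<bind> P t \<theta>) (\<nu> \<bind> P t \<theta>0)"
    let ?X = "wasserstein (w 1) \<nu> (\<pi> \<theta>0)"
    show "?W \<le> ennreal (rate R C C2 q (g \<theta>)) * (?X + F \<nu> + F (\<pi> \<theta>0))"
    proof (cases "\<theta> = \<theta>0 \<or> g \<theta> = 0")
      case True
      then have "?W = 0"
      proof
        assume "\<theta> = \<theta>0" then show ?thesis using wasserstein_w_diagonal[OF \<nu>(1) t] by simp
      next
        assume "g \<theta> = 0"
        then have "?W \<le> 0" using perturbation_bound[OF \<nu>(1) \<theta> t, of 0] by simp
        then show ?thesis by simp
      qed
      then show ?thesis by simp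
    next
      case False
      define x where "x = g \<theta>"
      have x: "0 < x" using False g(1)[OF \<theta>] by (simp add: x_def)
      \<comment> \<open>The switching time, at which the small-time error \<open>R(t) x\<close> reaches \<open>C x\<^sup>1\<^sup>-\<^sup>q\<close>.\<close>
      define ts where "ts = inv_into {0..} R (C * x powr (- q))"
      have r: "C * x powr (- q) \<in> R ` {0..}" using range[OF \<theta>] False by (simp add: x_def)
      have ts: "0 \<le> ts" "R ts = C * x powr (- q)"
        using inv_into_into[OF r] f_inv_into_f[OF r] by (auto simp: ts_def)
      have "T \<le> ts"
      proof (rule ccontr)
        assume "\<not> T \<le> ts"
        then have "R ts < R T" using strict_mono_onD[OF R(3), of ts T] ts(1) T0 by auto
        then show False using large[OF \<theta>] False ts(2) by (simp add: x_def)
      qed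
      define M where "M = Max {exp (- C2 * ts), x, x powr (1 - q)}"
      have M: "exp (- C2 * ts) \<le> M" "x \<le> M" "x powr (1 - q) \<le> M" "0 \<le> M"
        using x by (auto simp: M_def intro: order_trans[OF less_imp_le[OF x]])
      have rate: "rate R C C2 q (g \<theta>) = C * M"
        using unb x by (simp add: rate_def M_def ts_def x_def[symmetric])
      show ?thesis
      proof (cases "t \<le> ts")
        case True
        have "?W \<le> ennreal (R t) * F \<nu> * ennreal (g \<theta>)" by (intro perturbation_bound \<nu> \<theta> t) simp
        also have "\<dots> \<le> ennreal (R ts) * F \<nu> * ennreal (g \<theta>)"
          using R_mono[OF t True] by (intro mult_right_mono ennreal_leI) auto
        also have "\<dots> = ennreal (R ts * x) * F \<nu>"
          using R(1)[OF ts(1)] x by (simp add: x_def[symmetric] ennreal_mult ac_simps)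
        also have "R ts * x = C * x powr (1 - q)"
          using x by (simp add: ts(2) powr_diff powr_minus field_simps)
        also have "ennreal (C * x powr (1 - q)) * F \<nu> \<le> ennreal (C * M) * (?X + F \<nu> + F (\<pi> \<theta>0))"
          using C M by (intro mult_mono ennreal_leI mult_left_mono) (auto intro: add_increasing add_increasing2)
        finally show ?thesis by (simp add: rate)
      next
        case False
        have "?W \<le> ennreal B * (ennreal (exp (- t * C2)) * ?X + F (\<pi> \<theta>0) * ennreal (g \<theta>))"
          using False \<open>T \<le> ts\<close> \<open>\<not> (\<theta> = \<theta>0 \<or> g \<theta> = 0)\<close> by (intro B(2) \<theta> \<nu>) auto
        also have "\<dots> \<le> ennreal C * (ennreal M * ?X + F (\<pi> \<theta>0) * ennreal M)"
        proof (intro mult_mono add_mono ennreal_leI C)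
          have "ts * C2 \<le> t * C2" using False positive by (intro mult_right_mono) auto
          then have "exp (- t * C2) \<le> exp (- C2 * ts)" by (simp add: mult.commute)
          then show "exp (- t * C2) \<le> M" by (rule order_trans[OF _ M(1)])
          show "g \<theta> \<le> M" using M(2) by (simp add: x_def)
        qed auto
        also have "\<dots> = ennreal (C * M) * (?X + F (\<pi> \<theta>0))"
          using C M by (simp add: ennreal_mult distrib_left ac_simps)
        also have "\<dots> \<le> ennreal (C * M) * (?X + F \<nu> + F (\<pi> \<theta>0))"
          by (intro mult_left_mono add_right_mono) (auto intro: add_increasing2)
        finally show ?thesis by (simp add: rate)
      qed
    qed
  qed
  then show ?thesis using C(1) range by blast
qed

text \<open>A fixed switching time suffices for the limit: choose it so late that the forgetting term is below \<open>\<epsilon>/2\<close>, and then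
  let \<open>g(\<theta>)\<close> tend to zero.\<close>

lemma sup_dist_tendsto_0:
  assumes \<nu>: "\<nu> \<in> Pr" "F \<nu> < \<infinity>" and X: "wasserstein (w 1) \<nu> (\<pi> \<theta>0) < \<infinity>"
  shows "(sup_dist \<nu> \<longlongrightarrow> 0) (at \<theta>0 within \<Theta>)"
proof (rule order_tendstoI)
  fix a :: ennreal assume "0 < a"
  then obtain \<epsilon>' where "0 < \<epsilon>'" "\<epsilon>' < a" using dense by blast
  then obtain \<epsilon> where \<epsilon>: "0 < \<epsilon>" "ennreal \<epsilon> < a" by (cases \<epsilon>') auto
  obtain B where B: "0 < B"
    "\<And>\<theta> t. \<theta> \<in> \<Theta> \<Longrightarrow> \<theta> \<noteq> \<theta>0 \<Longrightarrow> T \<le> t \<Longrightarrow>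
     wasserstein (w 0) (\<nu> \<bind> P t \<theta>) (\<nu> \<bind> P t \<theta>0) \<le>
       ennreal B * (ennreal (exp (- t * C2)) * wasserstein (w 1) \<nu> (\<pi> \<theta>0) + F (\<pi> \<theta>0) * ennreal (g \<theta>))"
    using large_time_bound \<nu> by (metis DiffI singletonD)
  obtain X where X: "0 \<le> X" "wasserstein (w 1) \<nu> (\<pi> \<theta>0) = ennreal X"
    using X by (cases "wasserstein (w 1) \<nu> (\<pi> \<theta>0)") auto
  obtain y where y: "0 \<le> y" "F (\<pi> \<theta>0) = ennreal y" using f_inv by (cases "F (\<pi> \<theta>0)") auto
  obtain z where z: "0 \<le> z" "F \<nu> = ennreal z" using \<nu> by (cases "F \<nu>") auto
  have "((\<lambda>t. B * (exp (- t * C2) * X)) \<longlongrightarrow> B * (0 * X)) at_top"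
    using positive by (intro tendsto_intros filterlim_compose[OF exp_at_bot])
      (auto simp: filterlim_uminus_at_bot filterlim_tendsto_pos_mult_at_top[OF tendsto_const] mult.commute
        intro!: filterlim_at_top_mult_tendsto_pos[OF tendsto_const _ filterlim_ident])
  then have "\<forall>\<^sub>F t in at_top. B * (exp (- t * C2) * X) < \<epsilon>/2"
    using \<epsilon>(1) by (intro order_tendstoD(2)) auto
  then have "\<forall>\<^sub>F t in at_top. B * (exp (- t * C2) * X) < \<epsilon>/2 \<and> T \<le> t"
    using eventually_ge_at_top by (rule eventually_conj)
  then obtain ts where ts: "B * (exp (- ts * C2) * X) < \<epsilon>/2" "T \<le> ts"
    by (auto simp: eventually_at_top_linorder)
  have ts0: "0 \<le> ts" using ts positive by simp
  have "((\<lambda>\<theta>. B * (y * g \<theta>)) \<longlongrightarrow> B * (y * 0)) (at \<theta>0 within \<Theta>)" by (intro tendsto_intros g(2))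
  then have ev1: "\<forall>\<^sub>F \<theta> in at \<theta>0 within \<Theta>. B * (y * g \<theta>) < \<epsilon>/2"
    using \<epsilon>(1) by (intro order_tendstoD(2)) auto
  have "((\<lambda>\<theta>. R ts * z * g \<theta>) \<longlongrightarrow> R ts * z * 0) (at \<theta>0 within \<Theta>)" by (intro tendsto_intros g(2))
  then have ev2: "\<forall>\<^sub>F \<theta> in at \<theta>0 within \<Theta>. R ts * z * g \<theta> < \<epsilon>"
    using \<epsilon>(1) by (intro order_tendstoD(2)) auto
  have ev3: "\<forall>\<^sub>F \<theta> in at \<theta>0 within \<Theta>. \<theta> \<in> \<Theta> \<and> \<theta> \<noteq> \<theta>0" by (simp add: eventually_at_filter)
  show "\<forall>\<^sub>F \<theta> in at \<theta>0 within \<Theta>. sup_dist \<nu> \<theta> < a"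
    using ev1 ev2 ev3
  proof eventually_elim
    case (elim \<theta>)
    then have \<theta>: "\<theta> \<in> \<Theta>" "\<theta> \<noteq> \<theta>0" by auto
    have "sup_dist \<nu> \<theta> \<le> ennreal \<epsilon>"
    proof (rule SUP_least)
      fix t :: real assume "t \<in> {0..}"
      then have t: "0 \<le> t" by simp
      show "wasserstein (w 0) (\<nu> \<bind> P t \<theta>) (\<nu> \<bind> P t \<theta>0) \<le> ennreal \<epsilon>"
      proof (cases "t \<le> ts")
        case True
        have "wasserstein (w 0) (\<nu> \<bind> P t \<theta>) (\<nu> \<bind> P t \<theta>0) \<le> ennreal (R t) * F \<nu> * ennreal (g \<theta>)"
          by (intro perturbation_bound \<nu> \<theta> t) simp
        also have "\<dots> \<le> ennreal (R ts) * F \<nu> * ennreal (g \<theta>)"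
          using R_mono[OF t True] by (intro mult_right_mono ennreal_leI) auto
        also have "\<dots> = ennreal (R ts * z * g \<theta>)"
          using R(1)[OF ts0] z g(1)[OF \<theta>(1)] by (simp add: ennreal_mult)
        also have "\<dots> \<le> ennreal \<epsilon>" using elim by (intro ennreal_leI) simp
        finally show ?thesis .
      next
        case False
        have "wasserstein (w 0) (\<nu> \<bind> P t \<theta>) (\<nu> \<bind> P t \<theta>0) \<le>
            ennreal B * (ennreal (exp (- t * C2)) * ennreal X + ennreal y * ennreal (g \<theta>))"
          using B(2)[OF \<theta>, of t] False ts(2) X y by simp
        also have "\<dots> = ennreal (B * (exp (- t * C2) * X) + B * (y * g \<theta>))"
          using B(1) X y g(1)[OF \<theta>(1)] by (simp add: ennreal_mult distrib_left)
        also have "\<dots> \<le> ennreal \<epsilon>"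
        proof (rule ennreal_leI)
          have "ts * C2 \<le> t * C2" using False positive by (intro mult_right_mono) auto
          then have "B * (exp (- t * C2) * X) \<le> B * (exp (- ts * C2) * X)"
            using B(1) X by (intro mult_left_mono mult_right_mono) auto
          then show "B * (exp (- t * C2) * X) + B * (y * g \<theta>) \<le> \<epsilon>" using ts elim by simp
        qed
        finally show ?thesis .
      qed
    qed
    then show "sup_dist \<nu> \<theta> < a" using \<epsilon>(2) by simp
  qed
qed simp

end

theorem theorem2p6:
  fixes \<Lambda> :: "('a::{banach, second_countable_topology} \<Rightarrow> 'a \<Rightarrow> real) set"
    and \<Theta> :: "'p::topological_space set"
    and P :: "real \<Rightarrow> 'p \<Rightarrow> 'a \<Rightarrow> 'a measure"
    and \<gamma> \<alpha>' :: real
    and \<mu>inv :: "'p \<Rightarrow> 'a measure"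
    and \<theta>0 :: 'p
    and g :: "real \<Rightarrow> ('a \<Rightarrow> 'a \<Rightarrow> real) \<Rightarrow> 'p \<Rightarrow> real"
    and R :: "real \<Rightarrow> ('a \<Rightarrow> 'a \<Rightarrow> real) \<Rightarrow> real \<Rightarrow> real"
    and f :: "real \<Rightarrow> ('a \<Rightarrow> 'a \<Rightarrow> real) \<Rightarrow> 'a \<Rightarrow> ennreal"
    and \<alpha>4 :: "real \<Rightarrow> real"
    and \<rho>4 :: "real \<Rightarrow> real \<Rightarrow> 'a \<Rightarrow> 'a \<Rightarrow> real"
    and T C1 C2 :: "real \<Rightarrow> real \<Rightarrow> real"
  assumes \<Lambda>: "\<And>\<rho>. \<rho> \<in> \<Lambda> \<Longrightarrow> distance_like \<rho> \<and> (\<forall>u v. \<rho> u v \<le> 1)"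
    and kernels: "\<And>t \<theta>. 0 \<le> t \<Longrightarrow> \<theta> \<in> \<Theta> \<Longrightarrow> markov_kernel (P t \<theta>)"
    and H1: "1 \<le> \<gamma>"
      "\<And>\<rho> \<alpha>. \<rho> \<in> \<Lambda> \<Longrightarrow> 0 < \<alpha> \<Longrightarrow>
         \<exists>C>0. \<forall>u v w. weighted \<rho> \<alpha> u v
                      \<le> C * (weighted \<rho> (\<gamma> * \<alpha>) u w + weighted \<rho> (\<gamma> * \<alpha>) w v)"
    and H2: "\<And>\<theta>. \<theta> \<in> \<Theta> \<Longrightarrow> \<mu>inv \<theta> \<in> Pr \<and> invariant_under (\<lambda>t. P t \<theta>) (\<mu>inv \<theta>)"
    and H3: "\<theta>0 \<in> \<Theta>" "0 < \<alpha>'"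
      "\<And>\<alpha> \<rho>. 0 < \<alpha> \<Longrightarrow> \<alpha> \<le> \<alpha>' \<Longrightarrow> \<rho> \<in> \<Lambda> \<Longrightarrow>
         (\<forall>\<theta>\<in>\<Theta>. 0 \<le> g \<alpha> \<rho> \<theta>) \<and> (\<forall>t\<ge>0. 0 \<le> R \<alpha> \<rho> t) \<and> f \<alpha> \<rho> \<in> borel_measurable borel \<and>
         (\<forall>\<theta>\<in>\<Theta>. \<forall>t\<ge>0. \<forall>u. wasserstein (weighted \<rho> \<alpha>) (P t \<theta> u) (P t \<theta>0 u)
                              \<le> ennreal (R \<alpha> \<rho> t) * f \<alpha> \<rho> u * ennreal (g \<alpha> \<rho> \<theta>))"
    and H4: "\<And>m. 1 \<le> m \<Longrightarrow> 0 < \<alpha>4 m"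
      "\<And>m \<alpha>. 1 \<le> m \<Longrightarrow> 0 < \<alpha> \<Longrightarrow> \<alpha> \<le> \<alpha>4 m \<Longrightarrow>
         \<rho>4 m \<alpha> \<in> \<Lambda> \<and> 0 < T m \<alpha> \<and> 0 < C1 m \<alpha> \<and> 0 < C2 m \<alpha> \<and>
         (\<forall>\<mu>\<in>Pr. \<forall>\<mu>'\<in>Pr. \<forall>t\<ge>T m \<alpha>.
            (SUP \<theta>\<in>\<Theta> - {\<theta>0}. wasserstein (weighted (\<rho>4 m \<alpha>) \<alpha>) (\<mu> \<bind> P t \<theta>) (\<mu>' \<bind> P t \<theta>))
            \<le> ennreal (C1 m \<alpha> * exp (- t * C2 m \<alpha>)) * wasserstein (weighted (\<rho>4 m \<alpha>) (\<alpha> / m)) \<mu> \<mu>')"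
    and H5: "\<And>\<alpha> \<rho>. 0 < \<alpha> \<Longrightarrow> \<alpha> \<le> \<alpha>' \<Longrightarrow> \<rho> \<in> \<Lambda> \<Longrightarrow>
         continuous_on {0..} (R \<alpha> \<rho>) \<and> strict_mono_on {0..} (R \<alpha> \<rho>)"
    and H6: "\<theta>0 islimpt \<Theta>"
      "\<And>\<alpha> \<rho>. 0 < \<alpha> \<Longrightarrow> \<alpha> \<le> \<alpha>' \<Longrightarrow> \<rho> \<in> \<Lambda> \<Longrightarrow>
         bounded (g \<alpha> \<rho> ` \<Theta>) \<and> (g \<alpha> \<rho> \<longlongrightarrow> 0) (at \<theta>0 within \<Theta>)"
    and H7: "\<And>\<alpha> \<rho>. 0 < \<alpha> \<Longrightarrow> \<alpha> \<le> \<alpha>' \<Longrightarrow> \<rho> \<in> \<Lambda> \<Longrightarrow> (\<integral>\<^sup>+ u. f \<alpha> \<rho> u \<partial>\<mu>inv \<theta>0) < \<infinity>"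
  shows "\<exists>\<alpha>hat>0. \<forall>\<alpha>. 0 < \<alpha> \<and> \<alpha> \<le> \<alpha>hat \<longrightarrow>
    (\<exists>\<rho>\<in>\<Lambda>. \<exists>\<beta> m. \<alpha> \<le> \<beta> \<and> \<beta> \<le> \<alpha>' \<and> 1 \<le> m \<and> \<beta> \<le> \<alpha>4 m \<and> \<rho> = \<rho>4 m \<beta> \<and>
      (\<forall>q. 0 < q \<and> q < 1 \<longrightarrow>
        (\<exists>C>0.
          (\<not> bounded (R \<beta> \<rho> ` {0..}) \<longrightarrow>
             (\<forall>\<theta>\<in>\<Theta>. g \<beta> \<rho> \<theta> \<noteq> 0 \<longrightarrow> C * g \<beta> \<rho> \<theta> powr (- q) \<in> R \<beta> \<rho> ` {0..})) \<and>
          (\<forall>\<theta>\<in>\<Theta>. \<forall>\<mu>\<in>Pr. (\<integral>\<^sup>+ u. f \<beta> \<rho> u \<partial>\<mu>) < \<infinity> \<longrightarrow>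
             (SUP t\<in>{0..}. wasserstein (weighted \<rho> \<alpha>) (\<mu> \<bind> P t \<theta>) (\<mu> \<bind> P t \<theta>0))
             \<le> ennreal (rate (R \<beta> \<rho>) C (C2 m \<beta>) q (g \<beta> \<rho> \<theta>)) *
               (wasserstein (weighted \<rho> (\<gamma> * \<alpha>)) \<mu> (\<mu>inv \<theta>0)
                + (\<integral>\<^sup>+ u. f \<beta> \<rho> u \<partial>\<mu>) + (\<integral>\<^sup>+ u. f \<beta> \<rho> u \<partial>\<mu>inv \<theta>0))))) \<and>
      (\<forall>\<mu>\<in>Pr. (\<integral>\<^sup>+ u. f \<beta> \<rho> u \<partial>\<mu>) < \<infinity> \<longrightarrow>
         wasserstein (weighted \<rho> (\<gamma> * \<alpha>)) \<mu> (\<mu>inv \<theta>0) < \<infinity> \<longrightarrow>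
         ((\<lambda>\<theta>. SUP t\<in>{0..}. wasserstein (weighted \<rho> \<alpha>) (\<mu> \<bind> P t \<theta>) (\<mu> \<bind> P t \<theta>0))
            \<longlongrightarrow> 0) (at \<theta>0 within \<Theta>)))"
proof -
  \<comment> \<open>Five triangle inequalities lead from the exponent \<open>\<alpha>\<close> to \<open>\<beta> = \<gamma>\<^sup>5 \<alpha>\<close>, and contraction has to lead back to \<open>\<gamma> \<alpha>\<close>.\<close>
  define m where "m = \<gamma> ^ 4"
  define \<alpha>hat where "\<alpha>hat = min \<alpha>' (\<alpha>4 m) / \<gamma> ^ 5"
  have \<gamma>: "0 < \<gamma>" using H1(1) by simp
  have m: "1 \<le> m" unfolding m_def by (rule one_le_power[OF H1(1)])
  show ?thesis
  proof (intro exI[of _ \<alpha>hat] conjI allI impI)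
    show "0 < \<alpha>hat" using H3(2) H4(1)[OF m] \<gamma> by (simp add: \<alpha>hat_def)
    fix \<alpha> assume "0 < \<alpha> \<and> \<alpha> \<le> \<alpha>hat"
    then have \<alpha>: "0 < \<alpha>" "\<alpha> \<le> \<alpha>hat" by auto
    define \<beta> where "\<beta> = \<gamma> ^ 5 * \<alpha>"
    define \<rho> where "\<rho> = \<rho>4 m \<beta>"
    have "\<beta> \<le> min \<alpha>' (\<alpha>4 m)" using \<alpha> \<gamma> by (simp add: \<beta>_def \<alpha>hat_def field_simps)
    then have \<beta>: "0 < \<beta>" "\<beta> \<le> \<alpha>'" "\<beta> \<le> \<alpha>4 m" using \<alpha> \<gamma> by (auto simp: \<beta>_def)
    have "1 * \<alpha> \<le> \<beta>" unfolding \<beta>_def using \<alpha> by (intro mult_right_mono one_le_power H1(1)) auto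
    then have \<alpha>\<beta>: "\<alpha> \<le> \<beta>" by simp
    have \<beta>m: "\<beta> / m = \<gamma> * \<alpha>" using \<gamma> by (simp add: \<beta>_def m_def eval_nat_numeral)
    note h4 = H4(2)[OF m \<beta>(1,3), folded \<rho>_def, unfolded \<beta>m]
    have \<rho>: "\<rho> \<in> \<Lambda>" using h4 by blast
    note dl = \<Lambda>[OF \<rho>, THEN conjunct1]
    note h3 = H3(3)[OF \<beta>(1,2) \<rho>] and h5 = H5[OF \<beta>(1,2) \<rho>] and h6 = H6(2)[OF \<beta>(1,2) \<rho>]
    define w where "w i = weighted \<rho> (\<gamma> ^ i * \<alpha>)" for i :: nat
    have w0: "w 0 = weighted \<rho> \<alpha>" and w1: "w 1 = weighted \<rho> (\<gamma> * \<alpha>)" and w5: "w 5 = weighted \<rho> \<beta>"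
      by (simp_all add: w_def \<beta>_def)
    have "\<exists>C>0. \<forall>u v x. w i u v \<le> C * (w (Suc i) u x + w (Suc i) x v)" for i
      using H1(2)[OF \<rho>, of "\<gamma> ^ i * \<alpha>"] \<gamma> \<alpha>(1) by (simp add: w_def mult.assoc)
    then obtain Cf where Cf: "\<And>i. 0 < Cf i" "\<And>i u v x. w i u v \<le> Cf i * (w (Suc i) u x + w (Suc i) x v)"
      by metis
    define D where "D = 1 + (\<Sum>i<5::nat. Cf i)"
    have wnn: "0 \<le> w i u v" for i u v using lsc_cost_weighted[OF dl] by (simp add: w_def lsc_cost_def)
    interpret perturbed_kernels P \<Theta> \<theta>0 \<mu>inv w D "T m \<beta>" "C1 m \<beta>" "C2 m \<beta>" "R \<beta> \<rho>" "f \<beta> \<rho>" "g \<beta> \<rho>"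
    proof
      show "w i u v \<le> D * (w (Suc i) u x + w (Suc i) x v)" if "i < 5" for i u v x
      proof -
        have "Cf i \<le> (\<Sum>i<5. Cf i)" using that Cf(1) by (intro member_le_sum) (auto intro: less_imp_le)
        then have "Cf i \<le> D" by (simp add: D_def)
        then show ?thesis using wnn by (intro order_trans[OF Cf(2) mult_right_mono]) (auto intro: add_nonneg_nonneg)
      qed
      show "1 \<le> D" using sum_nonneg[of "{..<5}" Cf] Cf(1) by (simp add: D_def less_imp_le)
      show "wasserstein (w 5) (\<mu> \<bind> P t \<theta>) (\<nu> \<bind> P t \<theta>)
          \<le> ennreal (C1 m \<beta> * exp (- t * C2 m \<beta>)) * wasserstein (w 1) \<mu> \<nu>"
        if "\<theta> \<in> \<Theta>" "\<theta> \<noteq> \<theta>0" "T m \<beta> \<le> t" "\<mu> \<in> Pr" "\<nu> \<in> Pr" for \<theta> t \<mu> \<nu>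
      proof -
        have "wasserstein (w 5) (\<mu> \<bind> P t \<theta>) (\<nu> \<bind> P t \<theta>)
            \<le> (SUP \<theta>\<in>\<Theta> - {\<theta>0}. wasserstein (w 5) (\<mu> \<bind> P t \<theta>) (\<nu> \<bind> P t \<theta>))"
          using that by (intro SUP_upper) auto
        also have "\<dots> \<le> ennreal (C1 m \<beta> * exp (- t * C2 m \<beta>)) * wasserstein (w 1) \<mu> \<nu>"
          unfolding w5 w1 using h4 that by blast
        finally show ?thesis .
      qed
      show "w i u v \<le> w j u v" if "i \<le> j" for i j u v
        unfolding w_def using that \<alpha> H1(1)
        by (intro weighted_mono[OF dl] mult_right_mono power_increasing) auto
      show "wasserstein (w 5) (P t \<theta> u) (P t \<theta>0 u) \<le> ennreal (R \<beta> \<rho> t) * f \<beta> \<rho> u * ennreal (g \<beta> \<rho> \<theta>)"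
        if "\<theta> \<in> \<Theta>" "0 \<le> t" for \<theta> t u
        unfolding w5 using h3 that by blast
    qed (use h3 h4 h5 h6 H2 H3 H6(1) H7[OF \<beta>(1,2) \<rho>] kernels in
        \<open>auto simp: w_def lsc_cost_weighted[OF dl] weighted_sym[OF dl] weighted_refl[OF dl] invariant_under_def\<close>)
    obtain G where G: "0 < G" "\<And>\<theta>. \<theta> \<in> \<Theta> \<Longrightarrow> g \<beta> \<rho> \<theta> \<le> G"
    proof -
      obtain G' where "\<And>\<theta>. \<theta> \<in> \<Theta> \<Longrightarrow> \<bar>g \<beta> \<rho> \<theta>\<bar> \<le> G'" using h6 by (auto simp: bounded_iff)
      then show thesis by (intro that[of "max G' 1"]) (auto simp: abs_le_iff le_max_iff_disj)
    qed
    show "\<exists>\<rho>\<in>\<Lambda>. \<exists>\<beta> m. \<alpha> \<le> \<beta> \<and> \<beta> \<le> \<alpha>' \<and> 1 \<le> m \<and> \<beta> \<le> \<alpha>4 m \<and> \<rho> = \<rho>4 m \<beta> \<and>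
      (\<forall>q. 0 < q \<and> q < 1 \<longrightarrow>
        (\<exists>C>0.
          (\<not> bounded (R \<beta> \<rho> ` {0..}) \<longrightarrow>
             (\<forall>\<theta>\<in>\<Theta>. g \<beta> \<rho> \<theta> \<noteq> 0 \<longrightarrow> C * g \<beta> \<rho> \<theta> powr (- q) \<in> R \<beta> \<rho> ` {0..})) \<and>
          (\<forall>\<theta>\<in>\<Theta>. \<forall>\<mu>\<in>Pr. (\<integral>\<^sup>+ u. f \<beta> \<rho> u \<partial>\<mu>) < \<infinity> \<longrightarrow>
             (SUP t\<in>{0..}. wasserstein (weighted \<rho> \<alpha>) (\<mu> \<bind> P t \<theta>) (\<mu> \<bind> P t \<theta>0))
             \<le> ennreal (rate (R \<beta> \<rho>) C (C2 m \<beta>) q (g \<beta> \<rho> \<theta>)) *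
               (wasserstein (weighted \<rho> (\<gamma> * \<alpha>)) \<mu> (\<mu>inv \<theta>0)
                + (\<integral>\<^sup>+ u. f \<beta> \<rho> u \<partial>\<mu>) + (\<integral>\<^sup>+ u. f \<beta> \<rho> u \<partial>\<mu>inv \<theta>0))))) \<and>
      (\<forall>\<mu>\<in>Pr. (\<integral>\<^sup>+ u. f \<beta> \<rho> u \<partial>\<mu>) < \<infinity> \<longrightarrow>
         wasserstein (weighted \<rho> (\<gamma> * \<alpha>)) \<mu> (\<mu>inv \<theta>0) < \<infinity> \<longrightarrow>
         ((\<lambda>\<theta>. SUP t\<in>{0..}. wasserstein (weighted \<rho> \<alpha>) (\<mu> \<bind> P t \<theta>) (\<mu> \<bind> P t \<theta>0))
            \<longlongrightarrow> 0) (at \<theta>0 within \<Theta>))"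
    proof (rule bexI[OF _ \<rho>], rule exI[of _ \<beta>], rule exI[of _ m],
        intro conjI allI impI ballI \<alpha>\<beta> \<beta>(2,3) m \<rho>_def)
      fix q :: real assume "0 < q \<and> q < 1"
      then have q: "0 < q" by simp
      show "\<exists>C>0.
          (\<not> bounded (R \<beta> \<rho> ` {0..}) \<longrightarrow>
             (\<forall>\<theta>\<in>\<Theta>. g \<beta> \<rho> \<theta> \<noteq> 0 \<longrightarrow> C * g \<beta> \<rho> \<theta> powr (- q) \<in> R \<beta> \<rho> ` {0..})) \<and>
          (\<forall>\<theta>\<in>\<Theta>. \<forall>\<mu>\<in>Pr. (\<integral>\<^sup>+ u. f \<beta> \<rho> u \<partial>\<mu>) < \<infinity> \<longrightarrow>
             (SUP t\<in>{0..}. wasserstein (weighted \<rho> \<alpha>) (\<mu> \<bind> P t \<theta>) (\<mu> \<bind> P t \<theta>0))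
             \<le> ennreal (rate (R \<beta> \<rho>) C (C2 m \<beta>) q (g \<beta> \<rho> \<theta>)) *
               (wasserstein (weighted \<rho> (\<gamma> * \<alpha>)) \<mu> (\<mu>inv \<theta>0)
                + (\<integral>\<^sup>+ u. f \<beta> \<rho> u \<partial>\<mu>) + (\<integral>\<^sup>+ u. f \<beta> \<rho> u \<partial>\<mu>inv \<theta>0)))"
      proof (cases "bounded (R \<beta> \<rho> ` {0..})")
        case True
        then show ?thesis using uniform_in_time_bounded[OF True, of q] unfolding w0 w1 by blast
      next
        case False
        then show ?thesis using uniform_in_time_unbounded[OF False G q] unfolding w0 w1 by blast
      qed
    next
      fix \<mu> :: "'a measure"
      assume "\<mu> \<in> Pr" "(\<integral>\<^sup>+ u. f \<beta> \<rho> u \<partial>\<mu>) < \<infinity>"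
        "wasserstein (weighted \<rho> (\<gamma> * \<alpha>)) \<mu> (\<mu>inv \<theta>0) < \<infinity>"
      then show "((\<lambda>\<theta>. SUP t\<in>{0..}. wasserstein (weighted \<rho> \<alpha>) (\<mu> \<bind> P t \<theta>) (\<mu> \<bind> P t \<theta>0))
            \<longlongrightarrow> 0) (at \<theta>0 within \<Theta>)"
        using sup_dist_tendsto_0[of \<mu>] unfolding w0 w1 by blast
    qed
  qed
qed

end
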